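(* Let $a<b$ and $\tau>0$ be fixed. Let $g:\mathbb{R}\to\mathbb{R}$ be locally Lipschitz continuous and suppose there is a constant $\sigma>0$ with $g(s)\ge\sigma$ for all $s\in\mathbb{R}$. Let $f=-F'$, where $F:\mathbb{R}\to\mathbb{R}$ satisfies: $F\in C^3(\mathbb{R})$ and $F(u)\to+\infty$ as $|u|\to\infty$; $F(\pm1)=F'(\pm1)=0$, $F''(-1)>0$, $F''(1)>0$; and $\{u\in\mathbb{R}: F'(u)=0,\ F(u)\le 0\}=\{-1,1\}$. Let $N\ge1$ be an integer, let $v:(a,b)\to\{-1,+1\}$ be a piecewise constant function with exactly $N$ discontinuities, and put $c_0:=\sqrt2\int_{-1}^1\sqrt{F(s)}\,ds$. For each sufficiently small $\varepsilon>0$ let $(u_0^\varepsilon,u_1^\varepsilon)\in H^1([a,b])\times L^2(a,b)$, and let $k$ be a positive integer. Assume $$\lim_{\varepsilon\to0}\|u_0^\varepsilon-v\|_{L^1(a,b)}=0,$$ and that there exists $C>0$ such that for all sufficiently small $\varepsilon>0$ $$\int_a^b\left[\frac{\tau}{2\varepsilon}(u_1^\varepsilon)^2+\frac{\varepsilon}{2}\big((u_0^\varepsilon)_x\big)^2+\frac{F(u_0^\varepsilon)}{\varepsilon}\right]dx\le Nc_0+C\varepsilon^k.$$ Let $u^\varepsilon$ be the (mild) solution of $$\tau u_{tt}+g(u)u_t=\varepsilon^2u_{xx}+f(u)\quad (x\in[a,b],\ t>0),\qquad u_x(a,t)=u_x(b,t)=0\quad (t>0),$$ $$u(x,0)=u_0^\varepsilon(x),\qquad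 u_t(x,0)=u_1^\varepsilon(x)\quad (x\in[a,b]).$$ Then for any $m>0$ $$\sup_{0\le t\le m\varepsilon^{-k}}\|u^\varepsilon(\cdot,t)-v\|_{L^1(a,b)}\longrightarrow0\qquad\text{as }\varepsilon\to0.$$
   Context: Mild solution: write $X=H^1([a,b])\times L^2(a,b)$ (real Hilbert space). Let $A$ be the operator $A(u,w)=(w-u,\ \varepsilon^2\tau^{-1}u_{xx}-w)$ with domain $D(A)=\{(u,w)\in H^2([a,b])\times H^1([a,b]): u_x(a)=u_x(b)=0\}$; it generates a contraction semigroup $(S(t))_{t\ge0}$ on $X$ with respect to the scalar product $\langle(u,w),(\tilde u,\tilde w)\rangle_X=\int_a^b(\varepsilon^2u_x\tilde u_x+\tau u\tilde u+\tau w\tilde w)\,dx$. Let $\Phi(u,w)=(u,\ w+\tau^{-1}(f(u)-g(u)w))$. The mild solution with initial data $(u_0,u_1)\in X$ is the function $y=(u,u_t)\in C([0,\infty),X)$ satisfying $y(t)=S(t)(u_0,u_1)+\int_0^tS(t-s)\Phi(y(s))\,ds$ for all $t\ge0$. Under the stated assumptions it exists and is unique. *)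

theory Defs
  imports "HOL-Analysis.Analysis" "HOL-Library.Function_Algebras"
begin

instantiation "fun" :: (type, real_vector) real_vector
begin

definition scaleR_fun :: "real \<Rightarrow> ('a \<Rightarrow> 'b) \<Rightarrow> 'a \<Rightarrow> 'b"
  where "scaleR_fun c u = (\<lambda>x. c *\<^sub>R u x)"

instance
  by standard (simp_all add: scaleR_fun_def fun_eq_iff scaleR_add_right scaleR_add_left)

end

definition C_k :: "nat \<Rightarrow> (real \<Rightarrow> real) \<Rightarrow> bool"
  where "C_k n F \<longleftrightarrow>
    (\<forall>j<n. \<forall>x. (deriv ^^ j) F differentiable (at x)) \<and> continuous_on UNIV ((deriv ^^ n) F)"

text \<open>The pieces are required to be nondegenerate intervals. Hence every discontinuity of a
  piecewise constant function is a genuine jump, and changing the function at a single point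
  inside a piece is excluded.\<close>

definition piecewise_constant :: "real \<Rightarrow> real \<Rightarrow> (real \<Rightarrow> real) \<Rightarrow> bool"
  where "piecewise_constant a b v \<longleftrightarrow>
    (\<exists>P. finite P \<and> partition_on {a<..<b} P \<and>
      (\<forall>I\<in>P. is_interval I \<and> interior I \<noteq> {} \<and> v constant_on I))"

text \<open>Elements of the Lebesgue and Sobolev spaces on \<open>(a, b)\<close> are represented by functions;
  functions that agree almost everywhere on \<open>(a, b)\<close> represent the same element, so equality of
  elements is always expressed by a vanishing (semi)norm of the difference.\<close>

definition L1_norm :: "real \<Rightarrow> real \<Rightarrow> (real \<Rightarrow> real) \<Rightarrow> real"
  where "L1_norm a b u = (LINT x|lebesgue_on {a<..<b}. \<bar>u x\<bar>)"

definition L2 :: "real \<Rightarrow> real \<Rightarrow> (real \<Rightarrow> real) set"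
  where "L2 a b = {u. u \<in> borel_measurable (lebesgue_on {a<..<b}) \<and>
    integrable (lebesgue_on {a<..<b}) (\<lambda>x. (u x)\<^sup>2)}"

definition L2_norm :: "real \<Rightarrow> real \<Rightarrow> (real \<Rightarrow> real) \<Rightarrow> real"
  where "L2_norm a b u = sqrt (LINT x|lebesgue_on {a<..<b}. (u x)\<^sup>2)"

text \<open>As usual in one space dimension (e.g. Brezis, Functional Analysis, Sobolev Spaces and
  Partial Differential Equations, Section 8.2), weak derivatives are tested against compactly
  supported functions of class \<open>C\<^sup>1\<close>.\<close>

definition test_functions :: "real \<Rightarrow> real \<Rightarrow> (real \<Rightarrow> real) set"
  where "test_functions a b =
    {\<phi>. C_k 1 \<phi> \<and> (\<exists>K. compact K \<and> K \<subseteq> {a<..<b} \<and> (\<forall>x. x \<notin> K \<longrightarrow> \<phi> x = 0))}"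

definition has_weak_deriv :: "real \<Rightarrow> real \<Rightarrow> (real \<Rightarrow> real) \<Rightarrow> (real \<Rightarrow> real) \<Rightarrow> bool"
  where "has_weak_deriv a b u u' \<longleftrightarrow>
    (\<forall>\<phi>\<in>test_functions a b.
      (LINT x|lebesgue_on {a<..<b}. u x * deriv \<phi> x) =
      - (LINT x|lebesgue_on {a<..<b}. u' x * \<phi> x))"

definition H1 :: "real \<Rightarrow> real \<Rightarrow> (real \<Rightarrow> real) set"
  where "H1 a b = {u \<in> L2 a b. \<exists>u'\<in>L2 a b. has_weak_deriv a b u u'}"

text \<open>The weak derivative of an \<open>H\<^sup>1\<close> function, unique up to almost everywhere equality.\<close>

definition wderiv :: "real \<Rightarrow> real \<Rightarrow> (real \<Rightarrow> real) \<Rightarrow> real \<Rightarrow> real"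
  where "wderiv a b u = (SOME u'. u' \<in> L2 a b \<and> has_weak_deriv a b u u')"

definition H2 :: "real \<Rightarrow> real \<Rightarrow> (real \<Rightarrow> real) set"
  where "H2 a b = {u \<in> H1 a b. wderiv a b u \<in> H1 a b}"

type_synonym state = "(real \<Rightarrow> real) \<times> (real \<Rightarrow> real)"

definition X_space :: "real \<Rightarrow> real \<Rightarrow> state set"
  where "X_space a b = H1 a b \<times> L2 a b"

definition X_inner :: "real \<Rightarrow> real \<Rightarrow> real \<Rightarrow> real \<Rightarrow> state \<Rightarrow> state \<Rightarrow> real"
  where "X_inner a b \<tau> \<epsilon> = (\<lambda>(u, w) (u', w').
    LINT x|lebesgue_on {a<..<b}.
      \<epsilon>\<^sup>2 * wderiv a b u x * wderiv a b u' x + \<tau> * u x * u' x + \<tau> * w x * w' x)"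

definition X_norm :: "real \<Rightarrow> real \<Rightarrow> real \<Rightarrow> real \<Rightarrow> state \<Rightarrow> real"
  where "X_norm a b \<tau> \<epsilon> y = sqrt (X_inner a b \<tau> \<epsilon> y y)"

text \<open>The boundary values of \<open>u\<^sub>x\<close> are those of its representative \<open>c\<close> that is continuous
  on \<open>[a, b]\<close>.\<close>

definition dom_A :: "real \<Rightarrow> real \<Rightarrow> state set"
  where "dom_A a b = {(u, w). u \<in> H2 a b \<and> w \<in> H1 a b \<and>
    (\<exists>c. continuous_on {a..b} c \<and> (AE x in lebesgue_on {a<..<b}. c x = wderiv a b u x) \<and>
      c a = 0 \<and> c b = 0)}"

definition op_A :: "real \<Rightarrow> real \<Rightarrow> real \<Rightarrow> real \<Rightarrow> state \<Rightarrow> state"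
  where "op_A a b \<tau> \<epsilon> = (\<lambda>(u, w).
    (\<lambda>x. w x - u x, \<lambda>x. \<epsilon>\<^sup>2 / \<tau> * wderiv a b (wderiv a b u) x - w x))"

definition Phi :: "real \<Rightarrow> (real \<Rightarrow> real) \<Rightarrow> (real \<Rightarrow> real) \<Rightarrow> state \<Rightarrow> state"
  where "Phi \<tau> f g = (\<lambda>(u, w). (u, \<lambda>x. w x + (f (u x) - g (u x) * w x) / \<tau>))"

text \<open>Strongly continuous contraction semigroups on a subspace \<open>X\<close> with seminorm \<open>nrm\<close>, elements
  at seminorm distance zero being identified.\<close>

definition contraction_semigroup ::
    "'x::real_vector set \<Rightarrow> ('x \<Rightarrow> real) \<Rightarrow> (real \<Rightarrow> 'x \<Rightarrow> 'x) \<Rightarrow> bool"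
  where "contraction_semigroup X nrm S \<longleftrightarrow>
    (\<forall>t\<ge>0. \<forall>x\<in>X. S t x \<in> X) \<and>
    (\<forall>t\<ge>0. \<forall>x\<in>X. \<forall>y\<in>X. nrm (S t (x + y) - (S t x + S t y)) = 0) \<and>
    (\<forall>t\<ge>0. \<forall>x\<in>X. \<forall>c. nrm (S t (c *\<^sub>R x) - c *\<^sub>R S t x) = 0) \<and>
    (\<forall>x\<in>X. nrm (S 0 x - x) = 0) \<and>
    (\<forall>s\<ge>0. \<forall>t\<ge>0. \<forall>x\<in>X. nrm (S (s + t) x - S s (S t x)) = 0) \<and>
    (\<forall>x\<in>X. ((\<lambda>t. nrm (S t x - x)) \<longlongrightarrow> 0) (at_right 0)) \<and>
    (\<forall>t\<ge>0. \<forall>x\<in>X. nrm (S t x) \<le> nrm x)"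

definition generates_contraction_semigroup ::
    "'x::real_vector set \<Rightarrow> ('x \<Rightarrow> real) \<Rightarrow> 'x set \<Rightarrow> ('x \<Rightarrow> 'x) \<Rightarrow> (real \<Rightarrow> 'x \<Rightarrow> 'x) \<Rightarrow> bool"
  where "generates_contraction_semigroup X nrm D A S \<longleftrightarrow>
    contraction_semigroup X nrm S \<and>
    (\<forall>x\<in>X. \<forall>z\<in>X.
      ((\<lambda>h. nrm ((1 / h) *\<^sub>R (S h x - x) - z)) \<longlongrightarrow> 0) (at_right 0) \<longleftrightarrow>
      x \<in> D \<and> nrm (A x - z) = 0)"

text \<open>The Riemann integral of \<open>h\<close> over \<open>[s, t]\<close> with respect to \<open>nrm\<close> is \<open>z\<close>. Below it is
  only applied to continuous integrands with values in a Hilbert space, for which it coincides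
  with the Bochner integral.\<close>

definition has_riemann_integral ::
    "('x::real_vector \<Rightarrow> real) \<Rightarrow> (real \<Rightarrow> 'x) \<Rightarrow> 'x \<Rightarrow> real \<Rightarrow> real \<Rightarrow> bool"
  where "has_riemann_integral nrm h z s t \<longleftrightarrow>
    (\<forall>e>0. \<exists>d>0. \<forall>p. p tagged_division_of {s..t} \<and> (\<lambda>r. ball r d) fine p \<longrightarrow>
      nrm ((\<Sum>(r, K)\<in>p. measure lborel K *\<^sub>R h r) - z) < e)"

text \<open>\<open>y t = (u(t), u\<^sub>t(t))\<close>, where \<open>u\<^sub>t\<close> is the time derivative of \<open>u\<close> as a function with values
  in \<open>L\<^sup>2(a, b)\<close>. The semigroup \<open>S\<close> is uniquely determined by its generator.\<close>

definition mild_solution ::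
    "real \<Rightarrow> real \<Rightarrow> real \<Rightarrow> real \<Rightarrow> (real \<Rightarrow> real) \<Rightarrow> (real \<Rightarrow> real) \<Rightarrow> state \<Rightarrow> (real \<Rightarrow> state) \<Rightarrow> bool"
  where "mild_solution a b \<tau> \<epsilon> f g y0 y \<longleftrightarrow>
    (\<forall>t\<ge>0. y t \<in> X_space a b) \<and>
    (\<forall>t\<ge>0. ((\<lambda>s. X_norm a b \<tau> \<epsilon> (y s - y t)) \<longlongrightarrow> 0) (at t within {0..})) \<and>
    (\<forall>t\<ge>0. ((\<lambda>s. L2_norm a b ((1 / (s - t)) *\<^sub>R (fst (y s) - fst (y t)) - snd (y t))) \<longlongrightarrow> 0)
      (at t within {0..})) \<and>
    (\<exists>S. generates_contraction_semigroup (X_space a b) (X_norm a b \<tau> \<epsilon>)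
        (dom_A a b) (op_A a b \<tau> \<epsilon>) S \<and>
      (\<forall>t\<ge>0. has_riemann_integral (X_norm a b \<tau> \<epsilon>)
        (\<lambda>s. S (t - s) (Phi \<tau> f g (y s))) (y t - S t y0) 0 t))"

end

theory Submission
  imports Defs
begin

text \<open>Write \<open>E\<close> for the integral of \<open>\<tau>/2 u\<^sub>t\<^sup>2 + \<epsilon>\<^sup>2/2 u\<^sub>x\<^sup>2 + F(u)\<close>, that is \<open>\<epsilon>\<close> times the energy of the
  statement. Its upper right derivative along a mild solution is at most \<open>-\<sigma> \<parallel>u\<^sub>t\<parallel>\<^sup>2\<close>: the quadratic
  part of \<open>E\<close> decays like \<open>exp (- 2 t)\<close> under the semigroup of \<open>A\<close> (a computation on the
  domain of \<open>A\<close>, extended by density), and \<open>y (t + h) = S h (y t) + h \<Phi> (y t) + o(h)\<close>.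

  On the other hand, following Bronsard and Kohn, a function that is \<open>L\<^sub>1\<close>-close to \<open>v\<close> and whose
  energy is at most \<open>N c\<^sub>0 + C \<epsilon>\<^sup>k\<close> has energy at least \<open>N c\<^sub>0 - C' \<epsilon>\<^sup>k\<close>. A lower bound with error
  \<open>\<epsilon>\<^sup>j\<close> on windows around the jumps leaves energy \<open>O(\<epsilon>\<^sup>j)\<close> outside, so there are points next to each
  window where \<open>F(u) = O(\<epsilon>\<^bsup>j+1\<^esup>)\<close>; the transition between two such points costs
  \<open>c\<^sub>0 - O(\<epsilon>\<^bsup>j+1\<^esup>)\<close>, because the wells are nondegenerate.

  Hence, as long as \<open>u\<close> stays close to \<open>v\<close>, only \<open>O(\<epsilon>\<^bsup>k+1\<^esup>)\<close> of \<open>E\<close> can be dissipated, and by the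
  Cauchy-Schwarz inequality \<open>u\<close> moves by at most \<open>O(\<surd>\<epsilon>)\<close> in \<open>L\<^sub>1\<close> up to time \<open>m \<epsilon>\<^bsup>-k\<^esup>\<close>. By continuity
  in time \<open>u\<close> therefore never leaves the neighbourhood of \<open>v\<close>.\<close>

subsection \<open>Semi-inner product spaces and mild solutions\<close>

text \<open>Mild solutions need not lie in the domain of \<open>A\<close>, so the energy cannot be
  differentiated by inserting the equation. One-sided estimates suffice: a bound on an upper right
  derivative is turned into monotonicity, for the energy and again for the distance travelled. The
  form of \<Phi> explains the signs: the \<open>w\<close> in its second component cancels the
  damping \<open>- w\<close> built into \<open>A\<close>, so that only \<open>f(u) - g(u) w\<close>
  works on \<open>w\<close>. The spaces consist of functions and not of classes, hence vector space
  identities hold up to seminorm zero, and the abstract part is written for semi-inner products on a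
  subspace. Point values of \<open>H1\<close> functions are read off the continuous representative
  \<open>c + prim (wderiv a b u)\<close>. The gain of a power of \<epsilon> per window rests on the
  nondegenerate wells: the deficit of a transition is linear in \<open>F\<close>, and
  \<open>F\<close> is smaller by a factor \<epsilon> than the energy left over. A weight of order
  \<epsilon>^(-k-1/2) balances the dissipated energy against the length of the time
  interval.\<close>

lemma dini_nonincreasing:
  fixes \<phi> :: "real \<Rightarrow> real"
  assumes "s \<le> t" and cont: "continuous_on {s..t} \<phi>"
    and dini: "\<And>r e. s \<le> r \<Longrightarrow> r < t \<Longrightarrow> e > 0 \<Longrightarrow>
      \<forall>\<^sub>F h in at_right 0. \<phi> (r + h) \<le> \<phi> r + e * h"
  shows "\<phi> t \<le> \<phi> s"
proof (rule field_le_epsilon)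
  fix e0 :: real
  assume "e0 > 0"
  define e where "e = e0 / (t - s + 1)"
  have e: "e > 0" "e * (t - s) \<le> e0"
    using \<open>e0 > 0\<close> \<open>s \<le> t\<close> by (auto simp: e_def field_simps)
  \<comment> \<open>The points where \<open>\<phi>\<close> stays below the line of slope
    \<open>e\<close> through its starting value. At the last such point the Dini estimate would
    produce a later one, unless that point is \<open>t\<close>.\<close>
  define A where "A = {r \<in> {s..t}. \<phi> r - e * (r - s) \<le> \<phi> s}"
  have "closed A"
    unfolding A_def by (intro continuous_on_closed_Collect_le continuous_intros cont closed_atLeastAtMost)
  then have "compact ({s..t} \<inter> A)"
    by (rule compact_Int_closed[OF compact_Icc])
  also have "{s..t} \<inter> A = A"
    by (auto simp: A_def)
  finally have "compact A" .
  moreover have "s \<in> A"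
    using \<open>s \<le> t\<close> by (auto simp: A_def)
  ultimately obtain r where r: "r \<in> A" "\<And>r'. r' \<in> A \<Longrightarrow> r' \<le> r"
    using compact_attains_sup[of A] by blast
  have "r = t"
  proof (rule ccontr)
    assume "r \<noteq> t"
    with r have "s \<le> r" "r < t" by (auto simp: A_def)
    from dini[OF this e(1)] have "\<forall>\<^sub>F h in at_right 0. \<phi> (r + h) \<le> \<phi> r + e * h" .
    moreover have "\<forall>\<^sub>F h in at_right 0. h \<in> {0<..<t - r}"
      using \<open>r < t\<close> by (intro eventually_at_right_real) auto
    ultimately have "\<forall>\<^sub>F h in at_right 0. h \<in> {0<..<t - r} \<and> \<phi> (r + h) \<le> \<phi> r + e * h"
      by eventually_elim auto
    then obtain h where h: "0 < h" "h < t - r" "\<phi> (r + h) \<le> \<phi> r + e * h"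
      using eventually_happens'[of "at_right (0::real)"] by (auto simp: trivial_limit_at_right_real)
    then have "r + h \<in> A"
      using r \<open>s \<le> r\<close> by (auto simp: A_def algebra_simps)
    from r(2)[OF this] h show False by simp
  qed
  with r e show "\<phi> t \<le> \<phi> s + e0" by (auto simp: A_def)
qed

text \<open>Functions that agree almost everywhere stay distinct, so \<open>B x x = 0\<close> must
  not force \<open>x = 0\<close>. The spaces are sets of functions and not types, hence the carrier
  \<open>X\<close> and the membership premises.\<close>

locale semi_inner =
  fixes X :: "'x::real_vector set" and B :: "'x \<Rightarrow> 'x \<Rightarrow> real"
  assumes sub: "subspace X"
    and sym: "x \<in> X \<Longrightarrow> y \<in> X \<Longrightarrow> B x y = B y x"
    and add_left: "x \<in> X \<Longrightarrow> y \<in> X \<Longrightarrow> z \<in> X \<Longrightarrow> B (x + y) z = B x z + B y z"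
    and scale_left: "x \<in> X \<Longrightarrow> y \<in> X \<Longrightarrow> B (c *\<^sub>R x) y = c * B x y"
    and nonneg: "x \<in> X \<Longrightarrow> B x x \<ge> 0"
begin

definition nrm :: "'x \<Rightarrow> real" where "nrm x = sqrt (B x x)"

lemma mem [simp, intro]:
  "0 \<in> X" "x \<in> X \<Longrightarrow> y \<in> X \<Longrightarrow> x + y \<in> X" "x \<in> X \<Longrightarrow> y \<in> X \<Longrightarrow> x - y \<in> X"
  "x \<in> X \<Longrightarrow> c *\<^sub>R x \<in> X" "x \<in> X \<Longrightarrow> - x \<in> X"
  using sub by (auto simp: subspace_def subspace_diff subspace_neg)

lemma sum_mem [intro]: "(\<And>i. i \<in> I \<Longrightarrow> g i \<in> X) \<Longrightarrow> sum g I \<in> X"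
  using sub by (rule subspace_sum)

lemma add_right: "x \<in> X \<Longrightarrow> y \<in> X \<Longrightarrow> z \<in> X \<Longrightarrow> B z (x + y) = B z x + B z y"
  using add_left sym by simp

lemma scale_right: "x \<in> X \<Longrightarrow> y \<in> X \<Longrightarrow> B y (c *\<^sub>R x) = c * B y x"
  using scale_left sym by simp

lemma diff_left: "x \<in> X \<Longrightarrow> y \<in> X \<Longrightarrow> z \<in> X \<Longrightarrow> B (x - y) z = B x z - B y z"
  using add_left[of x "(-1) *\<^sub>R y" z] scale_left[of y z "-1"] by simp

lemma diff_right: "x \<in> X \<Longrightarrow> y \<in> X \<Longrightarrow> z \<in> X \<Longrightarrow> B z (x - y) = B z x - B z y"
  using diff_left sym by simp

lemmas bilin = add_left add_right scale_left scale_right diff_left diff_right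

lemma nrm_sq: "x \<in> X \<Longrightarrow> (nrm x)\<^sup>2 = B x x"
  by (simp add: nrm_def nonneg)

lemma nrm_nonneg [simp]: "x \<in> X \<Longrightarrow> 0 \<le> nrm x"
  by (simp add: nrm_def nonneg)

lemma cauchy_schwarz:
  assumes "x \<in> X" "y \<in> X"
  shows "\<bar>B x y\<bar> \<le> nrm x * nrm y"
proof -
  have quad: "0 \<le> B x x - 2 * c * B x y + c\<^sup>2 * B y y" for c
  proof -
    have "0 \<le> B (x - c *\<^sub>R y) (x - c *\<^sub>R y)"
      using assms by (intro nonneg) auto
    also have "\<dots> = B x x - 2 * c * B x y + c\<^sup>2 * B y y"
      using assms sym[of x y] by (simp add: bilin power2_eq_square algebra_simps)
    finally show ?thesis .
  qed
  have "(B x y)\<^sup>2 \<le> B x x * B y y"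
  proof (cases "B y y = 0")
    case True
    have "B x y = 0"
    proof (rule ccontr)
      assume "B x y \<noteq> 0"
      \<comment> \<open>In this case the quadratic is affine in \<open>c\<close>, and at this value
        of \<open>c\<close> it equals \<open>-1\<close>.\<close>
      with quad[of "(B x x + 1) / (2 * B x y)"] True show False by simp
    qed
    then show ?thesis using True by simp
  next
    case False
    with nonneg[OF assms(2)] have "B y y > 0" by simp
    with quad[of "B x y / B y y"] show ?thesis
      by (simp add: field_simps power2_eq_square)
  qed
  then have "sqrt ((B x y)\<^sup>2) \<le> sqrt (B x x * B y y)"
    by (rule real_sqrt_le_mono)
  then show ?thesis
    by (simp add: nrm_def real_sqrt_mult)
qed

lemma nrm_scale: "x \<in> X \<Longrightarrow> nrm (c *\<^sub>R x) = \<bar>c\<bar> * nrm x"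
  by (simp add: nrm_def bilin real_sqrt_mult flip: power2_eq_square mult.assoc)

lemma nrm_zero [simp]: "nrm 0 = 0"
  using nrm_scale[of 0 0] by simp

lemma nrm_minus: "x \<in> X \<Longrightarrow> y \<in> X \<Longrightarrow> nrm (x - y) = nrm (y - x)"
  using nrm_scale[of "x - y" "-1"] by simp

lemma nrm_triangle:
  assumes "x \<in> X" "y \<in> X"
  shows "nrm (x + y) \<le> nrm x + nrm y"
proof (rule power2_le_imp_le)
  have "(nrm (x + y))\<^sup>2 = B x x + 2 * B x y + B y y"
    using assms sym[of x y] by (simp add: nrm_sq bilin)
  also have "\<dots> \<le> (nrm x)\<^sup>2 + 2 * (nrm x * nrm y) + (nrm y)\<^sup>2"
    using cauchy_schwarz[OF assms] assms by (simp add: nrm_sq)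
  finally show "(nrm (x + y))\<^sup>2 \<le> (nrm x + nrm y)\<^sup>2"
    by (simp add: power2_sum)
qed (use assms in auto)

text \<open>Applied repeatedly by \<open>intro\<close>, it bounds a nested sum by bounds for its
  pieces; the long telescoping sums below are estimated in this way.\<close>

lemma nrm_add_le: "x \<in> X \<Longrightarrow> y \<in> X \<Longrightarrow> nrm x \<le> p \<Longrightarrow> nrm y \<le> q \<Longrightarrow> nrm (x + y) \<le> p + q"
  using nrm_triangle[of x y] by linarith

lemma nrm_diff_triangle:
  assumes "x \<in> X" "y \<in> X" "z \<in> X"
  shows "nrm (x - z) \<le> nrm (x - y) + nrm (y - z)"
  using nrm_triangle[of "x - y" "y - z"] assms by simp

lemma nrm_diff_ge:
  assumes "x \<in> X" "y \<in> X"
  shows "\<bar>nrm x - nrm y\<bar> \<le> nrm (x - y)"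
  using nrm_triangle[of "x - y" y] nrm_triangle[of "y - x" x] nrm_minus[OF assms] assms by simp

lemma nrm_sum:
  assumes "\<And>i. i \<in> I \<Longrightarrow> g i \<in> X"
  shows "nrm (sum g I) \<le> (\<Sum>i\<in>I. nrm (g i))"
  using assms
proof (induction I rule: infinite_finite_induct)
  case (insert i I)
  then have "nrm (g i + sum g I) \<le> nrm (g i) + nrm (sum g I)"
    by (intro nrm_triangle sum_mem) auto
  with insert show ?case by simp
qed auto

lemma tendsto_nrm:
  assumes lim: "((\<lambda>t. nrm (y t - x)) \<longlongrightarrow> 0) G" and ev: "\<forall>\<^sub>F t in G. y t \<in> X" and "x \<in> X"
  shows "((\<lambda>t. nrm (y t)) \<longlongrightarrow> nrm x) G"
proof -
  have "((\<lambda>t. nrm (y t) - nrm x) \<longlongrightarrow> 0) G"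
    by (rule Lim_null_comparison[OF _ lim])
       (use ev in eventually_elim, use \<open>x \<in> X\<close> nrm_diff_ge in auto)
  then show ?thesis
    by (simp add: LIM_zero_iff)
qed

end

text \<open>\<open>Q\<close> will be the quadratic part of the energy. It does not see constants in
  \<open>u\<close>, so it is degenerate on \<open>X\<close>, but the scalar product \<open>B\<close>
  dominates it; convergence in \<open>nrm\<close> therefore passes to \<open>Q\<close>.\<close>

locale dominated_form = semi_inner X B + Q: semi_inner X Q
  for X :: "'x::real_vector set" and B Q :: "'x \<Rightarrow> 'x \<Rightarrow> real" +
  assumes dominated: "x \<in> X \<Longrightarrow> Q x x \<le> B x x"
begin

lemma Q_nrm_le: "x \<in> X \<Longrightarrow> Q.nrm x \<le> nrm x"
  by (simp add: Q.nrm_def nrm_def dominated)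

lemma Q_bound: "x \<in> X \<Longrightarrow> y \<in> X \<Longrightarrow> \<bar>Q x y\<bar> \<le> nrm x * nrm y"
  using Q.cauchy_schwarz[of x y] Q_nrm_le[of x] Q_nrm_le[of y]
  by (meson Q.nrm_nonneg mult_mono nrm_nonneg order_trans)

lemma tendsto_Q:
  assumes lim: "((\<lambda>t. nrm (y t - x)) \<longlongrightarrow> 0) G" and ev: "\<forall>\<^sub>F t in G. y t \<in> X" and "x \<in> X"
  shows "((\<lambda>t. Q (y t) (y t)) \<longlongrightarrow> Q x x) G"
proof -
  have "((\<lambda>t. Q.nrm (y t - x)) \<longlongrightarrow> 0) G"
    by (rule Lim_null_comparison[OF _ lim])
       (use ev in eventually_elim, use \<open>x \<in> X\<close> in \<open>auto simp: Q_nrm_le\<close>)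
  from Q.tendsto_nrm[OF this ev \<open>x \<in> X\<close>]
  have "((\<lambda>t. (Q.nrm (y t))\<^sup>2) \<longlongrightarrow> (Q.nrm x)\<^sup>2) G"
    by (rule tendsto_power)
  moreover have "\<forall>\<^sub>F t in G. (Q.nrm (y t))\<^sup>2 = Q (y t) (y t)"
    using ev by eventually_elim (simp add: Q.nrm_sq)
  ultimately show ?thesis
    using \<open>x \<in> X\<close> by (simp add: Q.nrm_sq tendsto_cong)
qed

text \<open>Inserting \<open>z h = s h + h *\<^sub>R p + o(h)\<close> in the quadratic form leaves
  \<open>Q (s h) (s h) + 2 h Q (s h) p\<close> up to \<open>o(h)\<close>, and \<open>s h\<close> may
  be replaced by its limit \<open>x\<close> in the mixed term. With constant \<open>s\<close> this
  differentiates \<open>Q\<close> along an orbit in the domain; with \<open>s h = S h x\<close> it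
  compares a mild solution with the semigroup.\<close>

lemma form_dini:
  assumes s: "\<forall>\<^sub>F h in at_right 0. s h \<in> X" and z: "\<forall>\<^sub>F h in at_right 0. z h \<in> X"
    and x: "x \<in> X" and p: "p \<in> X" and "e > 0"
    and lim_s: "((\<lambda>h. nrm (s h - x)) \<longlongrightarrow> 0) (at_right 0)"
    and lim_r: "((\<lambda>h. nrm (z h - s h - h *\<^sub>R p) / h) \<longlongrightarrow> 0) (at_right 0)"
  shows "\<forall>\<^sub>F h in at_right 0. Q (z h) (z h) \<le> Q (s h) (s h) + 2 * h * Q x p + e * h"
proof -
  define \<rho> where "\<rho> h = nrm (z h - s h - h *\<^sub>R p) / h" for h :: real
  \<comment> \<open>All error terms of the expansion, divided by \<open>h\<close>.\<close>
  define err where "err h = 2 * nrm (s h - x) * nrm p + h * Q p p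
    + 2 * \<rho> h * (nrm (s h) + \<bar>h\<bar> * nrm p) + \<rho> h * \<rho> h * h" for h
  have id: "((\<lambda>h. h) \<longlongrightarrow> 0) (at_right (0::real))"
    by (rule tendsto_ident_at)
  have \<rho>0: "(\<rho> \<longlongrightarrow> 0) (at_right 0)"
    using lim_r by (simp add: \<rho>_def[abs_def])
  have "(err \<longlongrightarrow> 2 * 0 * nrm p + 0 * Q p p + 2 * 0 * (nrm x + \<bar>0\<bar> * nrm p) + 0 * 0 * 0) (at_right 0)"
    unfolding err_def
    by (intro tendsto_intros lim_s id \<rho>0 tendsto_nrm[OF lim_s s x])
  then have "\<forall>\<^sub>F h in at_right 0. err h < e"
    using \<open>e > 0\<close> by (auto dest: order_tendstoD(2))
  moreover have "\<forall>\<^sub>F h in at_right (0::real). h > 0"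
    by (auto simp: eventually_at_right_less)
  ultimately show ?thesis using s z
  proof eventually_elim
    case (elim h)
    define r where "r = z h - s h - h *\<^sub>R p"
    have X: "r \<in> X" "s h \<in> X" "s h + h *\<^sub>R p \<in> X" "s h - x \<in> X"
      using elim p x by (auto simp: r_def)
    have nr: "nrm r = \<rho> h * h"
      using elim by (simp add: \<rho>_def r_def)
    have zh: "z h = r + (s h + h *\<^sub>R p)"
      by (simp add: r_def)
    have "Q (z h) (z h) = Q r r + 2 * Q r (s h + h *\<^sub>R p) + Q (s h + h *\<^sub>R p) (s h + h *\<^sub>R p)"
    proof -
      have "Q (r + w) (r + w) = Q r r + 2 * Q r w + Q w w" if "w \<in> X" for w
        using that X(1) Q.sym[OF X(1) that] by (simp add: Q.add_left Q.add_right)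
      from this[OF X(3)] show ?thesis by (simp only: zh)
    qed
    also have "Q (s h + h *\<^sub>R p) (s h + h *\<^sub>R p)
        = Q (s h) (s h) + 2 * h * Q x p + 2 * h * Q (s h - x) p + h * h * Q p p"
    proof -
      have "Q (w + h *\<^sub>R p) (w + h *\<^sub>R p) = Q w w + 2 * h * Q x p + 2 * h * Q (w - x) p + h * h * Q p p"
        if "w \<in> X" for w
        using that p x Q.sym[OF p that] by (simp add: Q.bilin algebra_simps)
      from this[OF X(2)] show ?thesis .
    qed
    also have "Q r r \<le> (\<rho> h * h) * (\<rho> h * h)"
      using Q_bound[of r r] X by (simp add: nr)
    also have "Q r (s h + h *\<^sub>R p) \<le> (\<rho> h * h) * (nrm (s h) + \<bar>h\<bar> * nrm p)"
    proof -
      have "Q r (s h + h *\<^sub>R p) \<le> nrm r * nrm (s h + h *\<^sub>R p)"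
        using Q_bound[of r "s h + h *\<^sub>R p"] X by auto
      also have "\<dots> \<le> nrm r * (nrm (s h) + \<bar>h\<bar> * nrm p)"
        using X p nrm_triangle[of "s h" "h *\<^sub>R p"] by (intro mult_left_mono) (auto simp: nrm_scale)
      finally show ?thesis by (simp add: nr)
    qed
    also have "2 * h * Q (s h - x) p \<le> 2 * h * (nrm (s h - x) * nrm p)"
      using Q_bound[of "s h - x" p] X p elim by (intro mult_left_mono) auto
    finally have "Q (z h) (z h) \<le> Q (s h) (s h) + 2 * h * Q x p + h * err h"
      by (simp add: err_def algebra_simps)
    moreover have "h * err h \<le> h * e"
      using elim by (intro mult_left_mono) auto
    ultimately show ?case by (simp add: mult.commute)
  qed
qed

end

section \<open>Contraction semigroups and the first-order expansion of mild solutions\<close>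

locale semi_inner_semigroup = semi_inner X B for X :: "'x::real_vector set" and B +
  fixes S :: "real \<Rightarrow> 'x \<Rightarrow> 'x"
  assumes semigroup: "contraction_semigroup X nrm S"
begin

lemma S_mem [simp, intro]: "t \<ge> 0 \<Longrightarrow> x \<in> X \<Longrightarrow> S t x \<in> X"
  and S_add: "t \<ge> 0 \<Longrightarrow> x \<in> X \<Longrightarrow> y \<in> X \<Longrightarrow> nrm (S t (x + y) - (S t x + S t y)) = 0"
  and S_scale: "t \<ge> 0 \<Longrightarrow> x \<in> X \<Longrightarrow> nrm (S t (c *\<^sub>R x) - c *\<^sub>R S t x) = 0"
  and S_plus: "s \<ge> 0 \<Longrightarrow> t \<ge> 0 \<Longrightarrow> x \<in> X \<Longrightarrow> nrm (S (s + t) x - S s (S t x)) = 0"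
  and S_lim: "x \<in> X \<Longrightarrow> ((\<lambda>t. nrm (S t x - x)) \<longlongrightarrow> 0) (at_right 0)"
  and S_contr: "t \<ge> 0 \<Longrightarrow> x \<in> X \<Longrightarrow> nrm (S t x) \<le> nrm x"
  and S_zero: "x \<in> X \<Longrightarrow> nrm (S 0 x - x) = 0"
  using semigroup by (auto simp: contraction_semigroup_def)

text \<open>The laws of \<open>S\<close> hold modulo elements of norm zero. A difference is
  therefore treated as a sum with \<open>(-1) *\<^sub>R y\<close>, and each use of a law costs one
  vanishing norm in a triangle inequality.\<close>

lemma S_diff:
  assumes "t \<ge> 0" "x \<in> X" "y \<in> X"
  shows "nrm (S t (x - y) - (S t x - S t y)) = 0"
proof -
  have "nrm ((S t (x + (-1) *\<^sub>R y) - (S t x + S t ((-1) *\<^sub>R y))) + (S t ((-1) *\<^sub>R y) - (-1) *\<^sub>R S t y)) \<le> 0 + 0"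
    by (intro nrm_add_le) (use assms S_add[of t x "(-1) *\<^sub>R y"] S_scale[of t y "-1"] in auto)
  then show ?thesis
    using assms by (intro antisym) (auto simp: algebra_simps)
qed

lemma S_lipschitz:
  assumes "t \<ge> 0" "x \<in> X" "y \<in> X"
  shows "nrm (S t x - S t y) \<le> nrm (x - y)"
  using nrm_diff_ge[of "S t (x - y)" "S t x - S t y"] S_diff[OF assms] S_contr[of t "x - y"] assms
  by auto

text \<open>Lets \<open>S h\<close> be moved inside the Riemann sums that approximate the Duhamel
  integral.\<close>

lemma S_sum:
  assumes "t \<ge> 0" "finite I" "\<And>i. i \<in> I \<Longrightarrow> g i \<in> X"
  shows "nrm (S t (\<Sum>i\<in>I. c i *\<^sub>R g i) - (\<Sum>i\<in>I. c i *\<^sub>R S t (g i))) = 0"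
  using assms(2,3)
proof (induction I rule: finite_induct)
  case empty
  then show ?case
    using S_contr[of t 0] \<open>t \<ge> 0\<close> by (intro antisym) auto
next
  case (insert i I)
  have mem: "(\<Sum>i\<in>I. c i *\<^sub>R g i) \<in> X" "(\<Sum>i\<in>I. c i *\<^sub>R S t (g i)) \<in> X" "g i \<in> X"
    using insert assms(1) by (auto intro!: sum_mem)
  have "nrm ((S t (c i *\<^sub>R g i + (\<Sum>i\<in>I. c i *\<^sub>R g i)) - (S t (c i *\<^sub>R g i) + S t (\<Sum>i\<in>I. c i *\<^sub>R g i)))
      + ((S t (c i *\<^sub>R g i) - c i *\<^sub>R S t (g i))
        + (S t (\<Sum>i\<in>I. c i *\<^sub>R g i) - (\<Sum>i\<in>I. c i *\<^sub>R S t (g i))))) \<le> 0 + (0 + 0)"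
    using insert mem assms(1) S_add[of t "c i *\<^sub>R g i" "\<Sum>i\<in>I. c i *\<^sub>R g i"] S_scale[of t "g i" "c i"]
    by (intro nrm_add_le) (auto intro!: mem(1))
  then show ?case
    using insert mem assms(1) by (intro antisym) (auto simp: algebra_simps intro!: sum_mem)
qed

lemma S_time_diff:
  assumes "0 \<le> s" "s \<le> t" "x \<in> X"
  shows "nrm (S t x - S s x) \<le> nrm (S (t - s) x - x)"
  using nrm_diff_triangle[of "S t x" "S s (S (t - s) x)" "S s x"] S_plus[of s "t - s" x]
    S_lipschitz[of s "S (t - s) x" x] assms by simp

text \<open>Contractivity bounds the distance of \<open>S s x\<close> and \<open>S t x\<close> by
  that of \<open>S \<bar>s - t\<bar> x\<close> and \<open>x\<close>, so right continuity at
  \<open>0\<close> gives continuity from both sides at every time.\<close>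

lemma S_continuous:
  assumes "t \<ge> 0" "x \<in> X"
  shows "((\<lambda>s. nrm (S s x - S t x)) \<longlongrightarrow> 0) (at t within {0..})"
proof (rule tendstoI)
  fix e :: real
  assume "e > 0"
  with S_lim[OF assms(2)] have "\<forall>\<^sub>F h in at_right 0. \<bar>nrm (S h x - x)\<bar> < e"
    by (auto dest: tendstoD simp: dist_real_def)
  then obtain d where d: "d > 0" "\<And>h. 0 < h \<Longrightarrow> h < d \<Longrightarrow> \<bar>nrm (S h x - x)\<bar> < e"
    by (auto simp: eventually_at_right_field)
  have "dist (nrm (S s x - S t x)) 0 < e" if "s \<in> {0..}" "s \<noteq> t" "dist s t < d" for s
  proof (cases "s < t")
    case True
    with S_time_diff[of s t x] nrm_minus[of "S s x" "S t x"] d(2)[of "t - s"] assms that show ?thesis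
      by (auto simp: dist_real_def)
  next
    case False
    with S_time_diff[of t s x] d(2)[of "s - t"] assms that show ?thesis
      by (auto simp: dist_real_def)
  qed
  then show "\<forall>\<^sub>F s in at t within {0..}. dist (nrm (S s x - S t x)) 0 < e"
    using d(1) by (auto simp: eventually_at)
qed

text \<open>The Duhamel formula restarted at time \<open>t\<close>: \<open>y (t + h)\<close> is
  \<open>S h (y t)\<close> plus the integral of \<open>S (t + h - s) (P s)\<close> over
  \<open>[t, t + h]\<close>, where the integrand is close to \<open>P t\<close>. As the integral is
  only given through Riemann sums, the restart is carried out on the sums: one tagged division of
  \<open>[0, t]\<close> serves the integrals up to \<open>t\<close> and up to
  \<open>t + h\<close>.\<close>

lemma mild_expansion:
  assumes y: "\<And>t. t \<ge> 0 \<Longrightarrow> y t \<in> X" and P: "\<And>t. t \<ge> 0 \<Longrightarrow> P t \<in> X" and y0: "y0 \<in> X"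
    and int: "\<And>t. t \<ge> 0 \<Longrightarrow> has_riemann_integral nrm (\<lambda>s. S (t - s) (P s)) (y t - S t y0) 0 t"
    and t: "t \<ge> 0" and cont: "((\<lambda>s. nrm (P s - P t)) \<longlongrightarrow> 0) (at_right t)"
  shows "((\<lambda>h. nrm (y (t + h) - S h (y t) - h *\<^sub>R P t) / h) \<longlongrightarrow> 0) (at_right 0)"
proof (rule tendstoI)
  fix e :: real
  assume "e > 0"
  then have e4: "e / 4 > 0" by simp
  from tendstoD[OF cont e4] obtain d1 where d1: "d1 > t" "\<And>s. t < s \<Longrightarrow> s < d1 \<Longrightarrow> nrm (P s - P t) < e / 4"
    using P t by (auto simp: eventually_at_right_field dist_real_def)
  from tendstoD[OF S_lim[OF P[OF t]] e4] obtain d2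
    where d2: "d2 > 0" and "\<And>h. 0 < h \<Longrightarrow> h < d2 \<Longrightarrow> \<bar>nrm (S h (P t) - P t)\<bar> < e / 4"
    by (auto simp: eventually_at_right_field dist_real_def)
  then have d2': "nrm (S h (P t) - P t) < e / 4" if "0 < h" "h < d2" for h
    using that by (meson abs_less_iff)
  define d where "d = min (d1 - t) d2"
  have "d > 0" using d1 d2 by (simp add: d_def)
  have main: "nrm (y (t + h) - S h (y t) - h *\<^sub>R P t) \<le> h * (e / 2)" if h: "0 < h" "h < d" for h
  proof (rule field_le_epsilon)
    fix \<eta>0 :: real
    assume "\<eta>0 > 0"
    define \<eta> where "\<eta> = \<eta>0 / 2"
    have "\<eta> > 0" using \<open>\<eta>0 > 0\<close> by (simp add: \<eta>_def)
    have th: "t + h \<ge> 0" using t h by simp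
    from int[OF t, unfolded has_riemann_integral_def, rule_format, OF \<open>\<eta> > 0\<close>] obtain r1 where r1: "r1 > 0"
      "\<And>p. p tagged_division_of {0..t} \<Longrightarrow> (\<lambda>r. ball r r1) fine p \<Longrightarrow>
        nrm ((\<Sum>(r, K)\<in>p. measure lborel K *\<^sub>R S (t - r) (P r)) - (y t - S t y0)) < \<eta>"
      by blast
    from int[OF th, unfolded has_riemann_integral_def, rule_format, OF \<open>\<eta> > 0\<close>] obtain r2 where r2: "r2 > 0"
      "\<And>p. p tagged_division_of {0..t + h} \<Longrightarrow> (\<lambda>r. ball r r2) fine p \<Longrightarrow>
        nrm ((\<Sum>(r, K)\<in>p. measure lborel K *\<^sub>R S (t + h - r) (P r)) - (y (t + h) - S (t + h) y0)) < \<eta>"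
      by blast
    \<comment> \<open>Fine enough for both integrals: \<open>p1\<close> approximates the one up to
      \<open>t\<close>, and \<open>p1 \<union> p2\<close> the one up to
      \<open>t + h\<close>.\<close>
    define \<rho> where "\<rho> = min r1 r2"
    have \<rho>: "\<rho> > 0" using r1 r2 by (simp add: \<rho>_def)
    have gauge: "gauge (\<lambda>r. ball r \<rho>)" for r :: real
      using \<rho> by (rule gauge_ball)
    obtain p1 where p1: "p1 tagged_division_of {0..t}" "(\<lambda>r. ball r \<rho>) fine p1"
      using fine_division_exists_real[OF gauge] by blast
    obtain p2 where p2: "p2 tagged_division_of {t..t + h}" "(\<lambda>r. ball r \<rho>) fine p2"
      using fine_division_exists_real[OF gauge] by blast
    have fin: "finite p1" "finite p2"
      using p1 p2 by auto
    have "p1 \<union> p2 tagged_division_of {0..t} \<union> {t..t + h}"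
      using p1 p2 by (intro tagged_division_Un) (auto simp: interior_atLeastAtMost_real)
    also have "{0..t} \<union> {t..t + h} = {0..t + h}"
      using t h by auto
    finally have p12: "p1 \<union> p2 tagged_division_of {0..t + h}" .
    have fine: "(\<lambda>r. ball r r1) fine p1" "(\<lambda>r. ball r r2) fine (p1 \<union> p2)"
      using p1 p2 by (auto simp: fine_def \<rho>_def subset_eq)
    have tags1: "0 \<le> r" "r \<le> t" "K \<subseteq> {0..t}" if "(r, K) \<in> p1" for r K
      using tagged_division_ofD(2,3)[OF p1(1) that] by (auto simp: subset_eq)
    have tags2: "t \<le> r" "r \<le> t + h" "K \<subseteq> {t..t + h}" if "(r, K) \<in> p2" for r K
      using tagged_division_ofD(2,3)[OF p2(1) that] by (auto simp: subset_eq)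
    have tags1': "0 \<le> fst z" "fst z \<le> t" if "z \<in> p1" for z
      using tags1[of "fst z" "snd z"] that by auto
    have tags2': "t \<le> fst z" "fst z \<le> t + h" if "z \<in> p2" for z
      using tags2[of "fst z" "snd z"] that by auto
    define G where "G = (\<lambda>(r, K::real set). measure lborel K *\<^sub>R S (t + h - r) (P r))"
    define \<Sigma>1 where "\<Sigma>1 = (\<Sum>(r, K)\<in>p1. measure lborel K *\<^sub>R S (t - r) (P r))"
    \<comment> \<open>A tagged set that belongs to both divisions is contained in \<open>{t}\<close>
      and has measure zero, so the overlap does no harm.\<close>
    have "sum G (p1 \<union> p2) = sum G p1 + sum G p2"
    proof (rule sum.union_inter_neutral[OF fin], rule ballI)
      fix z
      assume z: "z \<in> p1 \<inter> p2"
      obtain r K where zrK: "z = (r, K)" by (cases z)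
      with z tags1[of r K] tags2[of r K] have "K \<subseteq> {t}"
        by (auto simp: subset_eq) (meson antisym)
      then have "K = {} \<or> K = {t}" by auto
      then show "G z = 0" by (auto simp: G_def zrK)
    qed
    with r2(2)[OF p12 fine(2)] have b1: "nrm (sum G p1 + sum G p2 - (y (t + h) - S (t + h) y0)) \<le> \<eta>"
      by (simp add: G_def)
    have GX1: "G z \<in> X" if "z \<in> p1" for z
      using that tags1[of "fst z" "snd z"] h P by (cases z) (auto simp: G_def)
    have GX2: "G z \<in> X" if "z \<in> p2" for z
      using that tags2[of "fst z" "snd z"] t h P by (cases z) (auto simp: G_def)
    have "\<Sigma>1 \<in> X"
      unfolding \<Sigma>1_def
    proof (rule sum_mem)
      fix z
      assume "z \<in> p1"
      with tags1[of "fst z" "snd z"] P show "(case z of (r, K) \<Rightarrow> measure lborel K *\<^sub>R S (t - r) (P r)) \<in> X"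
        by (cases z) auto
    qed
    then have X: "sum G p1 \<in> X" "sum G p2 \<in> X" "\<Sigma>1 \<in> X"
      "y (t + h) \<in> X" "y t \<in> X" "P t \<in> X" "S t y0 \<in> X" "S (t + h) y0 \<in> X" "S h (S t y0) \<in> X" "S h (y t) \<in> X"
      using y P y0 t h GX1 GX2 by (auto intro!: sum_mem)
    \<comment> \<open>By the semigroup law \<open>S h\<close> turns the Riemann sum for time
      \<open>t\<close> into the part over \<open>[0, t]\<close> of the one for time
      \<open>t + h\<close>.\<close>
    have b2: "nrm (S h \<Sigma>1 - sum G p1) \<le> 0"
    proof -
      have eq: "\<Sigma>1 = (\<Sum>z\<in>p1. measure lborel (snd z) *\<^sub>R S (t - fst z) (P (fst z)))"
        unfolding \<Sigma>1_def by (rule sum.cong) auto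
      have Smem: "S (t - fst z) (P (fst z)) \<in> X" if "z \<in> p1" for z
        using that tags1[of "fst z" "snd z"] P by auto
      define R where "R = (\<Sum>z\<in>p1. measure lborel (snd z) *\<^sub>R S h (S (t - fst z) (P (fst z))))"
      have RX: "R \<in> X"
        unfolding R_def using Smem h by (auto intro!: sum_mem)
      have 1: "nrm (S h \<Sigma>1 - R) = 0"
        unfolding eq R_def using fin h Smem by (intro S_sum) auto
      have "nrm (R - sum G p1) = nrm (\<Sum>z\<in>p1. measure lborel (snd z) *\<^sub>R
          (S h (S (t - fst z) (P (fst z))) - S (t + h - fst z) (P (fst z))))"
        by (simp add: R_def G_def case_prod_beta sum_subtractf scaleR_diff_right)
      also have "\<dots> \<le> (\<Sum>z\<in>p1. nrm (measure lborel (snd z) *\<^sub>R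
          (S h (S (t - fst z) (P (fst z))) - S (t + h - fst z) (P (fst z)))))"
      proof (rule nrm_sum)
        fix z
        assume "z \<in> p1"
        note z = tags1'[OF this] Smem[OF this]
        have "0 \<le> t + h - fst z" using z h by simp
        then show "measure lborel (snd z) *\<^sub>R (S h (S (t - fst z) (P (fst z))) - S (t + h - fst z) (P (fst z))) \<in> X"
          using z h by (intro mem(3,4) S_mem P) simp_all
      qed
      also have "\<dots> = 0"
      proof (rule sum.neutral, rule ballI)
        fix z
        assume z: "z \<in> p1"
        with tags1[of "fst z" "snd z"] have z': "0 \<le> fst z" "fst z \<le> t" by auto
        have Pz: "P (fst z) \<in> X" using P z' by auto
        have eq: "h + (t - fst z) = t + h - fst z" by simp
        have "nrm (S (h + (t - fst z)) (P (fst z)) - S h (S (t - fst z) (P (fst z)))) = 0"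
          by (rule S_plus) (use h Pz z' in auto)
        then have "nrm (S (t + h - fst z) (P (fst z)) - S h (S (t - fst z) (P (fst z)))) = 0"
          by (simp only: eq)
        then have "nrm (S h (S (t - fst z) (P (fst z))) - S (t + h - fst z) (P (fst z))) = 0"
          using nrm_minus[of "S h (S (t - fst z) (P (fst z)))" "S (t + h - fst z) (P (fst z))"] h Pz z' by simp
        then show "nrm (measure lborel (snd z) *\<^sub>R (S h (S (t - fst z) (P (fst z))) - S (t + h - fst z) (P (fst z)))) = 0"
          using z' h Pz by (subst nrm_scale) auto
      qed
      finally have 2: "nrm (R - sum G p1) \<le> 0" .
      have "nrm ((S h \<Sigma>1 - R) + (R - sum G p1)) \<le> 0 + 0"
        by (rule nrm_add_le) (use 1 2 X RX h in auto)
      then show ?thesis by simp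
    qed
    have b3: "nrm (S h \<Sigma>1 - S h (y t - S t y0)) \<le> \<eta>"
      using S_lipschitz[of h \<Sigma>1 "y t - S t y0"] r1(2)[OF p1(1) fine(1)] X h by (simp add: \<Sigma>1_def)
    have b4: "nrm (S h (y t - S t y0) - (S h (y t) - S h (S t y0))) \<le> 0"
      using S_diff[of h "y t" "S t y0"] X h by simp
    have b5: "nrm (S (t + h) y0 - S h (S t y0)) \<le> 0"
      using S_plus[of h t y0] t h y0 by (simp add: add.commute)
    \<comment> \<open>The only term of order \<open>h\<close>. The lengths in \<open>p2\<close> add
      up to \<open>h\<close>, and each value of the integrand is within \<open>e / 2\<close> of
      \<open>P t\<close>: a quarter of \<open>e\<close> from the continuity of \<open>P\<close>,
      another from that of \<open>S\<close>.\<close>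
    have b6: "nrm (sum G p2 - h *\<^sub>R P t) \<le> h * (e / 2)"
    proof -
      have len: "(\<Sum>z\<in>p2. measure lborel (snd z)) = h"
        using additive_content_tagged_division[of p2 t "t + h"] p2(1) h
        by (simp add: case_prod_beta)
      have "nrm (sum G p2 - h *\<^sub>R P t) = nrm (\<Sum>z\<in>p2. measure lborel (snd z) *\<^sub>R (S (t + h - fst z) (P (fst z)) - P t))"
        unfolding scaleR_diff_right sum_subtractf scaleR_sum_left[symmetric] len
        by (simp add: G_def case_prod_beta)
      also have "\<dots> \<le> (\<Sum>z\<in>p2. nrm (measure lborel (snd z) *\<^sub>R (S (t + h - fst z) (P (fst z)) - P t)))"
      proof (rule nrm_sum)
        fix z
        assume "z \<in> p2"
        note z = tags2'[OF this]
        have "0 \<le> t + h - fst z" "0 \<le> fst z" using z t by simp_all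
        then show "measure lborel (snd z) *\<^sub>R (S (t + h - fst z) (P (fst z)) - P t) \<in> X"
          using t by (intro mem(3,4) S_mem P)
      qed
      also have "\<dots> \<le> (\<Sum>z\<in>p2. measure lborel (snd z) * (e / 2))"
      proof (rule sum_mono)
        fix z
        assume z: "z \<in> p2"
        with tags2[of "fst z" "snd z"] have z': "t \<le> fst z" "fst z \<le> t + h" by auto
        have 1: "nrm (P (fst z) - P t) \<le> e / 4"
          using d1(2)[of "fst z"] z' h \<open>e > 0\<close> by (cases "fst z = t") (auto simp: d_def)
        have 2: "nrm (S (t + h - fst z) (P t) - P t) \<le> e / 4"
          using d2'[of "t + h - fst z"] z' h \<open>e > 0\<close> S_zero[OF X(6)]
          by (cases "fst z = t + h") (auto simp: d_def)
        have "nrm (S (t + h - fst z) (P (fst z)) - S (t + h - fst z) (P t)) \<le> e / 4"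
          using S_lipschitz[of "t + h - fst z" "P (fst z)" "P t"] 1 z' t P by auto
        with 2 nrm_diff_triangle[of "S (t + h - fst z) (P (fst z))" "S (t + h - fst z) (P t)" "P t"]
        have le: "nrm (S (t + h - fst z) (P (fst z)) - P t) \<le> e / 2"
          using z' t P X by auto
        have "S (t + h - fst z) (P (fst z)) - P t \<in> X"
          using z' t P X by auto
        from nrm_scale[OF this] mult_left_mono[OF le, of "measure lborel (snd z)"]
        show "nrm (measure lborel (snd z) *\<^sub>R (S (t + h - fst z) (P (fst z)) - P t)) \<le> measure lborel (snd z) * (e / 2)"
          by simp
      qed
      also have "\<dots> = h * (e / 2)"
        by (simp only: sum_distrib_right[symmetric] len)
      finally show ?thesis .
    qed
    have b1': "nrm (y (t + h) - S (t + h) y0 - (sum G p1 + sum G p2)) \<le> \<eta>"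
      using b1 nrm_minus[of "sum G p1 + sum G p2" "y (t + h) - S (t + h) y0"] X by simp
    have b2': "nrm (sum G p1 - S h \<Sigma>1) \<le> 0"
      using b2 nrm_minus[of "sum G p1" "S h \<Sigma>1"] X h by simp
    have "nrm (y (t + h) - S h (y t) - h *\<^sub>R P t) =
       nrm ((y (t + h) - S (t + h) y0 - (sum G p1 + sum G p2)) + ((sum G p1 - S h \<Sigma>1)
       + ((S h \<Sigma>1 - S h (y t - S t y0)) + ((S h (y t - S t y0) - (S h (y t) - S h (S t y0)))
       + ((S (t + h) y0 - S h (S t y0)) + (sum G p2 - h *\<^sub>R P t))))))"
      by (simp add: algebra_simps)
    also have "\<dots> \<le> \<eta> + (0 + (\<eta> + (0 + (0 + h * (e / 2)))))"
      by (intro nrm_add_le b1' b2' b3 b4 b5 b6) (use X h in auto)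
    finally show "nrm (y (t + h) - S h (y t) - h *\<^sub>R P t) \<le> h * (e / 2) + \<eta>0"
      by (simp add: \<eta>_def)
  qed
  have "dist (nrm (y (t + h) - S h (y t) - h *\<^sub>R P t) / h) 0 < e" if h: "0 < h" "h < d" for h
  proof -
    have "nrm (y (t + h) - S h (y t) - h *\<^sub>R P t) / h \<le> e / 2"
      using main[OF h] h by (simp add: field_simps)
    then have "nrm (y (t + h) - S h (y t) - h *\<^sub>R P t) / h < e"
      using \<open>e > 0\<close> by linarith
    then show ?thesis
      using h t y P by (simp add: dist_real_def)
  qed
  then show "\<forall>\<^sub>F h in at_right 0. dist (nrm (y (t + h) - S h (y t) - h *\<^sub>R P t) / h) 0 < e"
    using \<open>d > 0\<close> by (auto simp: eventually_at_right_field)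
qed

end

section \<open>Decay of the quadratic form under the semigroup\<close>

locale form_semigroup = dominated_form X B Q + semi_inner_semigroup X B S
  for X :: "'x::real_vector set" and B Q S +
  fixes D A
  assumes gen: "generates_contraction_semigroup X nrm D A S"
    and DX: "D \<subseteq> X" and AX: "x \<in> D \<Longrightarrow> A x \<in> X"
    and dense: "x \<in> X \<Longrightarrow> e > 0 \<Longrightarrow> \<exists>x'\<in>D. nrm (x - x') < e"
    and dissipative: "x \<in> D \<Longrightarrow> Q x (A x) \<le> - Q x x"
begin

lemma gen_iff: "x \<in> X \<Longrightarrow> z \<in> X \<Longrightarrow>
    ((\<lambda>h. nrm ((1 / h) *\<^sub>R (S h x - x) - z)) \<longlongrightarrow> 0) (at_right 0) \<longleftrightarrow> x \<in> D \<and> nrm (A x - z) = 0"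
  using gen by (auto simp: generates_contraction_semigroup_def)

text \<open>\<open>gen_iff\<close> characterises \<open>D\<close> by convergence of the difference
  quotients. Those of \<open>S t x\<close> are, up to norm zero, the images under \<open>S t\<close>
  of those of \<open>x\<close>, so they converge to \<open>S t (A x)\<close>.\<close>

lemma S_domain:
  assumes "x \<in> D" "t \<ge> 0"
  shows "S t x \<in> D"
proof -
  have X: "x \<in> X" "A x \<in> X"
    using assms DX AX by auto
  have lim: "((\<lambda>h. nrm ((1 / h) *\<^sub>R (S h x - x) - A x)) \<longlongrightarrow> 0) (at_right 0)"
    using gen_iff[OF X] assms by simp
  have "((\<lambda>h. nrm ((1 / h) *\<^sub>R (S h (S t x) - S t x) - S t (A x))) \<longlongrightarrow> 0) (at_right 0)"
  proof (rule Lim_null_comparison[OF _ lim])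
    have "norm (nrm ((1 / h) *\<^sub>R (S h (S t x) - S t x) - S t (A x))) \<le> nrm ((1 / h) *\<^sub>R (S h x - x) - A x)"
      if h: "h > 0" for h
    proof -
      define w where "w = (1 / h) *\<^sub>R (S h x - x) - A x"
      have w: "w \<in> X" using X h by (auto simp: w_def)
      have a: "nrm (S h (S t x) - S (t + h) x) \<le> 0"
        using S_plus[of h t x] nrm_minus[of "S (t + h) x" "S h (S t x)"] h X assms by (simp add: add.commute)
      have b: "nrm (S (t + h) x - S t (S h x)) \<le> 0"
        using S_plus[of t h x] h X assms by simp
      have c: "nrm (S t (S h x) - S t x - S t (S h x - x)) \<le> 0"
        using S_diff[of t "S h x" x] nrm_minus[of "S t (S h x) - S t x" "S t (S h x - x)"] h X assms by simp
      have abc: "nrm (S h (S t x) - S (t + h) x + (S (t + h) x - S t (S h x) + (S t (S h x) - S t x - S t (S h x - x)))) \<le> 0 + (0 + 0)"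
        by (intro nrm_add_le a b c) (use h X assms in auto)
      have d: "nrm ((1 / h) *\<^sub>R (S h (S t x) - S t x - S t (S h x - x))) \<le> 0"
        using abc h X assms by (subst nrm_scale) (auto simp: algebra_simps divide_le_0_iff)
      have e: "nrm ((1 / h) *\<^sub>R S t (S h x - x) - S t ((1 / h) *\<^sub>R (S h x - x))) \<le> 0"
        using S_scale[of t "S h x - x" "1 / h"] nrm_minus[of "(1 / h) *\<^sub>R S t (S h x - x)" "S t ((1 / h) *\<^sub>R (S h x - x))"]
          h X assms by simp
      have f: "nrm (S t ((1 / h) *\<^sub>R (S h x - x)) - S t (A x) - S t w) \<le> 0"
        unfolding w_def
        using S_diff[of t "(1 / h) *\<^sub>R (S h x - x)" "A x"] h X assms
          nrm_minus[of "S t ((1 / h) *\<^sub>R (S h x - x)) - S t (A x)" "S t ((1 / h) *\<^sub>R (S h x - x) - A x)"]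
        by simp
      have "nrm ((1 / h) *\<^sub>R (S h (S t x) - S t x) - S t (A x)) =
         nrm ((1 / h) *\<^sub>R (S h (S t x) - S t x - S t (S h x - x)) +
         ((1 / h) *\<^sub>R S t (S h x - x) - S t ((1 / h) *\<^sub>R (S h x - x))
         + (S t ((1 / h) *\<^sub>R (S h x - x)) - S t (A x) - S t w + S t w)))"
        by (simp add: algebra_simps)
      also have "\<dots> \<le> 0 + (0 + (0 + nrm w))"
        by (intro nrm_add_le d e f) (use h X w assms S_contr in auto)
      finally show ?thesis
        using h X assms by (simp add: w_def)
    qed
    then show "\<forall>\<^sub>F h in at_right 0. norm (nrm ((1 / h) *\<^sub>R (S h (S t x) - S t x) - S t (A x))) \<le> nrm ((1 / h) *\<^sub>R (S h x - x) - A x)"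
      by (auto simp: eventually_at_right_field intro: exI[of _ 1])
  qed
  then show ?thesis
    using gen_iff[of "S t x" "S t (A x)"] X assms by simp
qed

lemma Q_cong: "x \<in> X \<Longrightarrow> y \<in> X \<Longrightarrow> nrm (x - y) = 0 \<Longrightarrow> Q x x = Q y y"
proof -
  assume *: "x \<in> X" "y \<in> X" "nrm (x - y) = 0"
  then have "Q.nrm x = Q.nrm y"
    using Q.nrm_diff_ge[of x y] Q_nrm_le[of "x - y"] by simp
  then show ?thesis
    using * by (metis Q.nrm_sq)
qed

text \<open>Formally the derivative of \<open>Q (S r x) (S r x)\<close> is
  \<open>2 Q (S r x) (A (S r x))\<close>, which \<open>dissipative\<close> bounds by
  \<open>- 2 Q\<close>; hence the form multiplied by \<open>exp (2 r)\<close> is nonincreasing.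
  Orbits starting in \<open>D\<close> remain there, so the estimate is available at every
  time.\<close>

lemma Q_decay_domain:
  assumes "x \<in> D" "t \<ge> 0"
  shows "Q (S t x) (S t x) \<le> exp (- 2 * t) * Q x x"
proof -
  have X: "x \<in> X" "A x \<in> X"
    using assms DX AX by auto
  define \<phi> where "\<phi> r = exp (2 * r) * Q (S r x) (S r x)" for r
  have "\<phi> t \<le> \<phi> 0"
  proof (rule dini_nonincreasing[OF \<open>t \<ge> 0\<close>])
    show "continuous_on {0..t} \<phi>"
    proof (unfold continuous_on_def, intro ballI)
      fix r
      assume r: "r \<in> {0..t}"
      have "((\<lambda>r. Q (S r x) (S r x)) \<longlongrightarrow> Q (S r x) (S r x)) (at r within {0..})"
        by (rule tendsto_Q[OF S_continuous]) (use r X in \<open>auto simp: eventually_at intro: exI[of _ 1]\<close>)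
      then have "((\<lambda>r. Q (S r x) (S r x)) \<longlongrightarrow> Q (S r x) (S r x)) (at r within {0..t})"
        by (rule tendsto_within_subset) auto
      then show "(\<phi> \<longlongrightarrow> \<phi> r) (at r within {0..t})"
        unfolding \<phi>_def by (intro tendsto_intros)
    qed
    fix r e :: real
    assume r: "0 \<le> r" "r < t" and e: "e > 0"
    define x' where "x' = S r x"
    have x': "x' \<in> D" "x' \<in> X" "A x' \<in> X"
      using S_domain[OF assms(1) r(1)] DX AX by (auto simp: x'_def)
    \<comment> \<open>Chosen so that the error is at most \<open>e * h\<close> after multiplication
      by \<open>exp (2 * r)\<close> and by \<open>exp (2 * h)\<close> with
      \<open>h < 1\<close>.\<close>
    define e' where "e' = e / exp (2 * r + 2)"
    have e': "e' > 0" using e by (simp add: e'_def)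
    have lim: "((\<lambda>h. nrm ((1 / h) *\<^sub>R (S h x' - x') - A x')) \<longlongrightarrow> 0) (at_right 0)"
      using gen_iff[OF x'(2,3)] x' by simp
    have pos: "\<forall>\<^sub>F h in at_right (0::real). 0 < h \<and> h < 1"
      by (auto simp: eventually_at_right_field intro: exI[of _ 1])
    have "((\<lambda>h. nrm (S h x' - x' - h *\<^sub>R A x') / h) \<longlongrightarrow> 0) (at_right 0)"
    proof (rule Lim_transform_eventually[OF lim])
      show "\<forall>\<^sub>F h in at_right 0. nrm ((1 / h) *\<^sub>R (S h x' - x') - A x') = nrm (S h x' - x' - h *\<^sub>R A x') / h"
        using pos
      proof eventually_elim
        case (elim h)
        have "(1 / h) *\<^sub>R (S h x' - x') - A x' = (1 / h) *\<^sub>R (S h x' - x' - h *\<^sub>R A x')"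
          using elim by (simp add: algebra_simps)
        then show ?case
          using elim x' by (simp add: nrm_scale)
      qed
    qed
    then have "\<forall>\<^sub>F h in at_right 0. Q (S h x') (S h x') \<le> Q x' x' + 2 * h * Q x' (A x') + e' * h"
      by (intro form_dini[where x = x' and s = "\<lambda>_. x'"])
         (use x' e' pos in \<open>auto elim!: eventually_mono\<close>)
    then show "\<forall>\<^sub>F h in at_right 0. \<phi> (r + h) \<le> \<phi> r + e * h"
      using pos
    proof eventually_elim
      case (elim h)
      have eq: "Q (S (r + h) x) (S (r + h) x) = Q (S h x') (S h x')"
        using S_plus[of h r x] r elim X x' by (intro Q_cong) (auto simp: x'_def add.commute)
      have "2 * h * Q x' (A x') \<le> 2 * h * (- Q x' x')"
        using elim dissipative[OF x'(1)] by (intro mult_left_mono) auto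
      with elim have 1: "Q (S h x') (S h x') \<le> (1 - 2 * h) * Q x' x' + e' * h"
        by (simp add: algebra_simps)
      have "exp (2 * h) * (1 - 2 * h) \<le> exp (2 * h) * exp (- (2 * h))"
        using exp_ge_add_one_self[of "- (2 * h)"] by (intro mult_left_mono) auto
      then have 2: "exp (2 * h) * (1 - 2 * h) \<le> 1"
        by (simp add: exp_minus_inverse)
      have "exp (2 * h) \<le> exp (2::real)" using elim by simp
      have "\<phi> (r + h) = exp (2 * r) * (exp (2 * h) * Q (S h x') (S h x'))"
        by (simp add: \<phi>_def eq distrib_left exp_add)
      also have "\<dots> \<le> exp (2 * r) * (exp (2 * h) * ((1 - 2 * h) * Q x' x' + e' * h))"
        using 1 by (intro mult_left_mono) auto
      also have "\<dots> = exp (2 * r) * ((exp (2 * h) * (1 - 2 * h)) * Q x' x' + exp (2 * h) * (e' * h))"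
        by (simp add: algebra_simps)
      also have "\<dots> \<le> exp (2 * r) * (1 * Q x' x' + exp 2 * (e' * h))"
        using elim e' x' 2 by (intro mult_left_mono add_mono mult_right_mono) (auto simp: Q.nonneg)
      also have "\<dots> = \<phi> r + e * h"
        by (simp add: \<phi>_def x'_def e'_def algebra_simps exp_add)
      finally show ?case .
    qed
  qed
  moreover have "Q (S 0 x) (S 0 x) = Q x x"
    using S_zero[OF X(1)] X by (intro Q_cong) auto
  ultimately show ?thesis
    by (simp add: \<phi>_def exp_minus field_simps)
qed

text \<open>Both sides depend continuously on \<open>x\<close> in \<open>nrm\<close>, and
  \<open>D\<close> is dense. The limit is taken for the seminorm of \<open>Q\<close>, because it
  obeys the triangle inequality.\<close>

lemma Q_decay:
  assumes "x \<in> X" "t \<ge> 0"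
  shows "Q (S t x) (S t x) \<le> exp (- 2 * t) * Q x x"
proof -
  have "Q.nrm (S t x) \<le> exp (- t) * Q.nrm x"
  proof (rule field_le_epsilon)
    fix e0 :: real
    assume "e0 > 0"
    define e where "e = e0 / 2"
    have "e > 0" using \<open>e0 > 0\<close> by (simp add: e_def)
    from dense[OF assms(1) this] obtain x' where x': "x' \<in> D" "nrm (x - x') < e" by blast
    then have X': "x' \<in> X" using DX by auto
    have "Q.nrm (S t x') \<le> sqrt (exp (- 2 * t) * Q x' x')"
      unfolding Q.nrm_def using Q_decay_domain[OF x'(1) assms(2)] by (rule real_sqrt_le_mono)
    also have "\<dots> = exp (- t) * Q.nrm x'"
      using exp_double[of "- t"] by (simp add: real_sqrt_mult Q.nrm_def)
    also have "\<dots> \<le> exp (- t) * (Q.nrm x + e)"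
      using Q.nrm_diff_ge[of x x'] Q_nrm_le[of "x - x'"] x' X' assms(1) by (intro mult_left_mono) auto
    also have "\<dots> \<le> exp (- t) * Q.nrm x + e"
      using \<open>e > 0\<close> assms by (simp add: distrib_left)
    finally have "Q.nrm (S t x') \<le> exp (- t) * Q.nrm x + e" .
    moreover have "Q.nrm (S t x - S t x') \<le> e"
      using Q_nrm_le[of "S t x - S t x'"] S_lipschitz[of t x x'] x' X' assms by auto
    ultimately show "Q.nrm (S t x) \<le> exp (- t) * Q.nrm x + e0"
      using Q.nrm_diff_ge[of "S t x" "S t x'"] X' assms by (simp add: e_def)
  qed
  then have "(Q.nrm (S t x))\<^sup>2 \<le> (exp (- t) * Q.nrm x)\<^sup>2"
    using assms by (intro power_mono) auto
  then show ?thesis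
    using exp_double[of "- t"] assms by (simp add: power_mult_distrib Q.nrm_sq)
qed

text \<open>\<open>y (t + h)\<close> differs from \<open>S h (y t)\<close> by
  \<open>h *\<^sub>R P t\<close> up to \<open>o(h)\<close>, and the decay of \<open>Q\<close> under
  \<open>S h\<close> supplies the term \<open>- 2 h Q (y t) (y t)\<close>. In this way
  \<open>A\<close> is never applied to \<open>y t\<close>.\<close>

lemma mild_dini:
  assumes y: "\<And>t. t \<ge> 0 \<Longrightarrow> y t \<in> X" and P: "\<And>t. t \<ge> 0 \<Longrightarrow> P t \<in> X" and y0: "y0 \<in> X"
    and int: "\<And>t. t \<ge> 0 \<Longrightarrow> has_riemann_integral nrm (\<lambda>s. S (t - s) (P s)) (y t - S t y0) 0 t"
    and t: "t \<ge> 0" and cont: "((\<lambda>s. nrm (P s - P t)) \<longlongrightarrow> 0) (at_right t)"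
    and e: "e > 0"
  shows "\<forall>\<^sub>F h in at_right 0. Q (y (t + h)) (y (t + h))
      \<le> Q (y t) (y t) + 2 * h * (Q (y t) (P t) - Q (y t) (y t)) + e * h"
proof -
  define q where "q = Q (y t) (y t)"
  have q: "q \<ge> 0" using y t by (simp add: q_def Q.nonneg)
  have pos: "\<forall>\<^sub>F h in at_right (0::real). 0 < h"
    by (auto simp: eventually_at_right_field intro: exI[of _ 1])
  have "\<forall>\<^sub>F h in at_right 0. Q (y (t + h)) (y (t + h))
      \<le> Q (S h (y t)) (S h (y t)) + 2 * h * Q (y t) (P t) + (e / 2) * h"
    by (intro form_dini[where x = "y t"] S_lim mild_expansion[OF y P y0 int t cont])
       (use pos y P t e in \<open>auto elim!: eventually_mono\<close>)
  moreover have "\<forall>\<^sub>F h in at_right 0. exp (- 2 * h) * q \<le> q - 2 * h * q + (e / 2) * h"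
  proof -
    have "((\<lambda>h. exp (- 2 * h) * q) has_real_derivative - 2 * q) (at 0)"
      by (auto intro!: derivative_eq_intros)
    then have "((\<lambda>h. (exp (- 2 * h) * q - q) / h) \<longlongrightarrow> - 2 * q) (at 0)"
      by (simp add: has_field_derivative_iff)
    then have "((\<lambda>h. (exp (- 2 * h) * q - q) / h) \<longlongrightarrow> - 2 * q) (at_right 0)"
      by (rule tendsto_within_subset) auto
    then have "\<forall>\<^sub>F h in at_right 0. (exp (- 2 * h) * q - q) / h < - 2 * q + e / 2"
      using e by (intro order_tendstoD(2)) auto
    then show ?thesis
      using pos by eventually_elim (simp add: field_simps)
  qed
  ultimately show ?thesis
    using pos
  proof eventually_elim
    case (elim h)
    have "Q (S h (y t)) (S h (y t)) \<le> exp (- 2 * h) * q"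
      unfolding q_def using elim y t by (intro Q_decay) auto
    with elim show ?case
      by (simp add: q_def algebra_simps)
  qed
qed

end

subsection \<open>Square integrable functions on an interval\<close>

text \<open>Squares of positive parts are of class C1, which is all that a test function must be;
  products of two of them give explicit functions of compact support.\<close>

lemma has_real_derivative_pos_part_square:
  "((\<lambda>x. (max 0 x)\<^sup>2) has_real_derivative 2 * max 0 x) (at x)" for x :: real
proof (cases "x = 0")
  case False
  then consider "x > 0" | "x < 0" by linarith
  then show ?thesis
  proof cases
    case 1
    have "((\<lambda>x. x\<^sup>2) has_real_derivative 2 * max 0 x) (at x)"
      using 1 by (auto intro!: derivative_eq_intros)
    then show ?thesis
      by (rule has_field_derivative_transform_within_open[of _ _ _ "{0<..}"]) (use 1 in auto)
  next
    case 2
    have "((\<lambda>x. 0) has_real_derivative 2 * max 0 x) (at x)"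
      using 2 by auto
    then show ?thesis
      by (rule has_field_derivative_transform_within_open[of _ _ _ "{..<0}"]) (use 2 in auto)
  qed
next
  case True
  have "(\<lambda>h::real. (max 0 h)\<^sup>2 / h) = (\<lambda>h. max 0 h)"
    by (auto simp: fun_eq_iff max_def power2_eq_square)
  moreover have "((\<lambda>h::real. max 0 h) \<longlongrightarrow> max 0 0) (at 0)"
    by (intro tendsto_intros)
  ultimately show ?thesis
    using True by (simp add: has_field_derivative_iff)
qed

section \<open>L2 as a semi-inner product space\<close>

locale interval =
  fixes a b :: real
  assumes ab: "a < b"
begin

abbreviation M :: "real measure" where "M \<equiv> lebesgue_on {a<..<b}"

abbreviation ip :: "(real \<Rightarrow> real) \<Rightarrow> (real \<Rightarrow> real) \<Rightarrow> real"
  where "ip u w \<equiv> LINT x|M. u x * w x"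

lemma space_M [simp]: "space M = {a<..<b}"
  by simp

lemma measure_M [simp]: "measure M {a<..<b} = b - a"
  using ab by (simp add: measure_restrict_space)

lemma finite_M: "finite_measure M"
  by (intro finite_measure_lebesgue_on) auto

lemma integrable_const_M [simp, intro]: "integrable M (\<lambda>x. c :: real)"
  by (rule finite_measure.integrable_const[OF finite_M])

lemma integral_const_M [simp]: "(LINT x|M. c :: real) = c * (b - a)"
  using measure_M by simp

lemma continuous_measurable_M: "continuous_on {a<..<b} u \<Longrightarrow> u \<in> borel_measurable M"
  for u :: "real \<Rightarrow> real"
  by (rule continuous_imp_measurable_on_sets_lebesgue) auto

lemma integrable_bounded:
  fixes u :: "real \<Rightarrow> real"
  assumes "u \<in> borel_measurable M" "AE x in M. \<bar>u x\<bar> \<le> C"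
  shows "integrable M u"
  by (rule Bochner_Integration.integrable_bound[of M "\<lambda>_. C"]) (use assms in auto)

lemma L2_I_bounded:
  assumes "u \<in> borel_measurable M" "AE x in M. \<bar>u x\<bar> \<le> C"
  shows "u \<in> L2 a b"
proof -
  have "AE x in M. \<bar>(u x)\<^sup>2\<bar> \<le> C\<^sup>2"
    using assms(2) by eventually_elim (auto simp: abs_le_square_iff[symmetric])
  then show ?thesis
    using assms(1) by (auto simp: L2_def intro!: integrable_bounded)
qed

lemma L2_measurable: "u \<in> L2 a b \<Longrightarrow> u \<in> borel_measurable M"
  and L2_square_integrable: "u \<in> L2 a b \<Longrightarrow> integrable M (\<lambda>x. (u x)\<^sup>2)"
  by (auto simp: L2_def)

lemma L2_mult_integrable [simp, intro]:
  assumes "u \<in> L2 a b" "w \<in> L2 a b"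
  shows "integrable M (\<lambda>x. u x * w x)"
proof (rule Bochner_Integration.integrable_bound)
  show "integrable M (\<lambda>x. (u x)\<^sup>2 + (w x)\<^sup>2)"
    using assms by (auto simp: L2_def)
  have "\<bar>u x * w x\<bar> \<le> (u x)\<^sup>2 + (w x)\<^sup>2" for x
  proof -
    have "2 * (\<bar>u x\<bar> * \<bar>w x\<bar>) \<le> (u x)\<^sup>2 + (w x)\<^sup>2"
      using sum_squares_bound[of "\<bar>u x\<bar>" "\<bar>w x\<bar>"] by simp
    moreover have "0 \<le> \<bar>u x\<bar> * \<bar>w x\<bar>" by simp
    ultimately show ?thesis
      unfolding abs_mult by linarith
  qed
  then show "AE x in M. norm (u x * w x) \<le> norm ((u x)\<^sup>2 + (w x)\<^sup>2)"
    by (simp add: abs_of_nonneg)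
qed (use assms[THEN L2_measurable] in measurable)

lemma L2_const [simp, intro]: "(\<lambda>x. c) \<in> L2 a b"
  by (auto simp: L2_def)

lemma L2_integrable: "u \<in> L2 a b \<Longrightarrow> integrable M u"
  using L2_mult_integrable[OF _ L2_const[of 1]] by simp

lemma L2_subspace: "subspace (L2 a b)"
proof -
  have "(\<lambda>x. u x + w x) \<in> L2 a b" if "u \<in> L2 a b" "w \<in> L2 a b" for u w
  proof -
    have "integrable M (\<lambda>x. (u x)\<^sup>2 + (w x)\<^sup>2 + 2 * (u x * w x))"
      using that by (intro Bochner_Integration.integrable_add integrable_mult_right
          L2_mult_integrable L2_square_integrable)
    then have "integrable M (\<lambda>x. (u x + w x)\<^sup>2)"
      by (simp add: power2_sum mult.assoc)
    then show ?thesis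
      using that[THEN L2_measurable] by (simp add: L2_def)
  qed
  moreover have "(\<lambda>x. c * u x) \<in> L2 a b" if "u \<in> L2 a b" for u c
    using that by (auto simp: L2_def power_mult_distrib)
  ultimately show ?thesis
    using L2_const[of 0]
    by (auto simp: subspace_def plus_fun_def scaleR_fun_def zero_fun_def)
qed

sublocale L2: semi_inner "L2 a b" ip
  rewrites "semi_inner.nrm ip = L2_norm a b"
proof -
  show "semi_inner (L2 a b) ip"
  proof
    show "ip (u + w) z = ip u z + ip w z" if "u \<in> L2 a b" "w \<in> L2 a b" "z \<in> L2 a b" for u w z
      using that by (simp add: distrib_right)
    show "ip (c *\<^sub>R u) w = c * ip u w" for u w c
      by (simp add: scaleR_fun_def mult.assoc)
  qed (auto simp: L2_subspace mult.commute)
  then show "semi_inner.nrm ip = L2_norm a b"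
    by (simp add: semi_inner.nrm_def L2_norm_def fun_eq_iff power2_eq_square)
qed

lemma L2_add [simp, intro]: "u \<in> L2 a b \<Longrightarrow> w \<in> L2 a b \<Longrightarrow> (\<lambda>x. u x + w x) \<in> L2 a b"
  and L2_diff [simp, intro]: "u \<in> L2 a b \<Longrightarrow> w \<in> L2 a b \<Longrightarrow> (\<lambda>x. u x - w x) \<in> L2 a b"
  and L2_cmult [simp, intro]: "u \<in> L2 a b \<Longrightarrow> (\<lambda>x. c * u x) \<in> L2 a b"
  using L2.mem(2)[of u w] L2.mem(3)[of u w] L2.mem(4)[of u c]
  by (auto simp: plus_fun_def scaleR_fun_def fun_diff_def)

lemma L2_mult_bounded:
  assumes "u \<in> L2 a b" "w \<in> borel_measurable M" "AE x in M. \<bar>w x\<bar> \<le> C"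
  shows "(\<lambda>x. w x * u x) \<in> L2 a b"
proof -
  have "integrable M (\<lambda>x. (w x * u x)\<^sup>2)"
  proof (rule Bochner_Integration.integrable_bound)
    show "integrable M (\<lambda>x. C\<^sup>2 * (u x)\<^sup>2)"
      using assms by (auto dest: L2_square_integrable)
    show "AE x in M. norm ((w x * u x)\<^sup>2) \<le> norm (C\<^sup>2 * (u x)\<^sup>2)"
      using assms(3)
    proof eventually_elim
      case (elim x)
      then have "(w x)\<^sup>2 \<le> C\<^sup>2"
        using abs_le_square_iff[of "w x" C] by auto
      then show ?case
        by (auto simp: power_mult_distrib intro!: mult_right_mono)
    qed
  qed (use L2_measurable[OF assms(1)] assms(2) in measurable)
  then show ?thesis
    using assms by (auto simp: L2_def intro: borel_measurable_times)
qed

lemma L2_norm_power2: "u \<in> L2 a b \<Longrightarrow> (L2_norm a b u)\<^sup>2 = (LINT x|M. (u x)\<^sup>2)"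
  using L2.nrm_sq[of u] by (simp add: power2_eq_square)

lemma L2_norm_mono:
  assumes "u \<in> borel_measurable M" "w \<in> L2 a b" "AE x in M. \<bar>u x\<bar> \<le> \<bar>w x\<bar>"
  shows "u \<in> L2 a b" "L2_norm a b u \<le> L2_norm a b w"
proof -
  have le: "AE x in M. (u x)\<^sup>2 \<le> (w x)\<^sup>2"
    using assms(3) by eventually_elim (simp add: abs_le_square_iff)
  have "integrable M (\<lambda>x. (u x)\<^sup>2)"
    by (rule Bochner_Integration.integrable_bound[OF L2_square_integrable[OF assms(2)]])
       (use assms(1) le in \<open>auto intro: borel_measurable_power\<close>)
  then show "u \<in> L2 a b" using assms(1) by (simp add: L2_def)
  then show "L2_norm a b u \<le> L2_norm a b w"
    unfolding L2_norm_def using le assms(2)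
    by (intro real_sqrt_le_mono integral_mono_AE) (auto dest: L2_square_integrable)
qed

lemma L2_norm_bounded:
  assumes "u \<in> borel_measurable M" "AE x in M. \<bar>u x\<bar> \<le> C" "C \<ge> 0"
  shows "L2_norm a b u \<le> sqrt (b - a) * C"
proof -
  have "L2_norm a b u \<le> L2_norm a b (\<lambda>x. C)"
    using assms by (intro L2_norm_mono(2)) auto
  also have "\<dots> = sqrt (b - a) * C"
    using assms by (simp add: L2_norm_def real_sqrt_mult mult.commute)
  finally show ?thesis .
qed

lemma L1_norm_le_L2_norm:
  assumes "u \<in> L2 a b"
  shows "L1_norm a b u \<le> sqrt (b - a) * L2_norm a b u"
proof -
  have abs: "(\<lambda>x. \<bar>u x\<bar>) \<in> L2 a b"
    using assms by (auto simp: L2_def)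
  have one: "L2_norm a b (\<lambda>x. 1) = sqrt (b - a)" by (simp add: L2_norm_def)
  have "L2_norm a b (\<lambda>x. \<bar>u x\<bar>) = L2_norm a b u" by (simp add: L2_norm_def)
  with L2.cauchy_schwarz[OF L2_const[of 1] abs] one show ?thesis
    by (simp add: L1_norm_def)
qed

lemma L2_norm_eq_0_AE:
  assumes "u \<in> L2 a b" "L2_norm a b u = 0"
  shows "AE x in M. u x = 0"
  using assms integral_nonneg_eq_0_iff_AE[OF L2_square_integrable[OF assms(1)]]
  by (simp add: L2_norm_def)

lemma L2_norm_dominated_convergence:
  assumes w: "w \<in> L2 a b" and m: "\<And>n. s n \<in> borel_measurable M" "u \<in> borel_measurable M"
    and bd: "\<And>n. AE x in M. \<bar>s n x - u x\<bar> \<le> \<bar>w x\<bar>"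
    and lim: "AE x in M. (\<lambda>n. s n x) \<longlonglongrightarrow> u x"
  shows "(\<lambda>n. L2_norm a b (\<lambda>x. s n x - u x)) \<longlonglongrightarrow> 0"
proof -
  have "(\<lambda>n. LINT x|M. (s n x - u x)\<^sup>2) \<longlonglongrightarrow> (LINT x|M. 0)"
  proof (rule integral_dominated_convergence)
    show "integrable M (\<lambda>x. (w x)\<^sup>2)"
      using w by (rule L2_square_integrable)
    show "AE x in M. (\<lambda>n. (s n x - u x)\<^sup>2) \<longlonglongrightarrow> 0"
      using lim
    proof eventually_elim
      case (elim x)
      then have "(\<lambda>n. (s n x - u x)\<^sup>2) \<longlonglongrightarrow> (u x - u x)\<^sup>2"
        by (intro tendsto_intros)
      then show ?case by simp
    qed
    show "AE x in M. norm ((s n x - u x)\<^sup>2) \<le> (w x)\<^sup>2" for n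
      using bd[of n] by eventually_elim (simp add: abs_le_square_iff)
  qed (use m in measurable)
  then have "(\<lambda>n. sqrt (LINT x|M. (s n x - u x)\<^sup>2)) \<longlonglongrightarrow> sqrt 0"
    by (intro tendsto_real_sqrt) simp
  then show ?thesis by (simp add: L2_norm_def)
qed

section \<open>Test functions and their density in L2\<close>

lemma test_functionsI:
  assumes "\<And>x. (\<phi> has_real_derivative \<phi>' x) (at x)" "continuous_on UNIV \<phi>'"
    and "compact K" "K \<subseteq> {a<..<b}" "\<And>x. x \<notin> K \<Longrightarrow> \<phi> x = 0"
  shows "\<phi> \<in> test_functions a b" "deriv \<phi> = \<phi>'"
proof -
  show "deriv \<phi> = \<phi>'"
    using assms(1) by (auto intro!: DERIV_imp_deriv)
  with assms show "\<phi> \<in> test_functions a b"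
    unfolding test_functions_def C_k_def
    by (auto simp: real_differentiable_def)
qed

lemma test_functionsE:
  assumes "\<phi> \<in> test_functions a b"
  obtains \<eta> where "\<eta> > 0" "\<And>x. x \<notin> {a + \<eta>..b - \<eta>} \<Longrightarrow> \<phi> x = 0"
    "\<And>x. (\<phi> has_real_derivative deriv \<phi> x) (at x)" "continuous_on UNIV (deriv \<phi>)" "continuous_on UNIV \<phi>"
proof -
  from assms obtain K where K: "C_k 1 \<phi>" "compact K" "K \<subseteq> {a<..<b}" "\<And>x. x \<notin> K \<Longrightarrow> \<phi> x = 0"
    by (auto simp: test_functions_def)
  have der: "(\<phi> has_real_derivative deriv \<phi> x) (at x)" for x
    using K(1) unfolding C_k_def by (auto simp: DERIV_deriv_iff_real_differentiable)
  have c': "continuous_on UNIV (deriv \<phi>)"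
    using K(1) unfolding C_k_def by simp
  have c: "continuous_on UNIV \<phi>"
    using der by (intro continuous_at_imp_continuous_on) (auto intro: DERIV_isCont)
  show thesis
  proof (cases "K = {}")
    case True
    then show ?thesis using that[of 1] der c c' K(4) by auto
  next
    case False
    obtain l where l: "l \<in> K" "\<And>x. x \<in> K \<Longrightarrow> l \<le> x"
      using compact_attains_inf[OF K(2) False] by blast
    obtain r where r: "r \<in> K" "\<And>x. x \<in> K \<Longrightarrow> x \<le> r"
      using compact_attains_sup[OF K(2) False] by blast
    have lr: "a < l" "r < b" using K(3) l(1) r(1) by auto
    define \<eta> where "\<eta> = min (l - a) (b - r)"
    have "\<phi> x = 0" if "x \<notin> {a + \<eta>..b - \<eta>}" for x
    proof (rule K(4), rule notI)
      assume "x \<in> K"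
      with l(2) r(2) that show False by (force simp: \<eta>_def)
    qed
    with that[of \<eta>] der c c' lr show ?thesis by (auto simp: \<eta>_def)
  qed
qed

lemma continuous_L2:
  assumes "continuous_on {a..b} u"
  shows "u \<in> L2 a b"
proof -
  have "compact (u ` {a..b})"
    using assms by (intro compact_continuous_image) auto
  then obtain C where C: "\<And>x. x \<in> {a..b} \<Longrightarrow> \<bar>u x\<bar> \<le> C"
    using compact_imp_bounded bounded_iff by (metis imageI real_norm_def)
  have "continuous_on {a<..<b} u"
    using assms by (rule continuous_on_subset) auto
  then show ?thesis
    using C by (intro L2_I_bounded[of u C] continuous_measurable_M AE_I2) auto
qed

lemma test_functions_L2: "\<phi> \<in> test_functions a b \<Longrightarrow> \<phi> \<in> L2 a b"
  and test_functions_deriv_L2: "\<phi> \<in> test_functions a b \<Longrightarrow> deriv \<phi> \<in> L2 a b"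
  by (auto elim!: test_functionsE intro!: continuous_L2 intro: continuous_on_subset)

text \<open>A C1 function that vanishes outside \<open>[a + \<eta>, b - \<eta>]\<close> and is
  positive in the interior of this interval.\<close>

definition bump :: "real \<Rightarrow> real \<Rightarrow> real"
  where "bump \<eta> x = (max 0 (x - a - \<eta>))\<^sup>2 * (max 0 (b - \<eta> - x))\<^sup>2"

definition bump' :: "real \<Rightarrow> real \<Rightarrow> real"
  where "bump' \<eta> x = 2 * max 0 (x - a - \<eta>) * (max 0 (b - \<eta> - x))\<^sup>2
    - (max 0 (x - a - \<eta>))\<^sup>2 * (2 * max 0 (b - \<eta> - x))"

lemma bump_derivative: "(bump \<eta> has_real_derivative bump' \<eta> x) (at x)"
proof -
  have 1: "((\<lambda>x. (max 0 (x - a - \<eta>))\<^sup>2) has_real_derivative 2 * max 0 (x - a - \<eta>) * 1) (at x)"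
    by (rule DERIV_chain2[OF has_real_derivative_pos_part_square]) (auto intro!: derivative_eq_intros)
  have 2: "((\<lambda>x. (max 0 (b - \<eta> - x))\<^sup>2) has_real_derivative 2 * max 0 (b - \<eta> - x) * (- 1)) (at x)"
    by (rule DERIV_chain2[OF has_real_derivative_pos_part_square]) (auto intro!: derivative_eq_intros)
  show ?thesis
    unfolding bump_def[abs_def] bump'_def
    by (rule DERIV_cong[OF DERIV_mult[OF 1 2]]) (simp add: algebra_simps)
qed

lemma bump_nonneg: "bump \<eta> x \<ge> 0"
  by (simp add: bump_def)

text \<open>The factor in front of \<open>p\<close> takes values in \<open>[0, 1)\<close> and tends
  to 1 as \<delta> tends to 0 wherever the bump is positive. It is a cutoff with an explicit
  derivative, so no mollifier is involved.\<close>

lemma bump_cutoff_test_function: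
  assumes p: "\<And>x. (p has_real_derivative p' x) (at x)" "continuous_on UNIV p'"
    and "\<eta> > 0" "\<delta> > 0"
  shows "(\<lambda>x. bump \<eta> x / (\<delta> + bump \<eta> x) * p x) \<in> test_functions a b"
proof (rule test_functionsI(1))
  have pos: "\<delta> + bump \<eta> x > 0" for x
    using bump_nonneg[of \<eta> x] \<open>\<delta> > 0\<close> by linarith
  have nz: "\<delta> + bump \<eta> x \<noteq> 0" for x
    using pos[of x] by simp
  define q where "q x = (bump' \<eta> x * (\<delta> + bump \<eta> x) - bump \<eta> x * bump' \<eta> x)
      / ((\<delta> + bump \<eta> x) * (\<delta> + bump \<eta> x)) * p x + p' x * (bump \<eta> x / (\<delta> + bump \<eta> x))" for x
  show "((\<lambda>x. bump \<eta> x / (\<delta> + bump \<eta> x) * p x) has_real_derivative q x) (at x)" for x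
  proof -
    have 1: "((\<lambda>x. \<delta> + bump \<eta> x) has_real_derivative bump' \<eta> x) (at x)"
      by (auto intro!: derivative_eq_intros bump_derivative)
    show ?thesis
      unfolding q_def by (rule DERIV_mult[OF DERIV_divide[OF bump_derivative 1 nz] p(1)])
  qed
  have cont: "continuous_on UNIV (bump \<eta>)" "continuous_on UNIV (bump' \<eta>)" "continuous_on UNIV p"
    using p(1) by (auto simp: bump_def[abs_def] bump'_def[abs_def] intro!: continuous_intros
        intro: continuous_at_imp_continuous_on DERIV_isCont)
  show "continuous_on UNIV q"
    unfolding q_def[abs_def] using nz by (intro continuous_intros cont p(2)) auto
  show "compact {a + \<eta>..b - \<eta>}" "{a + \<eta>..b - \<eta>} \<subseteq> {a<..<b}"
    using \<open>\<eta> > 0\<close> by auto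
  show "bump \<eta> x / (\<delta> + bump \<eta> x) * p x = 0" if "x \<notin> {a + \<eta>..b - \<eta>}" for x
    using that by (auto simp: bump_def max_def)
qed

text \<open>A measurable function is almost everywhere a limit of continuous ones. These are clipped
  to \<open>[- C, C]\<close>, replaced by polynomials through Stone-Weierstrass to gain
  differentiability, and cut off near the end points. All approximants share one constant bound, so
  dominated convergence applies.\<close>

lemma test_functions_dense_bounded:
  assumes u: "u \<in> borel_measurable M" "\<And>x. \<bar>u x\<bar> \<le> C" and "e > 0"
  shows "\<exists>\<phi>\<in>test_functions a b. L2_norm a b (\<lambda>x. \<phi> x - u x) < e"
proof -
  have "u measurable_on {a<..<b}"
    using u(1) by (subst measurable_on_iff_borel_measurable) auto
  then obtain Z g where Z: "negligible Z" and g: "\<And>n. continuous_on UNIV (g n)"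
    and lim: "\<And>x. x \<notin> Z \<Longrightarrow> (\<lambda>n. g n x) \<longlonglongrightarrow> (if x \<in> {a<..<b} then u x else 0)"
    unfolding measurable_on_def by blast
  define h where "h n x = max (- C) (min C (g n x))" for n x
  have C: "C \<ge> 0" using u(2)[of 0] by linarith
  have hb: "\<bar>h n x\<bar> \<le> C" for n x
    using C by (auto simp: h_def)
  have hc: "continuous_on {a..b} (h n)" for n
    unfolding h_def by (intro continuous_intros continuous_on_subset[OF g]) auto
  have "\<exists>p. real_polynomial_function p \<and> (\<forall>x\<in>{a..b}. \<bar>h n x - p x\<bar> < 1 / (real n + 1))" for n
    using Stone_Weierstrass_real_polynomial_function[OF compact_Icc hc[of n], of "1 / (real n + 1)"]
    by (metis add_pos_nonneg add.commute of_nat_0_le_iff zero_less_divide_1_iff zero_less_one)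
  then obtain p where p: "\<And>n. real_polynomial_function (p n)"
    "\<And>n x. x \<in> {a..b} \<Longrightarrow> \<bar>h n x - p n x\<bar> < 1 / (real n + 1)"
    by metis
  define \<phi> where "\<phi> n x = bump (1 / (real n + 1)) x / (1 / (real n + 1) + bump (1 / (real n + 1)) x) * p n x" for n x
  have \<phi>: "\<phi> n \<in> test_functions a b" for n
  proof -
    obtain p' where p': "real_polynomial_function p'" "\<And>x. (p n has_real_derivative p' x) (at x)"
      using has_real_derivative_polynomial_function[OF p(1)] by blast
    have "continuous_on UNIV p'"
      using continuous_real_polymonial_function[OF p'(1)] by (rule continuous_at_imp_continuous_on[OF ballI])
    with p'(2) show ?thesis
      unfolding \<phi>_def by (rule bump_cutoff_test_function) auto
  qed
  have cut: "0 \<le> bump \<eta> x / (\<delta> + bump \<eta> x)" "bump \<eta> x / (\<delta> + bump \<eta> x) \<le> 1" if "\<delta> > 0" for \<delta> \<eta> x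
    using that bump_nonneg[of \<eta> x] by (auto simp: field_simps)
  have inv0: "(\<lambda>n. 1 / (real n + 1)) \<longlonglongrightarrow> 0"
    using LIMSEQ_inverse_real_of_nat by (simp add: inverse_eq_divide add.commute)
  have "(\<lambda>n. L2_norm a b (\<lambda>x. \<phi> n x - u x)) \<longlonglongrightarrow> 0"
  \<comment> \<open>\<open>C + 1\<close> bounds the polynomials, whose distance from the clipped
    functions is at most 1, and \<open>C\<close> bounds \<open>u\<close>.\<close>
  proof (rule L2_norm_dominated_convergence[of "\<lambda>_. 2 * C + 1"])
    show "AE x in M. \<bar>\<phi> n x - u x\<bar> \<le> \<bar>2 * C + 1\<bar>" for n
    proof (rule AE_I2)
      fix x
      assume "x \<in> space M"
      then have x: "x \<in> {a..b}" by auto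
      have "1 / (real n + 1) \<le> 1" by simp
      with p(2)[OF x, of n] hb[of n x] have pb: "\<bar>p n x\<bar> \<le> C + 1" by linarith
      have "\<bar>\<phi> n x\<bar> \<le> 1 * \<bar>p n x\<bar>"
        unfolding \<phi>_def abs_mult[of "_ / _"]
      proof (rule mult_right_mono)
        have "1 / (real n + 1) > 0" by simp
        then show "\<bar>bump (1 / (real n + 1)) x / (1 / (real n + 1) + bump (1 / (real n + 1)) x)\<bar> \<le> 1"
          using cut[of "1 / (real n + 1)" "1 / (real n + 1)" x] by (simp only: abs_of_nonneg)
      qed simp
      with pb u(2)[of x] C show "\<bar>\<phi> n x - u x\<bar> \<le> \<bar>2 * C + 1\<bar>" by linarith
    qed
    have "Z \<in> null_sets lebesgue"
      using Z by (simp add: negligible_iff_null_sets)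
    then have "AE x in lebesgue. x \<notin> Z"
      by (rule AE_not_in)
    then have "AE x in M. x \<in> {a<..<b} \<and> x \<notin> Z"
      by (subst AE_restrict_space_iff) auto
    then show "AE x in M. (\<lambda>n. \<phi> n x) \<longlonglongrightarrow> u x"
    proof eventually_elim
      case (elim x)
      then have x: "x \<in> {a<..<b}" "x \<in> {a..b}" and g': "(\<lambda>n. g n x) \<longlonglongrightarrow> u x"
        using lim[of x] by auto
      have "(\<lambda>n. h n x) \<longlonglongrightarrow> max (- C) (min C (u x))"
        unfolding h_def by (intro tendsto_intros g')
      also have "max (- C) (min C (u x)) = u x"
        using u(2)[of x] by (auto simp: max_def min_def abs_le_iff)
      finally have h: "(\<lambda>n. h n x) \<longlonglongrightarrow> u x" .
      have hp: "(\<lambda>n. h n x - p n x) \<longlonglongrightarrow> 0"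
        by (rule Lim_null_comparison[OF _ inv0]) (use p(2)[OF x(2)] in \<open>auto intro!: always_eventually less_imp_le\<close>)
      have pu: "(\<lambda>n. p n x) \<longlonglongrightarrow> u x"
        using tendsto_diff[OF h hp] by simp
      \<comment> \<open>The pointwise limit of the bumps as their margin shrinks. It is positive on
        the open interval, so the cutoff factors tend to 1 at \<open>x\<close>.\<close>
      define \<beta> where "\<beta> = (max 0 (x - a - 0))\<^sup>2 * (max 0 (b - 0 - x))\<^sup>2"
      have \<beta>: "\<beta> > 0" using x by (simp add: \<beta>_def)
      have bl: "(\<lambda>n. bump (1 / (real n + 1)) x) \<longlonglongrightarrow> \<beta>"
        unfolding bump_def \<beta>_def by (intro tendsto_intros inv0)
      have "(\<lambda>n. \<phi> n x) \<longlonglongrightarrow> \<beta> / (0 + \<beta>) * u x"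
        unfolding \<phi>_def by (intro tendsto_intros inv0 bl pu) (use \<beta> in auto)
      then show ?case using \<beta> by simp
    qed
  qed (use \<phi> test_functions_L2 L2_measurable u in auto)
  with \<open>e > 0\<close> have "\<forall>\<^sub>F n in sequentially. L2_norm a b (\<lambda>x. \<phi> n x - u x) < e"
    by (rule order_tendstoD(2)[rotated])
  then obtain n where "L2_norm a b (\<lambda>x. \<phi> n x - u x) < e"
    by (auto simp: eventually_sequentially)
  with \<phi> show ?thesis by blast
qed

lemma test_functions_dense:
  assumes u: "u \<in> L2 a b" and "e > 0"
  shows "\<exists>\<phi>\<in>test_functions a b. L2_norm a b (\<phi> - u) < e"
proof -
  define s where "s n x = max (- real n) (min (real n) (u x))" for n x
  have sm: "s n \<in> borel_measurable M" for n
    unfolding s_def using L2_measurable[OF u] by measurable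
  have sb: "\<bar>s n x\<bar> \<le> real n" for n x
    by (auto simp: s_def)
  have sL2: "s n \<in> L2 a b" for n
    using sm sb by (intro L2_I_bounded) auto
  have "(\<lambda>n. L2_norm a b (\<lambda>x. s n x - u x)) \<longlonglongrightarrow> 0"
  proof (rule L2_norm_dominated_convergence[OF u])
    show "AE x in M. (\<lambda>n. s n x) \<longlonglongrightarrow> u x"
    proof (rule AE_I2)
      fix x
      obtain n0 where "\<bar>u x\<bar> \<le> real n0"
        using real_arch_simple by blast
      then have "s n x = u x" if "n \<ge> n0" for n
        using that by (auto simp: s_def max_def min_def abs_le_iff)
      then show "(\<lambda>n. s n x) \<longlonglongrightarrow> u x"
        by (intro tendsto_eventually) (auto simp: eventually_sequentially)
    qed
  qed (use sm L2_measurable[OF u] in \<open>auto simp: s_def\<close>)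
  then have "\<forall>\<^sub>F n in sequentially. L2_norm a b (\<lambda>x. s n x - u x) < e / 2"
    using \<open>e > 0\<close> by (intro order_tendstoD(2)) auto
  then obtain n where n: "L2_norm a b (\<lambda>x. s n x - u x) < e / 2"
    by (auto simp: eventually_sequentially)
  obtain \<phi> where \<phi>: "\<phi> \<in> test_functions a b" "L2_norm a b (\<lambda>x. \<phi> x - s n x) < e / 2"
    using test_functions_dense_bounded[OF sm sb, of "e / 2"] \<open>e > 0\<close> by auto
  have "L2_norm a b (\<phi> - u) \<le> L2_norm a b (\<phi> - s n) + L2_norm a b (s n - u)"
    using test_functions_L2[OF \<phi>(1)] sL2 u by (intro L2.nrm_diff_triangle)
  with n \<phi>(2) have "L2_norm a b (\<phi> - u) < e"
    by (simp add: fun_diff_def)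
  with \<phi>(1) show ?thesis by blast
qed

text \<open>The fundamental lemma of the calculus of variations:
  \<open>(L2_norm a b u)\<^sup>2\<close> is the product of \<open>u\<close> with
  \<open>u - \<phi>\<close>, and the norm of \<open>u - \<phi>\<close> can be made arbitrarily small
  by density.\<close>

lemma orthogonal_to_test_functions:
  assumes u: "u \<in> L2 a b" and ortho: "\<And>\<phi>. \<phi> \<in> test_functions a b \<Longrightarrow> ip u \<phi> = 0"
  shows "L2_norm a b u = 0" "AE x in M. u x = 0"
proof -
  have "L2_norm a b u \<le> 0 + e" if "e > 0" for e
  proof -
    obtain \<phi> where \<phi>: "\<phi> \<in> test_functions a b" "L2_norm a b (\<phi> - u) < e"
      using test_functions_dense[OF u \<open>e > 0\<close>] by blast
    note \<phi>L2 = test_functions_L2[OF \<phi>(1)]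
    have "(L2_norm a b u)\<^sup>2 = ip u (u - \<phi>)"
      using u \<phi>L2 ortho[OF \<phi>(1)] L2.diff_right[of u \<phi> u] by (simp add: L2.nrm_sq)
    also have "\<dots> \<le> L2_norm a b u * L2_norm a b (u - \<phi>)"
      using L2.cauchy_schwarz[of u "u - \<phi>"] u \<phi>L2 by auto
    also have "\<dots> \<le> L2_norm a b u * e"
      using \<phi>(2) L2.nrm_minus[OF u \<phi>L2] u by (intro mult_left_mono) auto
    finally have "L2_norm a b u * L2_norm a b u \<le> L2_norm a b u * e"
      by (simp add: power2_eq_square)
    then show ?thesis
      using u \<open>e > 0\<close> L2.nrm_nonneg[OF u] by (cases "L2_norm a b u = 0") auto
  qed
  then show 0: "L2_norm a b u = 0"
    using L2.nrm_nonneg[OF u] by (intro antisym field_le_epsilon[of _ 0]) auto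
  show "AE x in M. u x = 0"
    using u 0 by (rule L2_norm_eq_0_AE)
qed

end

subsection \<open>Weak derivatives\<close>

text \<open>Identities below are checked for test functions and extended by density; the difference
  of their two sides is then bounded by a fixed multiple of the approximation error
  \<open>e\<close>.\<close>

lemma eq_0_if_abs_le_mult:
  fixes x :: real
  assumes "K \<ge> 0" "\<And>e. e > 0 \<Longrightarrow> \<bar>x\<bar> \<le> K * e"
  shows "x = 0"
proof -
  have "\<bar>x\<bar> \<le> 0 + e" if "e > 0" for e
  proof -
    have "\<bar>x\<bar> \<le> K * (e / (K + 1))"
      using assms(1) that by (intro assms(2)) auto
    also have "\<dots> \<le> e"
      using assms(1) that by (simp add: field_simps)
    finally show ?thesis by simp
  qed
  then have "\<bar>x\<bar> \<le> 0" by (rule field_le_epsilon)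
  then show ?thesis by simp
qed

context interval
begin

lemma ip_cong_AE:
  assumes "u \<in> L2 a b" "u' \<in> L2 a b" "w \<in> L2 a b" "AE x in M. u x = u' x"
  shows "ip u w = ip u' w"
  by (rule integral_cong_AE)
     (use assms L2_measurable[OF assms(1)] L2_measurable[OF assms(2)] L2_measurable[OF assms(3)] in
       \<open>auto intro: borel_measurable_times\<close>)

lemma ip_cong: "(\<And>x. x \<in> {a<..<b} \<Longrightarrow> u x = u' x) \<Longrightarrow> ip u w = ip u' w"
  by (rule Bochner_Integration.integral_cong) auto

lemma indicator_L2 [simp]: "A \<in> sets borel \<Longrightarrow> (indicator A :: real \<Rightarrow> real) \<in> L2 a b"
proof (rule L2_I_bounded[of _ 1])
  assume "A \<in> sets borel"
  then have "(indicator A :: real \<Rightarrow> real) \<in> borel_measurable borel" by simp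
  then show "(indicator A :: real \<Rightarrow> real) \<in> borel_measurable M"
    by (simp add: measurable_restrict_space1 measurable_completion)
qed (auto simp: indicator_def)

lemma integral_FTC:
  assumes "\<And>x. (\<Phi> has_real_derivative \<phi> x) (at x)" "continuous_on UNIV \<phi>" "a \<le> p" "p \<le> q" "q \<le> b"
  shows "(LINT x|M. indicator {p<..<q} x * \<phi> x) = \<Phi> q - \<Phi> p"
proof -
  have cont: "continuous_on {a..b} \<phi>"
    using assms(2) by (rule continuous_on_subset) auto
  have "(\<lambda>x. indicator {p<..<q} x * \<phi> x) \<in> L2 a b"
  proof (rule L2_mult_bounded[OF continuous_L2[OF cont], of _ 1])
    show "(indicator {p<..<q} :: real \<Rightarrow> real) \<in> borel_measurable M"
      by (intro L2_measurable indicator_L2) auto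
  qed (auto simp: indicator_def)
  then have "(LINT x|M. indicator {p<..<q} x * \<phi> x) = integral {a<..<b} (\<lambda>x. indicator {p<..<q} x * \<phi> x)"
    by (intro lebesgue_integral_eq_integral L2_integrable) auto
  also have "\<dots> = integral {a<..<b} (\<lambda>x. if x \<in> {p<..<q} then \<phi> x else 0)"
    by (rule arg_cong[where f = "integral _"]) (auto simp: indicator_def)
  also have "\<dots> = integral {p<..<q} \<phi>"
  proof -
    have "{p<..<q} \<inter> {a<..<b} = {p<..<q}" using assms by auto
    then show ?thesis
      by (simp only: Henstock_Kurzweil_Integration.integral_restrict_Int)
  qed
  also have "\<dots> = integral {p..q} \<phi>"
    by (rule integral_open_interval_real[symmetric])
  also have "\<dots> = \<Phi> q - \<Phi> p"
    using assms(1,4) by (intro integral_unique fundamental_theorem_of_calculus)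
      (auto simp: has_real_derivative_iff_has_vector_derivative intro: has_vector_derivative_at_within)
  finally show ?thesis .
qed

lemma integral_FTC_full:
  assumes "\<And>x. (\<Phi> has_real_derivative \<phi> x) (at x)" "continuous_on UNIV \<phi>"
  shows "(LINT x|M. \<phi> x) = \<Phi> b - \<Phi> a"
proof -
  have "(LINT x|M. \<phi> x) = (LINT x|M. indicator {a<..<b} x * \<phi> x)"
    by (rule Bochner_Integration.integral_cong) auto
  also have "\<dots> = \<Phi> b - \<Phi> a"
    using ab by (intro integral_FTC assms) auto
  finally show ?thesis .
qed

text \<open>The primitive of \<open>w\<close> that vanishes at \<open>a\<close>, since the measure
  lives on the interval. Writing it as a product with an indicator makes linearity and the
  Cauchy-Schwarz inequality available.\<close>

definition prim :: "(real \<Rightarrow> real) \<Rightarrow> real \<Rightarrow> real"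
  where "prim w x = ip (indicator {..<x}) w"

lemma prim_diff: "u \<in> L2 a b \<Longrightarrow> w \<in> L2 a b \<Longrightarrow> prim (u - w) x = prim u x - prim w x"
  and prim_scale: "u \<in> L2 a b \<Longrightarrow> prim (c *\<^sub>R u) x = c * prim u x"
  unfolding prim_def by (subst L2.bilin; simp)+

lemma indicator_interval_norm:
  assumes "a \<le> p" "p \<le> q" "q \<le> b"
  shows "L2_norm a b (indicator {p<..<q}) = sqrt (q - p)"
proof -
  have "(LINT x|M. indicator {p<..<q} x * 1) = q - p"
    by (rule integral_FTC[of "\<lambda>x. x" "\<lambda>_. 1"]) (use assms in \<open>auto intro!: derivative_eq_intros\<close>)
  moreover have "(LINT x|M. (indicator {p<..<q} x)\<^sup>2) = (LINT x|M. indicator {p<..<q} x * (1::real))"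
    by (rule Bochner_Integration.integral_cong) (auto simp: indicator_def)
  ultimately show ?thesis by (simp add: L2_norm_def)
qed

lemma AE_neq: "AE x in M. x \<noteq> p"
proof -
  have "AE x in lebesgue. x \<noteq> p"
    by (rule AE_I'[of "{p}"]) (auto simp flip: negligible_iff_null_sets)
  then show ?thesis by (subst AE_restrict_space_iff) auto
qed

lemma prim_increment:
  assumes w: "w \<in> L2 a b" and "p \<le> q"
  shows "prim w q - prim w p = ip (indicator {p<..<q}) w"
proof -
  have "prim w q - prim w p = ip (indicator {..<q} - indicator {..<p}) w"
    unfolding prim_def using w by (subst L2.diff_left) auto
  also have "\<dots> = ip (indicator {p<..<q}) w"
  proof (rule ip_cong_AE)
    show "AE x in M. (indicator {..<q} - indicator {..<p}) x = (indicator {p<..<q} x :: real)"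
      using AE_neq[of p] by eventually_elim (use \<open>p \<le> q\<close> in \<open>auto simp: indicator_def\<close>)
  qed (use w in auto)
  finally show ?thesis .
qed

text \<open>Hoelder continuity with exponent 1/2, from the Cauchy-Schwarz inequality with the
  indicator of the interval between the two points.\<close>

lemma prim_lipschitz:
  assumes w: "w \<in> L2 a b" and "a \<le> p" "p \<le> q" "q \<le> b"
  shows "\<bar>prim w q - prim w p\<bar> \<le> sqrt (q - p) * L2_norm a b w"
  using L2.cauchy_schwarz[of "indicator {p<..<q}" w] assms
  by (simp add: prim_increment indicator_interval_norm)

lemma prim_a [simp]: "w \<in> L2 a b \<Longrightarrow> prim w a = 0"
  unfolding prim_def using ip_cong[of "indicator {..<a}" "\<lambda>_. 0" w] by simp

lemma prim_b: "prim w b = (LINT x|M. w x)"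
  unfolding prim_def using ip_cong[of "indicator {..<b}" "\<lambda>_. 1" w] by simp

lemma prim_bound:
  assumes w: "w \<in> L2 a b" and x: "x \<in> {a..b}"
  shows "\<bar>prim w x\<bar> \<le> sqrt (b - a) * L2_norm a b w"
proof -
  have "\<bar>prim w x\<bar> \<le> sqrt (x - a) * L2_norm a b w"
    using prim_lipschitz[OF w, of a x] w x by simp
  also have "\<dots> \<le> sqrt (b - a) * L2_norm a b w"
    using w x by (intro mult_right_mono) auto
  finally show ?thesis .
qed

lemma prim_continuous:
  assumes w: "w \<in> L2 a b"
  shows "continuous_on {a..b} (prim w)"
proof (unfold continuous_on_def, intro ballI)
  fix x
  assume x: "x \<in> {a..b}"
  have "((\<lambda>y. sqrt \<bar>y - x\<bar> * L2_norm a b w) \<longlongrightarrow> sqrt \<bar>x - x\<bar> * L2_norm a b w) (at x within {a..b})"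
    by (intro tendsto_intros)
  then have lim: "((\<lambda>y. sqrt \<bar>y - x\<bar> * L2_norm a b w) \<longlongrightarrow> 0) (at x within {a..b})"
    by simp
  have "((\<lambda>y. prim w y - prim w x) \<longlongrightarrow> 0) (at x within {a..b})"
  proof (rule Lim_null_comparison[OF _ lim])
    have "norm (prim w y - prim w x) \<le> sqrt \<bar>y - x\<bar> * L2_norm a b w" if "y \<in> {a..b}" for y
      using prim_lipschitz[OF w, of x y] prim_lipschitz[OF w, of y x] x that
      by (cases "x \<le> y") (auto simp: abs_minus_commute)
    then show "\<forall>\<^sub>F y in at x within {a..b}. norm (prim w y - prim w x) \<le> sqrt \<bar>y - x\<bar> * L2_norm a b w"
      by (auto simp: eventually_at intro: exI[of _ 1])
  qed
  then show "(prim w \<longlongrightarrow> prim w x) (at x within {a..b})"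
    by (simp add: LIM_zero_iff)
qed

lemma prim_L2 [simp, intro]: "w \<in> L2 a b \<Longrightarrow> prim w \<in> L2 a b"
  by (rule continuous_L2[OF prim_continuous])

lemma prim_norm:
  assumes "w \<in> L2 a b"
  shows "L2_norm a b (prim w) \<le> (b - a) * L2_norm a b w"
proof -
  have "L2_norm a b (prim w) \<le> sqrt (b - a) * (sqrt (b - a) * L2_norm a b w)"
    by (rule L2_norm_bounded) (use assms prim_bound[OF assms] ab in \<open>auto intro!: AE_I2 L2_measurable\<close>)
  also have "\<dots> = (b - a) * L2_norm a b w"
    using ab by (simp flip: mult.assoc)
  finally show ?thesis .
qed

lemma C1_weak_deriv:
  assumes der: "\<And>x. (\<Phi> has_real_derivative \<phi> x) (at x)" and cont: "continuous_on UNIV \<phi>"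
  shows "\<Phi> \<in> L2 a b" "\<phi> \<in> L2 a b" "has_weak_deriv a b \<Phi> \<phi>"
proof -
  have c: "continuous_on UNIV \<Phi>"
    using der by (intro continuous_at_imp_continuous_on) (auto intro: DERIV_isCont)
  show \<Phi>: "\<Phi> \<in> L2 a b" and \<phi>: "\<phi> \<in> L2 a b"
    using c cont by (auto intro!: continuous_L2 intro: continuous_on_subset)
  show "has_weak_deriv a b \<Phi> \<phi>"
    unfolding has_weak_deriv_def
  proof
    fix \<zeta>
    assume \<zeta>: "\<zeta> \<in> test_functions a b"
    then obtain \<eta> where \<eta>: "\<eta> > 0" "\<And>x. x \<notin> {a + \<eta>..b - \<eta>} \<Longrightarrow> \<zeta> x = 0"
      "\<And>x. (\<zeta> has_real_derivative deriv \<zeta> x) (at x)" "continuous_on UNIV (deriv \<zeta>)" "continuous_on UNIV \<zeta>"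
      by (rule test_functionsE) blast
    have "(LINT x|M. \<phi> x * \<zeta> x + deriv \<zeta> x * \<Phi> x) = \<Phi> b * \<zeta> b - \<Phi> a * \<zeta> a"
      by (rule integral_FTC_full) (use der cont c \<eta> in \<open>auto intro!: DERIV_mult continuous_intros\<close>)
    moreover have "\<zeta> a = 0" "\<zeta> b = 0" using \<eta>(1,2) by auto
    moreover have "(LINT x|M. \<phi> x * \<zeta> x + deriv \<zeta> x * \<Phi> x) = ip \<phi> \<zeta> + ip (deriv \<zeta>) \<Phi>"
      using \<Phi> \<phi> test_functions_L2[OF \<zeta>] test_functions_deriv_L2[OF \<zeta>]
      by (intro Bochner_Integration.integral_add L2_mult_integrable)
    ultimately show "ip \<Phi> (deriv \<zeta>) = - ip \<phi> \<zeta>"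
      by (simp add: mult.commute)
  qed
qed

text \<open>The primitive is an integral from \<open>a\<close>, defined on the whole line. It
  vanishes to the left of the support of \<open>\<psi>\<close> and is constant to the right of it,
  with value \<open>prim \<psi> b\<close>; a vanishing total integral is thus what makes it a test
  function.\<close>

lemma test_function_primitive:
  assumes \<psi>: "\<psi> \<in> test_functions a b"
  obtains \<Psi> where "\<And>x. (\<Psi> has_real_derivative \<psi> x) (at x)" "\<And>x. x \<in> {a..b} \<Longrightarrow> \<Psi> x = prim \<psi> x"
    "prim \<psi> b = 0 \<Longrightarrow> \<Psi> \<in> test_functions a b"
proof -
  from \<psi> obtain \<eta> where \<eta>: "\<eta> > 0" "\<And>x. x \<notin> {a + \<eta>..b - \<eta>} \<Longrightarrow> \<psi> x = 0"
    and c: "continuous_on UNIV \<psi>"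
    by (rule test_functionsE) blast
  define \<Psi> where "\<Psi> x = integral {a..x} \<psi>" for x
  have left: "\<Psi> x = 0" if "x < a + \<eta>" for x
  proof -
    have "\<Psi> x = integral {a..x} (\<lambda>_. 0)"
      unfolding \<Psi>_def by (rule Henstock_Kurzweil_Integration.integral_cong) (use \<eta> that in auto)
    then show ?thesis by simp
  qed
  have der: "(\<Psi> has_real_derivative \<psi> x) (at x)" for x
  proof (cases "x < a + \<eta>")
    case True
    then have "\<psi> x = 0" using \<eta>(2)[of x] by auto
    have "((\<lambda>_. 0) has_real_derivative \<psi> x) (at x)"
      using \<open>\<psi> x = 0\<close> by simp
    then show ?thesis
      by (rule has_field_derivative_transform_within_open[of _ _ _ "{..<a + \<eta>}"]) (use True left in auto)
  next
    case False
    have "((\<lambda>u. integral {a..u} \<psi>) has_vector_derivative \<psi> x) (at x within {a..x + 1})"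
      by (rule integral_has_vector_derivative) (use c False \<eta>(1) in \<open>auto intro: continuous_on_subset\<close>)
    moreover have "at x within {a..x + 1} = at x"
      by (rule at_within_interior) (use False \<eta>(1) in \<open>auto simp: interior_atLeastAtMost_real\<close>)
    ultimately show ?thesis
      by (simp add: \<Psi>_def[abs_def] has_real_derivative_iff_has_vector_derivative)
  qed
  have a: "\<Psi> a = 0" using left \<eta>(1) by simp
  have prim: "\<Psi> x = prim \<psi> x" if "x \<in> {a..b}" for x
    using that prim_increment[OF test_functions_L2[OF \<psi>], of a x] integral_FTC[OF der c, of a x] a
    by (simp add: test_functions_L2[OF \<psi>])
  have test: "\<Psi> \<in> test_functions a b" if mean: "prim \<psi> b = 0"
  proof (rule test_functionsI(1)[OF der c])
    show "compact {a + \<eta>..b - \<eta>}" "{a + \<eta>..b - \<eta>} \<subseteq> {a<..<b}"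
      using \<eta>(1) by auto
    fix x
    assume "x \<notin> {a + \<eta>..b - \<eta>}"
    then consider "x < a + \<eta>" | "x > b - \<eta>" by force
    then show "\<Psi> x = 0"
    proof cases
      case 2
      have "\<Psi> x = \<Psi> b"
      proof (rule DERIV_isconst3[where a = "b - \<eta>" and b = "max x b + 1" and f = \<Psi>])
        show "\<And>y. y \<in> {b - \<eta><..<max x b + 1} \<Longrightarrow> (\<Psi> has_real_derivative 0) (at y)"
        proof -
          fix y
          assume "y \<in> {b - \<eta><..<max x b + 1}"
          then show "(\<Psi> has_real_derivative 0) (at y)"
            using der[of y] \<eta>(2)[of y] by simp
        qed
      qed (use 2 \<eta>(1) in auto)
      then show ?thesis using prim[of b] mean ab by simp
    qed (rule left)
  qed
  show thesis
    using that[OF der prim test] .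
qed

text \<open>For a test function in place of \<open>w\<close> this is classical integration by parts.
  Both sides depend continuously on \<open>w\<close> in L2, since \<open>prim\<close> is a bounded
  operator there.\<close>

lemma prim_weak_deriv:
  assumes w: "w \<in> L2 a b"
  shows "has_weak_deriv a b (prim w) w"
  unfolding has_weak_deriv_def
proof
  fix \<zeta>
  assume "\<zeta> \<in> test_functions a b"
  note \<zeta> = this test_functions_L2[OF this] test_functions_deriv_L2[OF this]
  define K where "K = (b - a) * L2_norm a b (deriv \<zeta>) + L2_norm a b \<zeta>"
  have "ip (prim w) (deriv \<zeta>) + ip w \<zeta> = 0"
  proof (rule eq_0_if_abs_le_mult)
    show "K \<ge> 0" using ab \<zeta> by (auto simp: K_def intro!: add_nonneg_nonneg mult_nonneg_nonneg)
    fix e :: real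
    assume "e > 0"
    obtain \<psi> where \<psi>: "\<psi> \<in> test_functions a b" "L2_norm a b (\<psi> - w) < e"
      using test_functions_dense[OF w \<open>e > 0\<close>] by blast
    note \<psi>L2 = test_functions_L2[OF \<psi>(1)]
    from \<psi>(1) obtain \<Psi> where \<Psi>: "\<And>x. (\<Psi> has_real_derivative \<psi> x) (at x)" "\<And>x. x \<in> {a..b} \<Longrightarrow> \<Psi> x = prim \<psi> x"
      by (rule test_function_primitive) blast
    have "continuous_on UNIV \<psi>"
      using \<psi>(1) by (rule test_functionsE)
    from C1_weak_deriv(3)[OF \<Psi>(1) this] \<zeta>(1) have "ip \<Psi> (deriv \<zeta>) = - ip \<psi> \<zeta>"
      by (simp add: has_weak_deriv_def)
    moreover have "ip \<Psi> (deriv \<zeta>) = ip (prim \<psi>) (deriv \<zeta>)"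
      by (rule ip_cong) (use \<Psi>(2) in auto)
    ultimately have 0: "ip (prim \<psi>) (deriv \<zeta>) + ip \<psi> \<zeta> = 0" by simp
    have "prim (w - \<psi>) = prim w - prim \<psi>"
      using w \<psi>L2 by (auto simp: prim_diff)
    then have 1: "ip (prim (w - \<psi>)) (deriv \<zeta>) = ip (prim w) (deriv \<zeta>) - ip (prim \<psi>) (deriv \<zeta>)"
      using L2.diff_left[OF prim_L2[OF w] prim_L2[OF \<psi>L2] \<zeta>(3)] by simp
    have 2: "ip (w - \<psi>) \<zeta> = ip w \<zeta> - ip \<psi> \<zeta>"
      by (rule L2.diff_left[OF w \<psi>L2 \<zeta>(2)])
    have r: "w - \<psi> \<in> L2 a b" using w \<psi>L2 by auto
    have "\<bar>ip (prim w) (deriv \<zeta>) + ip w \<zeta>\<bar>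
        \<le> L2_norm a b (prim (w - \<psi>)) * L2_norm a b (deriv \<zeta>) + L2_norm a b (w - \<psi>) * L2_norm a b \<zeta>"
      using L2.cauchy_schwarz[OF prim_L2[OF r] \<zeta>(3)] L2.cauchy_schwarz[OF r \<zeta>(2)] 0 1 2 by linarith
    also have "\<dots> \<le> ((b - a) * L2_norm a b (w - \<psi>)) * L2_norm a b (deriv \<zeta>) + L2_norm a b (w - \<psi>) * L2_norm a b \<zeta>"
      using prim_norm[of "w - \<psi>"] w \<psi>L2 \<zeta> by (intro add_mono mult_right_mono) auto
    also have "\<dots> = K * L2_norm a b (w - \<psi>)"
      by (simp add: K_def algebra_simps)
    also have "\<dots> \<le> K * e"
      using \<psi>(2) L2.nrm_minus[OF w \<psi>L2] \<open>K \<ge> 0\<close> by (intro mult_left_mono) auto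
    finally show "\<bar>ip (prim w) (deriv \<zeta>) + ip w \<zeta>\<bar> \<le> K * e" .
  qed
  then show "ip (prim w) (deriv \<zeta>) = - ip w \<zeta>" by simp
qed

section \<open>Linearity of the weak derivative and the space H1\<close>

lemma has_weak_deriv_add:
  assumes "u \<in> L2 a b" "u' \<in> L2 a b" "w \<in> L2 a b" "w' \<in> L2 a b"
    and "has_weak_deriv a b u u'" "has_weak_deriv a b w w'"
  shows "has_weak_deriv a b (u + w) (u' + w')"
  unfolding has_weak_deriv_def
proof
  fix \<phi>
  assume "\<phi> \<in> test_functions a b"
  note \<phi> = this test_functions_L2[OF this] test_functions_deriv_L2[OF this]
  show "ip (u + w) (deriv \<phi>) = - ip (u' + w') \<phi>"
    unfolding L2.add_left[OF assms(1,3) \<phi>(3)] L2.add_left[OF assms(2,4) \<phi>(2)]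
    using assms(5,6) \<phi>(1) by (simp add: has_weak_deriv_def)
qed

lemma has_weak_deriv_scale:
  assumes "u \<in> L2 a b" "u' \<in> L2 a b" "has_weak_deriv a b u u'"
  shows "has_weak_deriv a b (c *\<^sub>R u) (c *\<^sub>R u')"
  unfolding has_weak_deriv_def
proof
  fix \<phi>
  assume "\<phi> \<in> test_functions a b"
  note \<phi> = this test_functions_L2[OF this] test_functions_deriv_L2[OF this]
  show "ip (c *\<^sub>R u) (deriv \<phi>) = - ip (c *\<^sub>R u') \<phi>"
    unfolding L2.scale_left[OF assms(1) \<phi>(3)] L2.scale_left[OF assms(2) \<phi>(2)]
    using assms(3) \<phi>(1) by (simp add: has_weak_deriv_def)
qed

lemma has_weak_deriv_unique:
  assumes "u' \<in> L2 a b" "u'' \<in> L2 a b" "has_weak_deriv a b u u'" "has_weak_deriv a b u u''"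
  shows "AE x in M. u' x = u'' x"
proof -
  have "AE x in M. (u' - u'') x = 0"
  proof (rule orthogonal_to_test_functions(2))
    fix \<phi>
    assume \<phi>: "\<phi> \<in> test_functions a b"
    show "ip (u' - u'') \<phi> = 0"
      unfolding L2.diff_left[OF assms(1,2) test_functions_L2[OF \<phi>]]
      using assms(3,4) \<phi> by (simp add: has_weak_deriv_def)
  qed (use assms in auto)
  then show ?thesis by eventually_elim simp
qed

lemma H1D:
  assumes "u \<in> H1 a b"
  shows "u \<in> L2 a b" "wderiv a b u \<in> L2 a b" "has_weak_deriv a b u (wderiv a b u)"
proof -
  from assms have ex: "\<exists>u'. u' \<in> L2 a b \<and> has_weak_deriv a b u u'"
    by (auto simp: H1_def)
  from someI_ex[OF ex] show "wderiv a b u \<in> L2 a b" "has_weak_deriv a b u (wderiv a b u)"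
    by (simp_all add: wderiv_def)
qed (use assms in \<open>auto simp: H1_def\<close>)

lemma H1I:
  assumes "u \<in> L2 a b" "u' \<in> L2 a b" "has_weak_deriv a b u u'"
  shows "u \<in> H1 a b" "AE x in M. wderiv a b u x = u' x"
proof -
  show "u \<in> H1 a b" using assms by (auto simp: H1_def)
  from H1D[OF this] assms show "AE x in M. wderiv a b u x = u' x"
    by (intro has_weak_deriv_unique)
qed

lemma has_weak_deriv_cong_AE:
  assumes "has_weak_deriv a b u u'" "u \<in> L2 a b" "w \<in> L2 a b" "AE x in M. w x = u x"
  shows "has_weak_deriv a b w u'"
  unfolding has_weak_deriv_def
proof
  fix \<phi>
  assume \<phi>: "\<phi> \<in> test_functions a b"
  have "ip w (deriv \<phi>) = ip u (deriv \<phi>)"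
    using assms test_functions_deriv_L2[OF \<phi>] by (intro ip_cong_AE) auto
  with assms(1) \<phi> show "ip w (deriv \<phi>) = - ip u' \<phi>"
    by (simp add: has_weak_deriv_def)
qed

lemma H1_add:
  assumes "u \<in> H1 a b" "w \<in> H1 a b"
  shows "u + w \<in> H1 a b" "AE x in M. wderiv a b (u + w) x = wderiv a b u x + wderiv a b w x"
proof -
  note u = H1D[OF assms(1)] and w = H1D[OF assms(2)]
  note wd = has_weak_deriv_add[OF u(1,2) w(1,2) u(3) w(3)]
  show "u + w \<in> H1 a b"
    by (rule H1I(1)[OF _ _ wd]) (use u w in auto)
  have "AE x in M. wderiv a b (u + w) x = (wderiv a b u + wderiv a b w) x"
    by (rule H1I(2)[OF _ _ wd]) (use u w in auto)
  then show "AE x in M. wderiv a b (u + w) x = wderiv a b u x + wderiv a b w x"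
    by simp
qed

lemma H1_scale:
  assumes "u \<in> H1 a b"
  shows "c *\<^sub>R u \<in> H1 a b" "AE x in M. wderiv a b (c *\<^sub>R u) x = c * wderiv a b u x"
proof -
  note u = H1D[OF assms]
  note wd = has_weak_deriv_scale[OF u]
  show "c *\<^sub>R u \<in> H1 a b"
    by (rule H1I(1)[OF _ _ wd]) (use u in auto)
  have "AE x in M. wderiv a b (c *\<^sub>R u) x = (c *\<^sub>R wderiv a b u) x"
    by (rule H1I(2)[OF _ _ wd]) (use u in auto)
  then show "AE x in M. wderiv a b (c *\<^sub>R u) x = c * wderiv a b u x"
    by (simp add: scaleR_fun_def)
qed

lemma H1_subspace: "subspace (H1 a b)"
proof -
  have "has_weak_deriv a b 0 0"
    by (simp add: has_weak_deriv_def)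
  then have "0 \<in> H1 a b"
    by (auto simp: H1_def zero_fun_def intro: bexI[of _ "\<lambda>_. 0"])
  then show ?thesis
    using H1_add(1) H1_scale(1) by (auto simp: subspace_def)
qed

lemma H1_diff:
  assumes "u \<in> H1 a b" "w \<in> H1 a b"
  shows "u - w \<in> H1 a b" "AE x in M. wderiv a b (u - w) x = wderiv a b u x - wderiv a b w x"
proof -
  have eq: "u - w = u + (-1) *\<^sub>R w" by (simp add: fun_eq_iff scaleR_fun_def)
  show "u - w \<in> H1 a b"
    unfolding eq by (intro H1_add(1) H1_scale(1) assms)
  show "AE x in M. wderiv a b (u - w) x = wderiv a b u x - wderiv a b w x"
    unfolding eq using H1_add(2)[OF assms(1) H1_scale(1)[OF assms(2), of "-1"]] H1_scale(2)[OF assms(2), of "-1"]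
    by eventually_elim simp
qed

section \<open>Continuous representatives and integration by parts in H1\<close>

lemma test_functions_diff_scale:
  assumes "\<phi> \<in> test_functions a b" "\<zeta> \<in> test_functions a b"
  shows "\<phi> - c *\<^sub>R \<zeta> \<in> test_functions a b"
proof -
  from assms(1) obtain \<eta>1 where \<eta>1: "\<eta>1 > 0" "\<And>x. x \<notin> {a + \<eta>1..b - \<eta>1} \<Longrightarrow> \<phi> x = 0"
      "\<And>x. (\<phi> has_real_derivative deriv \<phi> x) (at x)" "continuous_on UNIV (deriv \<phi>)"
    by (rule test_functionsE) blast
  from assms(2) obtain \<eta>2 where \<eta>2: "\<eta>2 > 0" "\<And>x. x \<notin> {a + \<eta>2..b - \<eta>2} \<Longrightarrow> \<zeta> x = 0"
      "\<And>x. (\<zeta> has_real_derivative deriv \<zeta> x) (at x)" "continuous_on UNIV (deriv \<zeta>)"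
    by (rule test_functionsE) blast
  show ?thesis
  proof (rule test_functionsI(1))
    show "(\<phi> - c *\<^sub>R \<zeta> has_real_derivative deriv \<phi> x - c * deriv \<zeta> x) (at x)" for x
      unfolding fun_diff_def scaleR_fun_def real_scaleR_def
      by (intro DERIV_diff DERIV_cmult \<eta>1 \<eta>2)
    show "continuous_on UNIV (\<lambda>x. deriv \<phi> x - c * deriv \<zeta> x)"
      by (intro continuous_intros \<eta>1 \<eta>2)
    show "compact {a + min \<eta>1 \<eta>2..b - min \<eta>1 \<eta>2}" "{a + min \<eta>1 \<eta>2..b - min \<eta>1 \<eta>2} \<subseteq> {a<..<b}"
      using \<eta>1(1) \<eta>2(1) by auto
    show "(\<phi> - c *\<^sub>R \<zeta>) x = 0" if "x \<notin> {a + min \<eta>1 \<eta>2..b - min \<eta>1 \<eta>2}" for x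
      using that \<eta>1(2)[of x] \<eta>2(2)[of x] by (auto simp: scaleR_fun_def min_def split: if_splits)
  qed
qed

lemma unit_mean_test_function:
  obtains \<omega> where "\<omega> \<in> test_functions a b" "prim \<omega> b = 1"
proof -
  \<comment> \<open>A function within L2 distance \<open>sqrt (b - a)\<close> of the constant 1 has
    an integral that differs from \<open>b - a\<close> by less than \<open>b - a\<close>. So the
    integral is not zero and can be normalised.\<close>
  have pos: "sqrt (b - a) > 0" using ab by simp
  obtain \<phi> where \<phi>: "\<phi> \<in> test_functions a b" "L2_norm a b (\<phi> - (\<lambda>_. 1)) < sqrt (b - a)"
    using test_functions_dense[OF L2_const pos] by blast
  note \<phi>L2 = test_functions_L2[OF \<phi>(1)]
  have "\<bar>prim \<phi> b - prim (\<lambda>_. 1) b\<bar> \<le> sqrt (b - a) * L2_norm a b (\<phi> - (\<lambda>_. 1))"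
    using prim_bound[of "\<phi> - (\<lambda>_. 1)" b] \<phi>L2 ab by (simp add: prim_diff)
  also have "\<dots> < sqrt (b - a) * sqrt (b - a)"
    using \<phi>(2) pos by (intro mult_strict_left_mono) auto
  also have "\<dots> = b - a" using ab by simp
  finally have nz: "prim \<phi> b \<noteq> 0" by (auto simp: prim_b)
  show thesis
  proof (rule that)
    have "\<phi> - (1 - 1 / prim \<phi> b) *\<^sub>R \<phi> \<in> test_functions a b"
      by (intro test_functions_diff_scale \<phi>)
    then show "(1 / prim \<phi> b) *\<^sub>R \<phi> \<in> test_functions a b"
      by (simp add: algebra_simps)
    show "prim ((1 / prim \<phi> b) *\<^sub>R \<phi>) b = 1"
      using nz \<phi>L2 by (simp add: prim_scale)
  qed
qed

text \<open>Subtracting a multiple of \<open>\<omega>\<close> from \<open>\<psi>\<close> gives a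
  test function of integral zero, which is the derivative of a test function. Hence the product of
  \<open>d\<close> with \<open>\<psi>\<close> depends only on the integral of \<open>\<psi>\<close>,
  as it does for the constant \<open>c\<close>.\<close>

lemma du_bois_reymond:
  assumes d: "d \<in> L2 a b" and ortho: "\<And>\<phi>. \<phi> \<in> test_functions a b \<Longrightarrow> ip d (deriv \<phi>) = 0"
  obtains c where "AE x in M. d x = c"
proof -
  obtain \<omega> where \<omega>: "\<omega> \<in> test_functions a b" "prim \<omega> b = 1"
    by (rule unit_mean_test_function)
  note \<omega>L2 = test_functions_L2[OF \<omega>(1)]
  define c where "c = ip d \<omega>"
  have "AE x in M. (d - (\<lambda>_. c)) x = 0"
  proof (rule orthogonal_to_test_functions(2))
    fix \<psi>
    assume \<psi>: "\<psi> \<in> test_functions a b"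
    note \<psi>L2 = test_functions_L2[OF \<psi>]
    define \<psi>0 where "\<psi>0 = \<psi> - prim \<psi> b *\<^sub>R \<omega>"
    have \<psi>0: "\<psi>0 \<in> test_functions a b" "prim \<psi>0 b = 0"
      using \<psi> \<omega> \<psi>L2 \<omega>L2 by (auto simp: \<psi>0_def test_functions_diff_scale prim_diff prim_scale)
    from \<psi>0(1) obtain \<Psi> where \<Psi>: "\<And>x. (\<Psi> has_real_derivative \<psi>0 x) (at x)" "\<Psi> \<in> test_functions a b"
      by (rule test_function_primitive) (use \<psi>0(2) in blast)
    have "deriv \<Psi> = \<psi>0"
      using \<Psi>(1) by (auto intro: DERIV_imp_deriv)
    with ortho[OF \<Psi>(2)] have "ip d \<psi>0 = 0" by simp
    then have 1: "ip d \<psi> - prim \<psi> b * c = 0"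
      unfolding \<psi>0_def c_def L2.diff_right[OF \<psi>L2 L2.mem(4)[OF \<omega>L2] d] L2.scale_right[OF \<omega>L2 d] .
    have "ip (\<lambda>_. c) \<psi> = prim \<psi> b * c"
      by (simp add: prim_b)
    with 1 show "ip (d - (\<lambda>_. c)) \<psi> = 0"
      unfolding L2.diff_left[OF d L2_const \<psi>L2] by linarith
  qed (use d in auto)
  then have "AE x in M. d x = c"
    by eventually_elim simp
  then show thesis by (rule that)
qed

text \<open>\<open>u\<close> and the primitive of its weak derivative have the same weak derivative,
  so their difference is constant. The right-hand side is the continuous version of
  \<open>u\<close>, through which point values are expressed.\<close>

lemma H1_representative:
  assumes "u \<in> H1 a b"
  obtains c where "AE x in M. u x = c + prim (wderiv a b u) x"
proof -
  note u = H1D[OF assms]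
  obtain c where "AE x in M. (u - prim (wderiv a b u)) x = c"
  proof (rule du_bois_reymond)
    fix \<phi>
    assume \<phi>: "\<phi> \<in> test_functions a b"
    show "ip (u - prim (wderiv a b u)) (deriv \<phi>) = 0"
      unfolding L2.diff_left[OF u(1) prim_L2[OF u(2)] test_functions_deriv_L2[OF \<phi>]]
      using u(3) prim_weak_deriv[OF u(2)] \<phi> by (simp add: has_weak_deriv_def)
  qed (use u in auto)
  then have "AE x in M. u x = c + prim (wderiv a b u) x"
    by eventually_elim (simp add: algebra_simps)
  then show thesis by (rule that)
qed

text \<open>The constant in \<open>H1_representative\<close> is estimated through its L2 norm, which
  is the norm of \<open>u - prim w\<close>. One half of the coefficient 2 comes from this constant,
  the other from \<open>prim w\<close> itself.\<close>

lemma H1_sup_bound: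
  assumes "u \<in> H1 a b"
  shows "AE x in M. \<bar>u x\<bar> \<le> L2_norm a b u / sqrt (b - a) + 2 * sqrt (b - a) * L2_norm a b (wderiv a b u)"
proof -
  note u = H1D[OF assms]
  obtain c where c: "AE x in M. u x = c + prim (wderiv a b u) x"
    using assms by (rule H1_representative)
  define w where "w = wderiv a b u"
  have pos: "sqrt (b - a) > 0" using ab by simp
  have "sqrt (b - a) * \<bar>c\<bar> = L2_norm a b (\<lambda>_. c)"
    by (simp add: L2_norm_def real_sqrt_mult mult.commute)
  also have "\<dots> = L2_norm a b (u - prim w)"
    unfolding L2_norm_def
    by (intro arg_cong[where f = sqrt] integral_cong_AE)
       (use c u prim_L2[of w] L2_measurable in \<open>auto simp: w_def elim!: eventually_mono intro!: borel_measurable_power borel_measurable_diff\<close>)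
  also have "\<dots> \<le> L2_norm a b u + L2_norm a b (prim w)"
    using L2.nrm_diff_triangle[of u 0 "prim w"] L2.nrm_minus[of 0 "prim w"] u by (simp add: w_def)
  also have "\<dots> \<le> L2_norm a b u + (b - a) * L2_norm a b w"
    using prim_norm u by (simp add: w_def)
  also have "\<dots> = sqrt (b - a) * (L2_norm a b u / sqrt (b - a) + sqrt (b - a) * L2_norm a b w)"
    using ab by (simp add: distrib_left flip: mult.assoc)
  finally have "\<bar>c\<bar> \<le> L2_norm a b u / sqrt (b - a) + sqrt (b - a) * L2_norm a b w"
    using pos by simp
  note cb = this
  have "AE x in M. x \<in> {a..b}" by (rule AE_I2) auto
  with c show ?thesis
  proof eventually_elim
    case (elim x)
    then show ?case
      using cb prim_bound[OF u(2), of x] by (simp add: w_def)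
  qed
qed

text \<open>\<open>prim z'\<close> vanishes at both ends, so there is no boundary term. If
  \<open>z'\<close> is approximated by test functions whose integral is corrected to zero, their
  primitives are test functions, and for these the identity is the definition of the weak derivative
  of \<open>w\<close>.\<close>

lemma integration_by_parts_H1:
  assumes w: "w \<in> H1 a b" and z': "z' \<in> L2 a b" "prim z' b = 0"
  shows "ip w z' = - ip (wderiv a b w) (prim z')"
proof -
  note wL2 = H1D[OF w]
  obtain \<omega> where \<omega>: "\<omega> \<in> test_functions a b" "prim \<omega> b = 1"
    by (rule unit_mean_test_function)
  note \<omega>L2 = test_functions_L2[OF \<omega>(1)]
  \<comment> \<open>Accounts for the correction of the integral: an error \<open>e\<close> in
    approximating \<open>z'\<close> becomes at most \<open>K1 * e\<close>.\<close>
  define K1 where "K1 = 1 + sqrt (b - a) * L2_norm a b \<omega>"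
  define K where "K = (L2_norm a b w + L2_norm a b (wderiv a b w) * (b - a)) * K1"
  have K1: "K1 \<ge> 0" using ab \<omega>L2 by (auto simp: K1_def intro!: add_nonneg_nonneg)
  have "ip w z' + ip (wderiv a b w) (prim z') = 0"
  proof (rule eq_0_if_abs_le_mult)
    show "K \<ge> 0" using K1 ab wL2 by (auto simp: K_def intro!: add_nonneg_nonneg mult_nonneg_nonneg)
    fix e :: real
    assume "e > 0"
    obtain \<psi> where \<psi>: "\<psi> \<in> test_functions a b" "L2_norm a b (\<psi> - z') < e"
      using test_functions_dense[OF z'(1) \<open>e > 0\<close>] by blast
    note \<psi>L2 = test_functions_L2[OF \<psi>(1)]
    define \<psi>0 where "\<psi>0 = \<psi> - prim \<psi> b *\<^sub>R \<omega>"
    have \<psi>0: "\<psi>0 \<in> test_functions a b" "prim \<psi>0 b = 0"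
      using \<psi> \<omega> \<psi>L2 \<omega>L2 by (auto simp: \<psi>0_def test_functions_diff_scale prim_diff prim_scale)
    note \<psi>0L2 = test_functions_L2[OF \<psi>0(1)]
    from \<psi>0(1) obtain \<Psi> where \<Psi>: "\<And>x. (\<Psi> has_real_derivative \<psi>0 x) (at x)" "\<Psi> \<in> test_functions a b"
      "\<And>x. x \<in> {a..b} \<Longrightarrow> \<Psi> x = prim \<psi>0 x"
      by (rule test_function_primitive) (use \<psi>0(2) in blast)
    have d: "deriv \<Psi> = \<psi>0"
      using \<Psi>(1) by (auto intro: DERIV_imp_deriv)
    have "ip w \<psi>0 = - ip (wderiv a b w) \<Psi>"
      using wL2(3) \<Psi>(2) d by (auto simp: has_weak_deriv_def)
    also have "ip (wderiv a b w) \<Psi> = ip (wderiv a b w) (prim \<psi>0)"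
      by (rule Bochner_Integration.integral_cong) (use \<Psi>(3) in auto)
    finally have eq: "ip w \<psi>0 + ip (wderiv a b w) (prim \<psi>0) = 0" by simp
    have "\<bar>prim \<psi> b\<bar> = \<bar>prim (\<psi> - z') b\<bar>"
      using z' \<psi>L2 by (simp add: prim_diff)
    also have "\<dots> \<le> sqrt (b - a) * L2_norm a b (\<psi> - z')"
      by (rule prim_bound) (use \<psi>L2 z' ab in auto)
    also have "\<dots> \<le> sqrt (b - a) * e"
      using \<psi>(2) ab by (intro mult_left_mono) auto
    finally have mean: "\<bar>prim \<psi> b\<bar> \<le> sqrt (b - a) * e" .
    define r where "r = z' - \<psi>0"
    have r: "r \<in> L2 a b" using z' \<psi>0L2 by (auto simp: r_def)
    have "r = (z' - \<psi>) + prim \<psi> b *\<^sub>R \<omega>" by (simp add: r_def \<psi>0_def)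
    then have "L2_norm a b r \<le> L2_norm a b (z' - \<psi>) + L2_norm a b (prim \<psi> b *\<^sub>R \<omega>)"
      using L2.nrm_triangle[of "z' - \<psi>" "prim \<psi> b *\<^sub>R \<omega>"] z' \<psi>L2 \<omega>L2 by auto
    also have "\<dots> \<le> e + (sqrt (b - a) * e) * L2_norm a b \<omega>"
      unfolding L2.nrm_scale[OF \<omega>L2]
      using \<psi>(2) L2.nrm_minus[OF z'(1) \<psi>L2] mean \<omega>L2 by (intro add_mono mult_right_mono) auto
    also have "\<dots> = K1 * e" by (simp add: K1_def algebra_simps)
    finally have rn: "L2_norm a b r \<le> K1 * e" .
    have eq': "ip w z' + ip (wderiv a b w) (prim z') = ip w r + ip (wderiv a b w) (prim r)"
    proof -
      have "prim r = prim z' - prim \<psi>0"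
        using z' \<psi>0L2 by (auto simp: r_def prim_diff)
      then have "ip (wderiv a b w) (prim r) = ip (wderiv a b w) (prim z') - ip (wderiv a b w) (prim \<psi>0)"
        using L2.diff_right[OF prim_L2[OF z'(1)] prim_L2[OF \<psi>0L2] wL2(2)] by simp
      moreover have "ip w r = ip w z' - ip w \<psi>0"
        unfolding r_def by (rule L2.diff_right[OF z'(1) \<psi>0L2 wL2(1)])
      ultimately show ?thesis using eq by linarith
    qed
    have "\<bar>ip w z' + ip (wderiv a b w) (prim z')\<bar>
        \<le> L2_norm a b w * L2_norm a b r + L2_norm a b (wderiv a b w) * L2_norm a b (prim r)"
      unfolding eq' using L2.cauchy_schwarz[OF wL2(1) r] L2.cauchy_schwarz[OF wL2(2) prim_L2[OF r]] by linarith
    also have "\<dots> \<le> L2_norm a b w * L2_norm a b r + L2_norm a b (wderiv a b w) * ((b - a) * L2_norm a b r)"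
      using prim_norm[OF r] wL2 by (intro add_left_mono mult_left_mono) auto
    also have "\<dots> = (L2_norm a b w + L2_norm a b (wderiv a b w) * (b - a)) * L2_norm a b r"
      by (simp add: algebra_simps)
    also have "\<dots> \<le> (L2_norm a b w + L2_norm a b (wderiv a b w) * (b - a)) * (K1 * e)"
      using rn wL2 ab by (intro mult_left_mono) (auto intro!: add_nonneg_nonneg)
    finally show "\<bar>ip w z' + ip (wderiv a b w) (prim z')\<bar> \<le> K * e"
      by (simp add: K_def algebra_simps)
  qed
  then show ?thesis by simp
qed

text \<open>Agreement holds on a closed set whose complement in the open interval is open and null,
  hence empty. Closedness includes the end points, where boundary conditions are imposed.\<close>

lemma AE_eq_continuous:
  fixes p q :: "real \<Rightarrow> real"
  assumes "continuous_on {a..b} p" "continuous_on {a..b} q" "AE x in M. p x = q x" "x \<in> {a..b}"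
  shows "p x = q x"
proof -
  have "closed ({x \<in> {a..b}. p x \<le> q x} \<inter> {x \<in> {a..b}. q x \<le> p x})"
    using assms(1,2) by (intro closed_Int continuous_on_closed_Collect_le) auto
  also have "{x \<in> {a..b}. p x \<le> q x} \<inter> {x \<in> {a..b}. q x \<le> p x} = {x \<in> {a..b}. p x = q x}"
    by auto
  finally have cl: "closed {x \<in> {a..b}. p x = q x}" .
  have op: "open ({a<..<b} - {x \<in> {a..b}. p x = q x})" (is "open ?U")
    using cl by (intro open_Diff) auto
  have "AE x in lebesgue. x \<in> {a<..<b} \<longrightarrow> p x = q x"
    using assms(3) by (simp add: AE_restrict_space_iff)
  then have "AE x in lebesgue. x \<notin> ?U"
    by eventually_elim auto
  then have "?U \<in> null_sets lebesgue"
    using op by (intro AE_iff_null_sets[THEN iffD2]) auto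
  then have "negligible ?U" by (simp add: negligible_iff_null_sets)
  with op have "?U = {}" using open_not_negligible by blast
  then have "{a<..<b} \<subseteq> {x \<in> {a..b}. p x = q x}" by auto
  then have "closure {a<..<b} \<subseteq> {x \<in> {a..b}. p x = q x}"
    using cl by (rule closure_minimal)
  with ab assms(4) show ?thesis by auto
qed

end

subsection \<open>The energy space\<close>

locale energy_space = interval +
  fixes \<tau> \<epsilon> :: real
  assumes \<tau>: "\<tau> > 0" and \<epsilon>: "\<epsilon> > 0"
begin

text \<open>The scalar product of \<open>X\<close> without \<open>\<tau> * u * u\<close>. Dropping
  this term makes the pairing of \<open>y\<close> with \<open>A y\<close> exactly
  \<open>- Q y y\<close>, and half of \<open>Q\<close> is the quadratic part of the energy.\<close>

definition Q :: "state \<Rightarrow> state \<Rightarrow> real"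
  where "Q y z = \<epsilon>\<^sup>2 * ip (wderiv a b (fst y)) (wderiv a b (fst z)) + \<tau> * ip (snd y) (snd z)"

lemma X_spaceD:
  assumes "y \<in> X_space a b"
  shows "fst y \<in> H1 a b" "fst y \<in> L2 a b" "wderiv a b (fst y) \<in> L2 a b" "snd y \<in> L2 a b"
  using assms H1D by (auto simp: X_space_def)

lemma X_inner_eq:
  assumes "y \<in> X_space a b" "z \<in> X_space a b"
  shows "X_inner a b \<tau> \<epsilon> y z = Q y z + \<tau> * ip (fst y) (fst z)"
proof -
  note y = X_spaceD[OF assms(1)] and z = X_spaceD[OF assms(2)]
  have "X_inner a b \<tau> \<epsilon> y z = (LINT x|M. (\<epsilon>\<^sup>2 * (wderiv a b (fst y) x * wderiv a b (fst z) x)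
      + \<tau> * (fst y x * fst z x)) + \<tau> * (snd y x * snd z x))"
    unfolding X_inner_def by (cases y; cases z) (simp add: mult.assoc)
  also have "\<dots> = (\<epsilon>\<^sup>2 * ip (wderiv a b (fst y)) (wderiv a b (fst z)) + \<tau> * ip (fst y) (fst z)) + \<tau> * ip (snd y) (snd z)"
    using y z by (subst Bochner_Integration.integral_add Bochner_Integration.integral_mult_right_zero;
        (intro Bochner_Integration.integrable_add integrable_mult_right L2_mult_integrable)?; simp)+
  finally show ?thesis by (simp add: Q_def)
qed

lemma X_subspace: "subspace (X_space a b)"
  using H1_subspace L2_subspace
  by (auto simp: subspace_def X_space_def plus_prod_def zero_prod_def)

lemma Q_semi_inner: "semi_inner (X_space a b) Q"
proof
  fix y z w :: state and c :: real
  assume X: "y \<in> X_space a b" "z \<in> X_space a b"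
  note y = X_spaceD[OF X(1)] and z = X_spaceD[OF X(2)]
  show "Q y z = Q z y" by (simp add: Q_def mult.commute)
  have "ip (wderiv a b (c *\<^sub>R fst y)) (wderiv a b (fst z)) = ip (c *\<^sub>R wderiv a b (fst y)) (wderiv a b (fst z))"
    by (rule ip_cong_AE) (use y z H1_scale[OF y(1), of c] H1D in \<open>auto simp: scaleR_fun_def\<close>)
  also have "\<dots> = c * ip (wderiv a b (fst y)) (wderiv a b (fst z))"
    using y z by (intro L2.scale_left) auto
  finally show "Q (c *\<^sub>R y) z = c * Q y z"
    using L2.scale_left[OF y(4) z(4), of c] by (simp add: Q_def distrib_left mult.left_commute)
  assume W: "w \<in> X_space a b"
  note w = X_spaceD[OF W]
  have "ip (wderiv a b (fst y + fst z)) (wderiv a b (fst w)) = ip (wderiv a b (fst y) + wderiv a b (fst z)) (wderiv a b (fst w))"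
    by (rule ip_cong_AE) (use y z w H1_add[OF y(1) z(1)] H1D in auto)
  also have "\<dots> = ip (wderiv a b (fst y)) (wderiv a b (fst w)) + ip (wderiv a b (fst z)) (wderiv a b (fst w))"
    using y z w by (intro L2.add_left) auto
  finally show "Q (y + z) w = Q y w + Q z w"
    using L2.add_left[OF y(4) z(4) w(4)] by (simp add: Q_def distrib_left)
next
  fix y :: state
  assume "y \<in> X_space a b"
  then show "0 \<le> Q y y"
    using L2.nonneg X_spaceD \<tau> by (auto simp: Q_def intro!: add_nonneg_nonneg mult_nonneg_nonneg)
qed (rule X_subspace)

sublocale X: dominated_form "X_space a b" "X_inner a b \<tau> \<epsilon>" Q
  rewrites "semi_inner.nrm (X_inner a b \<tau> \<epsilon>) = X_norm a b \<tau> \<epsilon>"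
proof -
  interpret Q: semi_inner "X_space a b" Q by (rule Q_semi_inner)
  have nn: "0 \<le> \<tau> * ip (fst y) (fst y)" if "y \<in> X_space a b" for y
    using L2.nonneg X_spaceD[OF that] \<tau> by auto
  show "dominated_form (X_space a b) (X_inner a b \<tau> \<epsilon>) Q"
  proof
    fix y z w :: state and c :: real
    assume X: "y \<in> X_space a b" "z \<in> X_space a b"
    note y = X_spaceD[OF X(1)] and z = X_spaceD[OF X(2)]
    show "X_inner a b \<tau> \<epsilon> y z = X_inner a b \<tau> \<epsilon> z y"
      using X Q.sym by (simp add: X_inner_eq mult.commute)
    have "c *\<^sub>R y \<in> X_space a b" using X by auto
    then show "X_inner a b \<tau> \<epsilon> (c *\<^sub>R y) z = c * X_inner a b \<tau> \<epsilon> y z"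
      using X Q.scale_left[OF X, of c] L2.scale_left[OF y(2) z(2), of c]
      by (simp add: X_inner_eq distrib_left mult.left_commute)
    assume W: "w \<in> X_space a b"
    note w = X_spaceD[OF W]
    have "y + z \<in> X_space a b" using X by auto
    then show "X_inner a b \<tau> \<epsilon> (y + z) w = X_inner a b \<tau> \<epsilon> y w + X_inner a b \<tau> \<epsilon> z w"
      using X W Q.add_left[OF X W] L2.add_left[OF y(2) z(2) w(2)]
      by (simp add: X_inner_eq distrib_left)
  next
    fix y :: state
    assume "y \<in> X_space a b"
    then show "0 \<le> X_inner a b \<tau> \<epsilon> y y" "Q y y \<le> X_inner a b \<tau> \<epsilon> y y"
      using nn[of y] Q.nonneg[of y] by (auto simp: X_inner_eq)
  qed (rule X_subspace)
  then interpret dominated_form "X_space a b" "X_inner a b \<tau> \<epsilon>" Q .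
  show "semi_inner.nrm (X_inner a b \<tau> \<epsilon>) = X_norm a b \<tau> \<epsilon>"
    by (simp add: nrm_def[abs_def] X_norm_def[abs_def] fun_eq_iff)
qed

lemma X_norm_sq:
  assumes "y \<in> X_space a b"
  shows "(X_norm a b \<tau> \<epsilon> y)\<^sup>2 = \<epsilon>\<^sup>2 * (L2_norm a b (wderiv a b (fst y)))\<^sup>2
    + \<tau> * (L2_norm a b (fst y))\<^sup>2 + \<tau> * (L2_norm a b (snd y))\<^sup>2"
  using X_spaceD[OF assms] by (simp add: X.nrm_sq assms X_inner_eq L2.nrm_sq Q_def)

lemma X_norm_components:
  assumes "y \<in> X_space a b"
  shows "\<epsilon> * L2_norm a b (wderiv a b (fst y)) \<le> X_norm a b \<tau> \<epsilon> y"
    "sqrt \<tau> * L2_norm a b (fst y) \<le> X_norm a b \<tau> \<epsilon> y"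
    "sqrt \<tau> * L2_norm a b (snd y) \<le> X_norm a b \<tau> \<epsilon> y"
proof -
  have "0 \<le> \<epsilon>\<^sup>2 * (L2_norm a b (wderiv a b (fst y)))\<^sup>2" "0 \<le> \<tau> * (L2_norm a b (fst y))\<^sup>2"
    "0 \<le> \<tau> * (L2_norm a b (snd y))\<^sup>2"
    using \<tau> by auto
  then have sq: "(\<epsilon> * L2_norm a b (wderiv a b (fst y)))\<^sup>2 \<le> (X_norm a b \<tau> \<epsilon> y)\<^sup>2"
    "(sqrt \<tau> * L2_norm a b (fst y))\<^sup>2 \<le> (X_norm a b \<tau> \<epsilon> y)\<^sup>2"
    "(sqrt \<tau> * L2_norm a b (snd y))\<^sup>2 \<le> (X_norm a b \<tau> \<epsilon> y)\<^sup>2"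
    using X_norm_sq[OF assms] \<tau> by (simp_all add: power_mult_distrib)
  show "\<epsilon> * L2_norm a b (wderiv a b (fst y)) \<le> X_norm a b \<tau> \<epsilon> y"
    "sqrt \<tau> * L2_norm a b (fst y) \<le> X_norm a b \<tau> \<epsilon> y"
    "sqrt \<tau> * L2_norm a b (snd y) \<le> X_norm a b \<tau> \<epsilon> y"
    using sq[THEN power2_le_imp_le] X.nrm_nonneg[OF assms] by auto
qed

lemma X_norm_le:
  assumes "y \<in> X_space a b"
  shows "X_norm a b \<tau> \<epsilon> y \<le> \<epsilon> * L2_norm a b (wderiv a b (fst y)) + sqrt \<tau> * L2_norm a b (fst y)
    + sqrt \<tau> * L2_norm a b (snd y)"
proof (rule power2_le_imp_le)
  note y = X_spaceD[OF assms]
  define p q r where "p = \<epsilon> * L2_norm a b (wderiv a b (fst y))" and "q = sqrt \<tau> * L2_norm a b (fst y)"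
    and "r = sqrt \<tau> * L2_norm a b (snd y)"
  have nn: "p \<ge> 0" "q \<ge> 0" "r \<ge> 0"
    using y \<tau> \<epsilon> by (auto simp: p_def q_def r_def)
  then have "p\<^sup>2 + q\<^sup>2 + r\<^sup>2 \<le> (p + q + r)\<^sup>2"
    by (simp add: power2_eq_square algebra_simps)
  moreover have "p\<^sup>2 + q\<^sup>2 + r\<^sup>2 = (X_norm a b \<tau> \<epsilon> y)\<^sup>2"
    using \<tau> by (simp add: X_norm_sq[OF assms] p_def q_def r_def power_mult_distrib)
  ultimately show "(X_norm a b \<tau> \<epsilon> y)\<^sup>2 \<le> (p + q + r)\<^sup>2" by simp
  show "0 \<le> p + q + r" using nn by simp
qed

lemma dom_A_subset: "dom_A a b \<subseteq> X_space a b"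
  by (auto simp: dom_A_def X_space_def H2_def H1D)

lemma op_A_mem:
  assumes "y \<in> dom_A a b"
  shows "op_A a b \<tau> \<epsilon> y \<in> X_space a b"
proof -
  obtain u w where y: "y = (u, w)" by (cases y)
  with assms have H: "u \<in> H1 a b" "wderiv a b u \<in> H1 a b" "w \<in> H1 a b"
    by (auto simp: dom_A_def H2_def)
  have "w - u \<in> H1 a b"
    by (intro H1_diff H)
  moreover have "(\<lambda>x. \<epsilon>\<^sup>2 / \<tau> * wderiv a b (wderiv a b u) x - w x) \<in> L2 a b"
    using H1D[OF H(2)] H1D[OF H(3)] by (intro L2_diff L2_cmult)
  ultimately show ?thesis
    by (simp add: y op_A_def X_space_def fun_diff_def)
qed

text \<open>The terms \<open>\<epsilon>\<^sup>2\<close> times \<open>u_x w_x\<close> and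
  \<open>w u_xx\<close> cancel after an integration by parts, whose boundary terms vanish by the
  Neumann condition. The summands \<open>- u\<close> and \<open>- w\<close> in \<open>A\<close>
  leave \<open>- Q y y\<close>.\<close>

lemma dissipative:
  assumes "y \<in> dom_A a b"
  shows "Q y (op_A a b \<tau> \<epsilon> y) = - Q y y"
proof -
  obtain u w where y: "y = (u, w)" by (cases y)
  with assms obtain c where H: "u \<in> H1 a b" "wderiv a b u \<in> H1 a b" "w \<in> H1 a b"
    and c: "continuous_on {a..b} c" "AE x in M. c x = wderiv a b u x" "c a = 0" "c b = 0"
    by (auto simp: dom_A_def H2_def)
  define z where "z = wderiv a b u"
  define z' where "z' = wderiv a b z"
  define w' where "w' = wderiv a b w"
  have L: "u \<in> L2 a b" "z \<in> L2 a b" "z' \<in> L2 a b" "w \<in> L2 a b" "w' \<in> L2 a b"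
    using H1D[OF H(1)] H1D[OF H(2)] H1D[OF H(3)] by (auto simp: z_def z'_def w'_def)
  obtain k where k: "AE x in M. z x = k + prim z' x"
    using H1_representative[OF H(2)] by (auto simp: z_def z'_def)
  \<comment> \<open>The boundary values are imposed on the continuous function \<open>c\<close>,
    which agrees with the representative \<open>k + prim z'\<close> up to the end points. So
    \<open>k = 0\<close> and \<open>z'\<close> has integral zero, as integration by parts
    requires.\<close>
  have "AE x in M. c x = k + prim z' x"
    using c(2) k unfolding z_def by eventually_elim simp
  then have cp: "c x = k + prim z' x" if "x \<in> {a..b}" for x
    using that by (intro AE_eq_continuous c continuous_intros prim_continuous L)
  have k0: "k = 0" using cp[of a] c(3) ab L by simp
  have b0: "prim z' b = 0" using cp[of b] c(4) ab k0 by simp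
  have "ip w z' = - ip w' (prim z')"
    unfolding w'_def by (rule integration_by_parts_H1[OF H(3) L(3) b0])
  also have "ip w' (prim z') = ip w' z"
    by (subst (1 2) mult.commute, rule ip_cong_AE) (use L k k0 in \<open>auto elim: eventually_mono\<close>)
  finally have ibp: "ip w z' = - ip w' z" .
  have "ip z (wderiv a b (w - u)) = ip z (w' - z)"
    by (subst (1 2) mult.commute, rule ip_cong_AE)
       (use L H1_diff[OF H(3,1)] H1D in \<open>auto simp: w'_def z_def\<close>)
  also have "\<dots> = ip z w' - ip z z"
    by (rule L2.diff_right[OF L(5,2,2)])
  finally have 1: "ip z (wderiv a b (w - u)) = ip z w' - ip z z" .
  have "ip w ((\<epsilon>\<^sup>2 / \<tau>) *\<^sub>R z' - w) = (\<epsilon>\<^sup>2 / \<tau>) * ip w z' - ip w w"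
    unfolding L2.diff_right[OF L2.mem(4)[OF L(3)] L(4,4)] L2.scale_right[OF L(3,4)] ..
  moreover have "op_A a b \<tau> \<epsilon> y = (w - u, (\<epsilon>\<^sup>2 / \<tau>) *\<^sub>R z' - w)"
    by (simp add: y op_A_def z'_def z_def fun_diff_def scaleR_fun_def)
  ultimately have "Q y (op_A a b \<tau> \<epsilon> y) = \<epsilon>\<^sup>2 * (ip z w' - ip z z) + \<tau> * ((\<epsilon>\<^sup>2 / \<tau>) * ip w z' - ip w w)"
    unfolding Q_def using 1 by (simp add: y z_def)
  also have "\<dots> = \<epsilon>\<^sup>2 * (ip z w' + ip w z') - (\<epsilon>\<^sup>2 * ip z z + \<tau> * ip w w)"
    using \<tau> by (simp add: algebra_simps)
  also have "ip z w' + ip w z' = 0"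
    using ibp by (simp add: mult.commute)
  finally show ?thesis
    by (simp add: Q_def y z_def)
qed

text \<open>Approximating \<open>u_x\<close> by a test function and integrating produces a
  \<open>U\<close> whose derivative vanishes near the end points, so the Neumann condition is met;
  the constant of integration is that of the representative of \<open>u\<close>.\<close>

lemma dom_A_dense:
  assumes "y \<in> X_space a b" "e > 0"
  shows "\<exists>y'\<in>dom_A a b. X_norm a b \<tau> \<epsilon> (y - y') < e"
proof -
  obtain u w where y: "y = (u, w)" by (cases y)
  with assms have u: "u \<in> H1 a b" and w: "w \<in> L2 a b" by (auto simp: X_space_def)
  note uL = H1D[OF u]
  obtain c where c: "AE x in M. u x = c + prim (wderiv a b u) x"
    using u by (rule H1_representative)
  define K where "K = \<epsilon> + sqrt \<tau> * (b - a) + sqrt \<tau>"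
  have K: "K > 0" using \<tau> \<epsilon> ab by (auto simp: K_def intro!: add_pos_nonneg)
  define d where "d = e / K"
  have d: "d > 0" using K \<open>e > 0\<close> by (simp add: d_def)
  obtain \<psi> where \<psi>: "\<psi> \<in> test_functions a b" "L2_norm a b (\<psi> - wderiv a b u) < d"
    using test_functions_dense[OF uL(2) d] by blast
  obtain \<zeta> where \<zeta>: "\<zeta> \<in> test_functions a b" "L2_norm a b (\<zeta> - w) < d"
    using test_functions_dense[OF w d] by blast
  note \<psi>L = test_functions_L2[OF \<psi>(1)] and \<zeta>L = test_functions_L2[OF \<zeta>(1)]
  have test_H1: "\<phi> \<in> H1 a b" "AE x in M. wderiv a b \<phi> x = deriv \<phi> x" if "\<phi> \<in> test_functions a b" for \<phi>
  proof -
    from that obtain \<eta> where "\<And>x. (\<phi> has_real_derivative deriv \<phi> x) (at x)" "continuous_on UNIV (deriv \<phi>)"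
      by (rule test_functionsE) blast
    from C1_weak_deriv[OF this] show "\<phi> \<in> H1 a b" "AE x in M. wderiv a b \<phi> x = deriv \<phi> x"
      by (auto intro: H1I)
  qed
  from \<psi>(1) obtain \<Psi> where \<Psi>: "\<And>x. (\<Psi> has_real_derivative \<psi> x) (at x)" "\<And>x. x \<in> {a..b} \<Longrightarrow> \<Psi> x = prim \<psi> x"
    by (rule test_function_primitive) blast
  from \<psi>(1) obtain \<eta> where \<eta>: "\<eta> > 0" "\<And>x. x \<notin> {a + \<eta>..b - \<eta>} \<Longrightarrow> \<psi> x = 0" and \<psi>c: "continuous_on UNIV \<psi>"
    by (rule test_functionsE) blast
  define U where "U x = c + \<Psi> x" for x
  have Uder: "(U has_real_derivative \<psi> x) (at x)" for x
    unfolding U_def by (auto intro!: derivative_eq_intros \<Psi>)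
  note U = C1_weak_deriv[OF Uder \<psi>c]
  note UH = H1I[OF U]
  note wU = H1D[OF UH(1)]
  have UH2: "wderiv a b U \<in> H1 a b"
  proof (rule H1I(1))
    show "has_weak_deriv a b (wderiv a b U) (wderiv a b \<psi>)"
      using H1D(3)[OF test_H1(1)[OF \<psi>(1)]] \<psi>L wU(2) UH(2) by (rule has_weak_deriv_cong_AE)
  qed (use wU H1D(2)[OF test_H1(1)[OF \<psi>(1)]] in auto)
  have dom: "(U, \<zeta>) \<in> dom_A a b"
  proof -
    have "continuous_on {a..b} \<psi>" using \<psi>c by (rule continuous_on_subset) auto
    moreover have "AE x in M. \<psi> x = wderiv a b U x" using UH(2) by eventually_elim simp
    moreover have "\<psi> a = 0" "\<psi> b = 0" using \<eta> by auto
    ultimately show ?thesis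
      using UH(1) UH2 test_H1(1)[OF \<zeta>(1)] by (auto simp: dom_A_def H2_def)
  qed
  have X: "y - (U, \<zeta>) \<in> X_space a b"
    using assms(1) dom dom_A_subset by auto
  have diff: "y - (U, \<zeta>) = (u - U, w - \<zeta>)" by (simp add: y)
  have n1: "L2_norm a b (wderiv a b (u - U)) = L2_norm a b (\<psi> - wderiv a b u)"
    unfolding L2_norm_def
  proof (intro arg_cong[where f = sqrt] integral_cong_AE)
    show "AE x in M. (wderiv a b (u - U) x)\<^sup>2 = ((\<psi> - wderiv a b u) x)\<^sup>2"
      using H1_diff(2)[OF u UH(1)] UH(2) by eventually_elim (simp add: power2_commute)
    show "(\<lambda>x. (wderiv a b (u - U) x)\<^sup>2) \<in> borel_measurable M"
      by (rule borel_measurable_power[OF L2_measurable[OF H1D(2)[OF H1_diff(1)[OF u UH(1)]]]])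
    show "(\<lambda>x. ((\<psi> - wderiv a b u) x)\<^sup>2) \<in> borel_measurable M"
      by (rule borel_measurable_power[OF L2_measurable[OF L2.mem(3)[OF \<psi>L uL(2)]]])
  qed
  have "L2_norm a b (u - U) = L2_norm a b (prim (wderiv a b u - \<psi>))"
    unfolding L2_norm_def
  proof (intro arg_cong[where f = sqrt] integral_cong_AE)
    have "AE x in M. x \<in> {a..b}" by (rule AE_I2) auto
    with c show "AE x in M. ((u - U) x)\<^sup>2 = (prim (wderiv a b u - \<psi>) x)\<^sup>2"
      by eventually_elim (simp add: U_def \<Psi>(2) prim_diff[OF uL(2) \<psi>L])
    show "(\<lambda>x. ((u - U) x)\<^sup>2) \<in> borel_measurable M"
      by (rule borel_measurable_power[OF L2_measurable[OF L2.mem(3)[OF uL(1) U(1)]]])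
    show "(\<lambda>x. (prim (wderiv a b u - \<psi>) x)\<^sup>2) \<in> borel_measurable M"
      by (rule borel_measurable_power[OF L2_measurable[OF prim_L2[OF L2.mem(3)[OF uL(2) \<psi>L]]]])
  qed
  also have "\<dots> \<le> (b - a) * L2_norm a b (\<psi> - wderiv a b u)"
    using prim_norm[OF L2.mem(3)[OF uL(2) \<psi>L]] L2.nrm_minus[OF uL(2) \<psi>L] by simp
  finally have n2: "L2_norm a b (u - U) \<le> (b - a) * L2_norm a b (\<psi> - wderiv a b u)" .
  have "X_norm a b \<tau> \<epsilon> (y - (U, \<zeta>)) \<le> \<epsilon> * L2_norm a b (wderiv a b (u - U)) + sqrt \<tau> * L2_norm a b (u - U)
    + sqrt \<tau> * L2_norm a b (w - \<zeta>)"
    using X_norm_le[OF X] by (simp add: diff)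
  also have "\<dots> \<le> \<epsilon> * L2_norm a b (\<psi> - wderiv a b u) + sqrt \<tau> * ((b - a) * L2_norm a b (\<psi> - wderiv a b u))
    + sqrt \<tau> * L2_norm a b (\<zeta> - w)"
    using n1 n2 \<tau> \<epsilon> L2.nrm_minus[OF w \<zeta>L] by (intro add_mono mult_left_mono) auto
  also have "\<dots> < \<epsilon> * d + sqrt \<tau> * ((b - a) * d) + sqrt \<tau> * d"
    using \<psi>(2) \<zeta>(2) \<tau> \<epsilon> ab by (intro add_strict_mono mult_strict_left_mono) auto
  also have "\<dots> = K * d" by (simp add: K_def algebra_simps)
  also have "\<dots> = e" using K by (simp add: d_def)
  finally show ?thesis using dom by blast
qed

lemma form_semigroup_generated:
  assumes "generates_contraction_semigroup (X_space a b) (X_norm a b \<tau> \<epsilon>) (dom_A a b) (op_A a b \<tau> \<epsilon>) S"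
  shows "form_semigroup (X_space a b) (X_inner a b \<tau> \<epsilon>) Q S (dom_A a b) (op_A a b \<tau> \<epsilon>)"
proof -
  have nrm: "semi_inner.nrm (X_inner a b \<tau> \<epsilon>) = X_norm a b \<tau> \<epsilon>"
    by (simp add: fun_eq_iff X_norm_def semi_inner.nrm_def[OF X.semi_inner_axioms])
  show ?thesis
  proof (unfold_locales, unfold nrm)
    show "contraction_semigroup (X_space a b) (X_norm a b \<tau> \<epsilon>) S"
      using assms by (simp add: generates_contraction_semigroup_def)
  qed (simp_all add: assms dom_A_subset op_A_mem dom_A_dense dissipative)
qed

text \<open>Uniform closeness of the first components is what makes compositions with
  \<open>f\<close>, \<open>g\<close> and \<open>F\<close> continuous in time. The constant
  \<open>K\<close> depends on \<epsilon>, which is fixed as long as one solution is studied.\<close>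

lemma X_norm_sup_bound:
  obtains K where "K > 0" "\<And>y. y \<in> X_space a b \<Longrightarrow> AE x in M. \<bar>fst y x\<bar> \<le> K * X_norm a b \<tau> \<epsilon> y"
proof -
  define K where "K = 1 / (sqrt (b - a) * sqrt \<tau>) + 2 * sqrt (b - a) / \<epsilon>"
  have pos: "sqrt (b - a) > 0" "sqrt \<tau> > 0" using ab \<tau> by auto
  have K: "K > 0" using pos \<epsilon> by (auto simp: K_def intro!: add_pos_pos)
  have "AE x in M. \<bar>fst y x\<bar> \<le> K * X_norm a b \<tau> \<epsilon> y" if y: "y \<in> X_space a b" for y
  proof -
    have 1: "L2_norm a b (fst y) \<le> X_norm a b \<tau> \<epsilon> y / sqrt \<tau>"
      using X_norm_components(2)[OF y] pos by (simp add: field_simps)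
    have 2: "L2_norm a b (wderiv a b (fst y)) \<le> X_norm a b \<tau> \<epsilon> y / \<epsilon>"
      using X_norm_components(1)[OF y] \<epsilon> by (simp add: field_simps)
    have "L2_norm a b (fst y) / sqrt (b - a) + 2 * sqrt (b - a) * L2_norm a b (wderiv a b (fst y))
        \<le> (X_norm a b \<tau> \<epsilon> y / sqrt \<tau>) / sqrt (b - a) + 2 * sqrt (b - a) * (X_norm a b \<tau> \<epsilon> y / \<epsilon>)"
      using 1 2 pos by (intro add_mono divide_right_mono mult_left_mono) auto
    also have "\<dots> = K * X_norm a b \<tau> \<epsilon> y"
      by (simp add: K_def field_simps)
    finally have le: "L2_norm a b (fst y) / sqrt (b - a) + 2 * sqrt (b - a) * L2_norm a b (wderiv a b (fst y))
        \<le> K * X_norm a b \<tau> \<epsilon> y" .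
    show ?thesis
      using H1_sup_bound[OF X_spaceD(1)[OF y]] by eventually_elim (use le in linarith)
  qed
  with K that show thesis by blast
qed

end

subsection \<open>The energy inequality for mild solutions\<close>

lemma continuous_bounded_on_interval:
  fixes h :: "real \<Rightarrow> real"
  assumes "continuous_on UNIV h"
  obtains C where "C \<ge> 0" "\<And>s. \<bar>s\<bar> \<le> R \<Longrightarrow> \<bar>h s\<bar> \<le> C"
proof -
  have "compact (h ` {- R..R})"
    using assms by (intro compact_continuous_image) (auto intro: continuous_on_subset)
  then obtain C where C: "\<And>y. y \<in> h ` {- R..R} \<Longrightarrow> \<bar>y\<bar> \<le> C"
    using compact_imp_bounded bounded_iff by (metis real_norm_def)
  have "\<bar>h s\<bar> \<le> \<bar>C\<bar>" if "\<bar>s\<bar> \<le> R" for s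
    using C[of "h s"] that by fastforce
  then show thesis by (intro that[of "\<bar>C\<bar>"]) auto
qed

lemma continuous_uniform_on_interval:
  fixes h :: "real \<Rightarrow> real"
  assumes "continuous_on UNIV h" "e > 0"
  obtains \<delta> where "\<delta> > 0" "\<And>s s'. \<bar>s\<bar> \<le> R \<Longrightarrow> \<bar>s' - s\<bar> \<le> \<delta> \<Longrightarrow> \<bar>h s' - h s\<bar> \<le> e"
proof -
  have "uniformly_continuous_on {- R - 1..R + 1} h"
    using assms(1) by (intro compact_uniformly_continuous) (auto intro: continuous_on_subset)
  then obtain d where d: "d > 0" "\<And>s s'. s \<in> {- R - 1..R + 1} \<Longrightarrow> s' \<in> {- R - 1..R + 1} \<Longrightarrow>
      dist s' s < d \<Longrightarrow> dist (h s') (h s) < e"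
    unfolding uniformly_continuous_on_def using \<open>e > 0\<close> by blast
  have "\<bar>h s' - h s\<bar> \<le> e" if "\<bar>s\<bar> \<le> R" "\<bar>s' - s\<bar> \<le> min 1 (d / 2)" for s s'
  proof -
    have "dist (h s') (h s) < e"
      by (rule d(2)) (use that d(1) in \<open>auto simp: dist_real_def abs_le_iff\<close>)
    then show ?thesis by (simp add: dist_real_def)
  qed
  with d(1) show thesis by (intro that[of "min 1 (d / 2)"]) auto
qed

text \<open>Since \<open>- f\<close> is the derivative of \<open>F\<close>, the left-hand side is a
  first-order Taylor remainder. Two applications of the mean value inequality give the constant
  \<open>L\<close>.\<close>

lemma taylor_bound:
  fixes F f f' :: "real \<Rightarrow> real"
  assumes F: "\<And>s. (F has_real_derivative - f s) (at s)" and f: "\<And>s. (f has_real_derivative f' s) (at s)"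
    and L: "\<And>s. \<bar>s\<bar> \<le> R \<Longrightarrow> \<bar>f' s\<bar> \<le> L" and s: "\<bar>s\<bar> \<le> R" "\<bar>s'\<bar> \<le> R"
  shows "\<bar>F s' - F s + f s * (s' - s)\<bar> \<le> L * (s' - s)\<^sup>2"
proof -
  define S where "S = closed_segment s s'"
  have S: "\<bar>x\<bar> \<le> R \<and> \<bar>x - s\<bar> \<le> \<bar>s' - s\<bar>" if "x \<in> S" for x
    using that s by (auto simp: S_def closed_segment_eq_real_ivl split: if_splits)
  have conv: "convex S" and mem: "s \<in> S" "s' \<in> S" by (auto simp: S_def)
  have fb: "\<bar>f x - f s\<bar> \<le> L * \<bar>x - s\<bar>" if "x \<in> S" for x
    using field_differentiable_bound[OF conv, of f f' L x s] f L S that mem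
    by (auto intro: DERIV_subset)
  have L0: "L \<ge> 0" using L[OF s(1)] by linarith
  have "norm ((F s' + f s * s') - (F s + f s * s)) \<le> (L * \<bar>s' - s\<bar>) * norm (s' - s)"
  proof (rule field_differentiable_bound[OF conv, of "\<lambda>x. F x + f s * x" "\<lambda>x. - f x + f s"])
    show "((\<lambda>x. F x + f s * x) has_real_derivative - f x + f s) (at x within S)" for x
      by (rule DERIV_subset[of _ _ _ UNIV]) (auto intro!: derivative_eq_intros F)
    show "norm (- f x + f s) \<le> L * \<bar>s' - s\<bar>" if "x \<in> S" for x
    proof -
      have "norm (- f x + f s) = \<bar>f x - f s\<bar>" by (simp add: abs_minus_commute)
      also have "\<dots> \<le> L * \<bar>x - s\<bar>" by (rule fb[OF that])
      also have "\<dots> \<le> L * \<bar>s' - s\<bar>" using S[OF that] L0 by (intro mult_left_mono) auto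
      finally show ?thesis .
    qed
  qed (use mem in auto)
  moreover have "(F s' + f s * s') - (F s + f s * s) = F s' - F s + f s * (s' - s)"
    by (simp add: algebra_simps)
  ultimately show ?thesis
    by (simp add: power2_eq_square abs_mult_self_eq mult.assoc flip: abs_mult)
qed

lemma eventually_within_nonneg: "\<forall>\<^sub>F s in at t within {0..}. (s::real) \<ge> 0" for t :: real
  by (auto simp: eventually_at intro: exI[of _ 1])

lemma tendsto_at_right_shift:
  fixes q :: "real \<Rightarrow> real"
  assumes "(q \<longlongrightarrow> l) (at t within {0..})" "t \<ge> 0"
  shows "((\<lambda>h. q (t + h)) \<longlongrightarrow> l) (at_right 0)"
proof -
  have "(q \<longlongrightarrow> l) (at_right t)"
    by (rule tendsto_within_subset[OF assms(1)]) (use \<open>t \<ge> 0\<close> in auto)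
  then show ?thesis
    using filterlim_at_right_to_0[of q "nhds l" t] by (simp add: add.commute)
qed

lemma eventually_at_right_shift:
  fixes t :: real
  assumes "\<forall>\<^sub>F s in at t within {0..}. R s" "t \<ge> 0"
  shows "\<forall>\<^sub>F h in at_right 0. R (t + h)"
proof -
  have "eventually R (at_right t)"
    by (rule filter_leD[OF at_le assms(1)]) (use \<open>t \<ge> 0\<close> in auto)
  then show ?thesis
    using eventually_at_right_to_0[of R t] by (simp add: add.commute)
qed

lemma eventually_at_right_0_pos: "\<forall>\<^sub>F h in at_right 0. 0 < (h::real)"
  by (auto simp: eventually_at_right_field intro: exI[of _ 1])

lemma continuous_on_IccI_nonneg:
  fixes q :: "real \<Rightarrow> real"
  assumes "\<And>r. r \<ge> 0 \<Longrightarrow> (q \<longlongrightarrow> q r) (at r within {0..})"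
  shows "continuous_on {0..t} q"
  unfolding continuous_on_def
proof
  fix r
  assume "r \<in> {0..t}"
  then show "(q \<longlongrightarrow> q r) (at r within {0..t})"
    using tendsto_within_subset[OF assms[of r], of "{0..t}"] by auto
qed

locale damped_wave = energy_space +
  fixes \<sigma> :: real and f f' g F :: "real \<Rightarrow> real" and y0 :: state and u w :: "real \<Rightarrow> real \<Rightarrow> real"
  assumes F_deriv: "\<And>s. (F has_real_derivative - f s) (at s)"
    and f_deriv: "\<And>s. (f has_real_derivative f' s) (at s)"
    and f'_cont: "continuous_on UNIV f'"
    and g_cont: "continuous_on UNIV g" and \<sigma>: "\<sigma> > 0" and g_ge: "\<And>s. g s \<ge> \<sigma>"
    and mild: "mild_solution a b \<tau> \<epsilon> f g y0 (\<lambda>t. (u t, w t))" and y0: "y0 \<in> X_space a b"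
begin

abbreviation y :: "real \<Rightarrow> state" where "y t \<equiv> (u t, w t)"

definition fu :: "real \<Rightarrow> real \<Rightarrow> real" where "fu t = (\<lambda>x. f (u t x))"
definition gw :: "real \<Rightarrow> real \<Rightarrow> real" where "gw t = (\<lambda>x. g (u t x) * w t x)"
definition P :: "real \<Rightarrow> state" where "P t = (u t, w t + (1 / \<tau>) *\<^sub>R (fu t - gw t))"
definition E :: "real \<Rightarrow> real" where "E t = Q (y t) (y t) / 2 + (LINT x|M. F (u t x))"

section \<open>Integrability and continuity in time along the solution\<close>

lemma f_cont: "continuous_on UNIV f" and F_cont: "continuous_on UNIV F"
  using f_deriv F_deriv by (auto intro!: continuous_at_imp_continuous_on DERIV_isCont)

lemma P_eq: "P t = Phi \<tau> f g (y t)"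
  by (auto simp: P_def Phi_def fu_def gw_def fun_eq_iff scaleR_fun_def)

lemma yX: "t \<ge> 0 \<Longrightarrow> y t \<in> X_space a b"
  and y_lim: "t \<ge> 0 \<Longrightarrow> ((\<lambda>s. X_norm a b \<tau> \<epsilon> (y s - y t)) \<longlongrightarrow> 0) (at t within {0..})"
  and u_deriv: "t \<ge> 0 \<Longrightarrow> ((\<lambda>s. L2_norm a b ((1 / (s - t)) *\<^sub>R (u s - u t) - w t)) \<longlongrightarrow> 0) (at t within {0..})"
  using mild by (auto simp: mild_solution_def)

lemma uw_mem:
  assumes "t \<ge> 0"
  shows "u t \<in> H1 a b" "u t \<in> L2 a b" "w t \<in> L2 a b" "wderiv a b (u t) \<in> L2 a b"
  using X_spaceD[OF yX[OF assms]] by auto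

lemma u_bounded:
  assumes "t \<ge> 0"
  obtains R where "R \<ge> 0" "AE x in M. \<bar>u t x\<bar> \<le> R"
proof -
  obtain K where K: "K > 0" "\<And>y. y \<in> X_space a b \<Longrightarrow> AE x in M. \<bar>fst y x\<bar> \<le> K * X_norm a b \<tau> \<epsilon> y"
    by (rule X_norm_sup_bound) blast
  from K(2)[OF yX[OF assms]] K(1) X.nrm_nonneg[OF yX[OF assms]] show thesis
    by (intro that[of "K * X_norm a b \<tau> \<epsilon> (y t)"]) auto
qed

lemma u_uniform:
  assumes "t \<ge> 0" "\<delta> > 0"
  shows "\<forall>\<^sub>F s in at t within {0..}. AE x in M. \<bar>u s x - u t x\<bar> \<le> \<delta>"
proof -
  obtain K where K: "K > 0" "\<And>y. y \<in> X_space a b \<Longrightarrow> AE x in M. \<bar>fst y x\<bar> \<le> K * X_norm a b \<tau> \<epsilon> y"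
    by (rule X_norm_sup_bound) blast
  have "\<forall>\<^sub>F s in at t within {0..}. X_norm a b \<tau> \<epsilon> (y s - y t) < \<delta> / K"
    using K(1) assms by (intro order_tendstoD(2)[OF y_lim]) auto
  then show ?thesis
    using eventually_within_nonneg
  proof eventually_elim
    case (elim s)
    have "y s - y t \<in> X_space a b"
      using yX[of s] yX[of t] elim assms by (intro X.mem(3))
    from K(2)[OF this] have "AE x in M. \<bar>u s x - u t x\<bar> \<le> K * X_norm a b \<tau> \<epsilon> (y s - y t)"
      by simp
    moreover have "K * X_norm a b \<tau> \<epsilon> (y s - y t) \<le> \<delta>"
      using elim(1) K(1) by (simp add: field_simps)
    ultimately show ?case
      by (auto elim!: eventually_mono)
  qed
qed

lemma compose_measurable:
  "continuous_on UNIV h \<Longrightarrow> t \<ge> 0 \<Longrightarrow> (\<lambda>x. h (u t x)) \<in> borel_measurable M" for h :: "real \<Rightarrow> real"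
  using L2_measurable[OF uw_mem(2)] borel_measurable_continuous_onI[of h]
  by (rule measurable_compose)

lemma compose_bounded:
  fixes h :: "real \<Rightarrow> real"
  assumes "continuous_on UNIV h" "t \<ge> 0"
  obtains C where "C \<ge> 0" "AE x in M. \<bar>h (u t x)\<bar> \<le> C"
proof -
  obtain R where R: "AE x in M. \<bar>u t x\<bar> \<le> R"
    using u_bounded[OF assms(2)] by blast
  obtain C where C: "C \<ge> 0" "\<And>s. \<bar>s\<bar> \<le> R \<Longrightarrow> \<bar>h s\<bar> \<le> C"
    using continuous_bounded_on_interval[OF assms(1)] by blast
  have "AE x in M. \<bar>h (u t x)\<bar> \<le> C"
    using R by eventually_elim (rule C(2))
  with C(1) show thesis by (rule that)
qed

lemma compose_L2: "continuous_on UNIV h \<Longrightarrow> t \<ge> 0 \<Longrightarrow> (\<lambda>x. h (u t x)) \<in> L2 a b" for h :: "real \<Rightarrow> real"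
  by (rule compose_bounded[of h t]) (auto intro: L2_I_bounded compose_measurable)

lemma fu_L2: "t \<ge> 0 \<Longrightarrow> fu t \<in> L2 a b"
  unfolding fu_def by (rule compose_L2[OF f_cont])

lemma gw_L2:
  assumes "t \<ge> 0"
  shows "gw t \<in> L2 a b"
proof -
  obtain C where "AE x in M. \<bar>g (u t x)\<bar> \<le> C"
    using compose_bounded[OF g_cont assms] by blast
  then show ?thesis
    unfolding gw_def by (rule L2_mult_bounded[OF uw_mem(3)[OF assms] compose_measurable[OF g_cont assms]])
qed

lemma P_mem: "t \<ge> 0 \<Longrightarrow> P t \<in> X_space a b"
  using uw_mem fu_L2 gw_L2 by (auto simp: P_def X_space_def)

lemma compose_uniform:
  fixes h :: "real \<Rightarrow> real"
  assumes "continuous_on UNIV h" "t \<ge> 0" "e > 0"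
  shows "\<forall>\<^sub>F s in at t within {0..}. AE x in M. \<bar>h (u s x) - h (u t x)\<bar> \<le> e"
proof -
  obtain R where R: "AE x in M. \<bar>u t x\<bar> \<le> R"
    using u_bounded[OF assms(2)] by blast
  obtain \<delta> where \<delta>: "\<delta> > 0" "\<And>s s'. \<bar>s\<bar> \<le> R \<Longrightarrow> \<bar>s' - s\<bar> \<le> \<delta> \<Longrightarrow> \<bar>h s' - h s\<bar> \<le> e"
    using continuous_uniform_on_interval[OF assms(1,3)] by blast
  from u_uniform[OF assms(2) \<delta>(1)] show ?thesis
  proof eventually_elim
    case (elim s)
    from R elim show ?case
      by eventually_elim (rule \<delta>(2))
  qed
qed

lemma compose_L2_lim:
  fixes h :: "real \<Rightarrow> real"
  assumes h: "continuous_on UNIV h" and t: "t \<ge> 0"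
  shows "((\<lambda>s. L2_norm a b ((\<lambda>x. h (u s x)) - (\<lambda>x. h (u t x)))) \<longlongrightarrow> 0) (at t within {0..})"
proof (rule tendstoI)
  fix e :: real
  assume "e > 0"
  define e' where "e' = e / (2 * sqrt (b - a))"
  have e': "e' > 0" "sqrt (b - a) * e' < e"
    using \<open>e > 0\<close> ab by (auto simp: e'_def)
  from compose_uniform[OF h t e'(1)] eventually_within_nonneg
  show "\<forall>\<^sub>F s in at t within {0..}. dist (L2_norm a b ((\<lambda>x. h (u s x)) - (\<lambda>x. h (u t x)))) 0 < e"
  proof eventually_elim
    case (elim s)
    have mem: "(\<lambda>x. h (u s x)) - (\<lambda>x. h (u t x)) \<in> L2 a b"
      using compose_L2[OF h] elim t by (intro L2.mem(3)) auto
    have "L2_norm a b ((\<lambda>x. h (u s x)) - (\<lambda>x. h (u t x))) \<le> sqrt (b - a) * e'"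
      using elim e' L2_measurable[OF mem] by (intro L2_norm_bounded) auto
    then show ?case
      using e' L2.nrm_nonneg[OF mem] by simp
  qed
qed

lemma w_lim:
  assumes t: "t \<ge> 0"
  shows "((\<lambda>s. L2_norm a b (w s - w t)) \<longlongrightarrow> 0) (at t within {0..})"
proof (rule Lim_null_comparison)
  show "((\<lambda>s. X_norm a b \<tau> \<epsilon> (y s - y t) / sqrt \<tau>) \<longlongrightarrow> 0) (at t within {0..})"
    by (rule tendsto_divide_zero[OF y_lim[OF t]])
  show "\<forall>\<^sub>F s in at t within {0..}. norm (L2_norm a b (w s - w t)) \<le> X_norm a b \<tau> \<epsilon> (y s - y t) / sqrt \<tau>"
    using eventually_within_nonneg
  proof eventually_elim
    case (elim s)
    have "y s - y t \<in> X_space a b"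
      using yX[OF elim] yX[OF t] by (rule X.mem(3))
    from X_norm_components(3)[OF this] X_spaceD(4)[OF this] \<tau> show ?case
      using L2.nrm_nonneg by (simp add: field_simps)
  qed
qed

text \<open>The difference splits into \<open>g (u s)\<close> times \<open>w s - w t\<close>, with a
  uniformly bounded factor, and \<open>g (u s) - g (u t)\<close> times \<open>w t\<close>, with a
  uniformly small one.\<close>

lemma gw_lim:
  assumes t: "t \<ge> 0"
  shows "((\<lambda>s. L2_norm a b (gw s - gw t)) \<longlongrightarrow> 0) (at t within {0..})"
proof (rule tendstoI)
  fix e :: real
  assume "e > 0"
  obtain G where G: "G \<ge> 0" "AE x in M. \<bar>g (u t x)\<bar> \<le> G"
    using compose_bounded[OF g_cont t] by blast
  \<comment> \<open>The bound 1 keeps \<open>\<bar>g (u s)\<bar>\<close> at most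
    \<open>G + 1\<close>; the other bound makes the second part smaller than
    \<open>e / 2\<close>.\<close>
  define e' where "e' = min 1 (e / (2 * (L2_norm a b (w t) + 1)))"
  have wn: "L2_norm a b (w t) \<ge> 0" using uw_mem(3)[OF t] by simp
  have e': "e' > 0" "e' \<le> 1" "e' * L2_norm a b (w t) < e / 2 + 0"
  proof -
    show "e' > 0" using \<open>e > 0\<close> wn by (auto simp: e'_def)
    show "e' \<le> 1" by (simp add: e'_def)
    have "e' * L2_norm a b (w t) < e' * (L2_norm a b (w t) + 1)"
      using \<open>e' > 0\<close> by (intro mult_strict_left_mono) auto
    also have "\<dots> \<le> (e / (2 * (L2_norm a b (w t) + 1))) * (L2_norm a b (w t) + 1)"
      using wn by (intro mult_right_mono) (auto simp: e'_def)
    also have "\<dots> = e / 2"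
      using wn by (simp add: field_simps)
    finally show "e' * L2_norm a b (w t) < e / 2 + 0" by simp
  qed
  have G1: "(G + 1) > 0" using G by simp
  then have "\<forall>\<^sub>F s in at t within {0..}. L2_norm a b (w s - w t) < e / (2 * (G + 1))"
    using \<open>e > 0\<close> by (intro order_tendstoD(2)[OF w_lim[OF t]]) auto
  with compose_uniform[OF g_cont t e'(1)] eventually_within_nonneg
  show "\<forall>\<^sub>F s in at t within {0..}. dist (L2_norm a b (gw s - gw t)) 0 < e"
  proof eventually_elim
    case (elim s)
    note W = uw_mem(3)[OF t] uw_mem(3)[OF elim(2)] L2.mem(3)[OF uw_mem(3)[OF elim(2)] uw_mem(3)[OF t]]
    define p where "p = (\<lambda>x. g (u s x) * (w s - w t) x)"
    define q where "q = (\<lambda>x. (g (u s x) - g (u t x)) * w t x)"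
    have gs: "(\<lambda>x. g (u s x)) \<in> borel_measurable M" "(\<lambda>x. g (u s x) - g (u t x)) \<in> borel_measurable M"
      using compose_measurable[OF g_cont] elim t by (auto intro: borel_measurable_diff)
    have bs: "AE x in M. \<bar>g (u s x)\<bar> \<le> G + 1"
      using G(2) elim(1) by eventually_elim (use e' in linarith)
    have p: "p \<in> L2 a b" "L2_norm a b p \<le> L2_norm a b ((G + 1) *\<^sub>R (w s - w t))"
    proof -
      have m: "p \<in> borel_measurable M"
        unfolding p_def by (rule borel_measurable_times[OF gs(1) L2_measurable[OF W(3)]])
      have "AE x in M. \<bar>p x\<bar> \<le> \<bar>((G + 1) *\<^sub>R (w s - w t)) x\<bar>"
        using bs
      proof eventually_elim
        case (elim x)
        then have "\<bar>g (u s x)\<bar> * \<bar>(w s - w t) x\<bar> \<le> \<bar>G + 1\<bar> * \<bar>(w s - w t) x\<bar>"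
          by (intro mult_right_mono) auto
        then show ?case
          unfolding p_def scaleR_fun_def real_scaleR_def abs_mult .
      qed
      with m L2.mem(4)[OF W(3), of "G + 1"] show "p \<in> L2 a b" "L2_norm a b p \<le> L2_norm a b ((G + 1) *\<^sub>R (w s - w t))"
        by (blast intro: L2_norm_mono)+
    qed
    have q: "q \<in> L2 a b" "L2_norm a b q \<le> L2_norm a b (e' *\<^sub>R w t)"
    proof -
      have m: "q \<in> borel_measurable M"
        unfolding q_def by (rule borel_measurable_times[OF gs(2) L2_measurable[OF W(1)]])
      have "AE x in M. \<bar>q x\<bar> \<le> \<bar>(e' *\<^sub>R w t) x\<bar>"
        using elim(1)
      proof eventually_elim
        case (elim x)
        then have "\<bar>g (u s x) - g (u t x)\<bar> * \<bar>w t x\<bar> \<le> \<bar>e'\<bar> * \<bar>w t x\<bar>"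
          by (intro mult_right_mono) auto
        then show ?case
          unfolding q_def scaleR_fun_def real_scaleR_def abs_mult .
      qed
      with m L2.mem(4)[OF W(1), of e'] show "q \<in> L2 a b" "L2_norm a b q \<le> L2_norm a b (e' *\<^sub>R w t)"
        by (blast intro: L2_norm_mono)+
    qed
    have "gw s - gw t = p + q"
      by (auto simp: p_def q_def gw_def fun_eq_iff algebra_simps)
    then have "L2_norm a b (gw s - gw t) \<le> L2_norm a b p + L2_norm a b q"
      using L2.nrm_triangle[OF p(1) q(1)] by simp
    also have "\<dots> \<le> (G + 1) * L2_norm a b (w s - w t) + e' * L2_norm a b (w t)"
      using p(2) q(2) G1 e' unfolding L2.nrm_scale[OF W(3)] L2.nrm_scale[OF W(1)] by simp
    also have "(G + 1) * L2_norm a b (w s - w t) < e / 2"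
      using elim(3) G1 by (simp add: field_simps)
    also have "e / 2 + e' * L2_norm a b (w t) < e" using e' by simp
    finally show ?case
      using L2.nrm_nonneg[OF L2.mem(3)[OF gw_L2[OF elim(2)] gw_L2[OF t]]] by (simp add: dist_real_def)
  qed
qed

lemma P_lim:
  assumes t: "t \<ge> 0"
  shows "((\<lambda>s. X_norm a b \<tau> \<epsilon> (P s - P t)) \<longlongrightarrow> 0) (at t within {0..})"
proof (rule Lim_null_comparison)
  \<comment> \<open>The factor 3 counts the parts of the norm that involve \<open>u_x\<close>,
    \<open>u\<close> and \<open>w\<close>.\<close>
  define B where "B s = 3 * X_norm a b \<tau> \<epsilon> (y s - y t)
    + sqrt \<tau> * (1 / \<tau>) * (L2_norm a b (fu s - fu t) + L2_norm a b (gw s - gw t))" for s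
  have fl: "((\<lambda>s. L2_norm a b (fu s - fu t)) \<longlongrightarrow> 0) (at t within {0..})"
    using compose_L2_lim[OF f_cont t] by (simp add: fu_def)
  have "(B \<longlongrightarrow> 3 * 0 + sqrt \<tau> * (1 / \<tau>) * (0 + 0)) (at t within {0..})"
    unfolding B_def by (intro tendsto_intros y_lim[OF t] fl gw_lim[OF t])
  then show "(B \<longlongrightarrow> 0) (at t within {0..})" by simp
  show "\<forall>\<^sub>F s in at t within {0..}. norm (X_norm a b \<tau> \<epsilon> (P s - P t)) \<le> B s"
    using eventually_within_nonneg
  proof eventually_elim
    case (elim s)
    note Y = X.mem(3)[OF yX[OF elim] yX[OF t]]
    note PX = X.mem(3)[OF P_mem[OF elim] P_mem[OF t]]
    note Wm = L2.mem(3)[OF uw_mem(3)[OF elim] uw_mem(3)[OF t]]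
    note Fm = L2.mem(3)[OF fu_L2[OF elim] fu_L2[OF t]]
    note Gm = L2.mem(3)[OF gw_L2[OF elim] gw_L2[OF t]]
    note FG = L2.mem(3)[OF Fm Gm]
    have snd_eq: "snd (P s - P t) = (w s - w t) + (1 / \<tau>) *\<^sub>R ((fu s - fu t) - (gw s - gw t))"
      by (simp add: P_def algebra_simps)
    have "L2_norm a b (snd (P s - P t)) \<le> L2_norm a b (w s - w t) + L2_norm a b ((1 / \<tau>) *\<^sub>R ((fu s - fu t) - (gw s - gw t)))"
      unfolding snd_eq by (rule L2.nrm_triangle[OF Wm L2.mem(4)[OF FG]])
    moreover have "L2_norm a b ((1 / \<tau>) *\<^sub>R ((fu s - fu t) - (gw s - gw t))) = (1 / \<tau>) * L2_norm a b ((fu s - fu t) - (gw s - gw t))"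
      unfolding L2.nrm_scale[OF FG] using \<tau> by simp
    moreover have "L2_norm a b ((fu s - fu t) - (gw s - gw t)) \<le> L2_norm a b (fu s - fu t) + L2_norm a b (gw s - gw t)"
      using L2.nrm_diff_triangle[OF Fm L2.mem(1) Gm] L2.nrm_minus[OF L2.mem(1) Gm] by simp
    then have "(1 / \<tau>) * L2_norm a b ((fu s - fu t) - (gw s - gw t)) \<le> (1 / \<tau>) * (L2_norm a b (fu s - fu t) + L2_norm a b (gw s - gw t))"
      using \<tau> by (intro mult_left_mono) auto
    ultimately have 1: "L2_norm a b (snd (P s - P t)) \<le> L2_norm a b (w s - w t)
        + (1 / \<tau>) * (L2_norm a b (fu s - fu t) + L2_norm a b (gw s - gw t))"
      by linarith
    have "X_norm a b \<tau> \<epsilon> (P s - P t) \<le> \<epsilon> * L2_norm a b (wderiv a b (u s - u t)) + sqrt \<tau> * L2_norm a b (u s - u t)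
        + sqrt \<tau> * L2_norm a b (snd (P s - P t))"
      using X_norm_le[OF PX] by (simp add: P_def)
    also have "\<dots> \<le> X_norm a b \<tau> \<epsilon> (y s - y t) + X_norm a b \<tau> \<epsilon> (y s - y t)
        + sqrt \<tau> * (L2_norm a b (w s - w t) + (1 / \<tau>) * (L2_norm a b (fu s - fu t) + L2_norm a b (gw s - gw t)))"
      using X_norm_components(1,2)[OF Y] 1 \<tau> by (intro add_mono mult_left_mono) auto
    also have "\<dots> \<le> B s"
      using X_norm_components(3)[OF Y] by (simp add: B_def algebra_simps)
    finally show ?case
      using X.nrm_nonneg[OF PX] by simp
  qed
qed

section \<open>Upper right derivatives of the quadratic and the potential energy\<close>

definition quot :: "real \<Rightarrow> real \<Rightarrow> real \<Rightarrow> real" where "quot t h = (1 / h) *\<^sub>R (u (t + h) - u t)"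

lemma quot_lim: "t \<ge> 0 \<Longrightarrow> ((\<lambda>h. L2_norm a b (quot t h - w t)) \<longlongrightarrow> 0) (at_right 0)"
  using tendsto_at_right_shift[OF u_deriv, of t] by (simp add: quot_def)

lemma quot_mem: "t \<ge> 0 \<Longrightarrow> h > 0 \<Longrightarrow> quot t h \<in> L2 a b"
  unfolding quot_def using uw_mem(2) by auto

text \<open>In \<open>Q (y t) (P t) - Q (y t) (y t)\<close> the gradient terms cancel, because
  \<open>P t\<close> and \<open>y t\<close> have the same first component, and so does the
  contribution of the summand \<open>w t\<close> in the second. What remains is the product of
  \<open>w\<close> with \<open>f(u) - g(u) w\<close>.\<close>

lemma kinetic_dini:
  assumes t: "t \<ge> 0" and "e > 0"
  shows "\<forall>\<^sub>F h in at_right 0. Q (y (t + h)) (y (t + h)) / 2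
    \<le> Q (y t) (y t) / 2 + h * (ip (w t) (fu t) - ip (w t) (gw t)) + e * h"
proof -
  from mild obtain S where gen: "generates_contraction_semigroup (X_space a b) (X_norm a b \<tau> \<epsilon>)
        (dom_A a b) (op_A a b \<tau> \<epsilon>) S"
    and int: "\<And>t. t \<ge> 0 \<Longrightarrow> has_riemann_integral (X_norm a b \<tau> \<epsilon>) (\<lambda>s. S (t - s) (P s)) (y t - S t y0) 0 t"
    by (auto simp: mild_solution_def P_eq)
  have nrm: "semi_inner.nrm (X_inner a b \<tau> \<epsilon>) = X_norm a b \<tau> \<epsilon>"
    by (simp add: fun_eq_iff X_norm_def semi_inner.nrm_def[OF X.semi_inner_axioms])
  have lim: "((\<lambda>s. X_norm a b \<tau> \<epsilon> (P s - P t)) \<longlongrightarrow> 0) (at_right t)"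
    using P_lim[OF t] by (rule tendsto_within_subset) (use t in auto)
  have "\<forall>\<^sub>F h in at_right 0. Q (y (t + h)) (y (t + h))
      \<le> Q (y t) (y t) + 2 * h * (Q (y t) (P t) - Q (y t) (y t)) + 2 * e * h"
    by (rule form_semigroup.mild_dini[OF form_semigroup_generated[OF gen], unfolded nrm, OF yX P_mem y0 int t lim])
       (use \<open>e > 0\<close> in auto)
  moreover have "Q (y t) (P t) - Q (y t) (y t) = ip (w t) (fu t) - ip (w t) (gw t)"
  proof -
    note m = uw_mem(3)[OF t] fu_L2[OF t] gw_L2[OF t]
    have "ip (w t) (w t + (1 / \<tau>) *\<^sub>R (fu t - gw t)) = ip (w t) (w t) + (1 / \<tau>) * (ip (w t) (fu t) - ip (w t) (gw t))"
      unfolding L2.add_right[OF m(1) L2.mem(4)[OF L2.mem(3)[OF m(2,3)]] m(1)] L2.scale_right[OF L2.mem(3)[OF m(2,3)] m(1)]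
        L2.diff_right[OF m(2,3,1)] ..
    then show ?thesis
      using \<tau> unfolding Q_def P_def by (simp add: distrib_left del: plus_fun_apply minus_apply)
  qed
  ultimately show ?thesis
    by (auto elim!: eventually_mono)
qed

text \<open>A Taylor expansion of \<open>F\<close> along
  \<open>u (t + h) - u t = h * quot t h\<close>; the quadratic remainder is
  \<open>O(h\<^sup>2)\<close> as the quotients stay bounded in L2. The term with \<open>fu\<close>
  cancels the one in \<open>kinetic_dini\<close>, so only the damping survives in the sum.\<close>

lemma potential_dini:
  assumes t: "t \<ge> 0" and "e > 0"
  shows "\<forall>\<^sub>F h in at_right 0. (LINT x|M. F (u (t + h) x)) \<le> (LINT x|M. F (u t x)) - h * ip (w t) (fu t) + e * h"
proof -
  obtain R where R: "R \<ge> 0" "AE x in M. \<bar>u t x\<bar> \<le> R"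
    by (rule u_bounded[OF t])
  \<comment> \<open>For small \<open>h\<close> the values \<open>u (t + h) x\<close> differ from
    \<open>u t x\<close> by at most 1, hence the radius \<open>R + 1\<close>.\<close>
  obtain L where L: "L \<ge> 0" "\<And>s. \<bar>s\<bar> \<le> R + 1 \<Longrightarrow> \<bar>f' s\<bar> \<le> L"
    using continuous_bounded_on_interval[OF f'_cont] by blast
  note fm = fu_L2[OF t] and wm = uw_mem(3)[OF t]
  define err where "err h = L2_norm a b (fu t) * L2_norm a b (quot t h - w t) + L * h * (L2_norm a b (quot t h))\<^sup>2" for h
  have qn: "((\<lambda>h. L2_norm a b (quot t h)) \<longlongrightarrow> L2_norm a b (w t)) (at_right 0)"
    using eventually_at_right_0_pos by (intro L2.tendsto_nrm[OF quot_lim[OF t]]) (auto elim!: eventually_mono simp: quot_mem t wm)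
  have "(err \<longlongrightarrow> L2_norm a b (fu t) * 0 + L * 0 * (L2_norm a b (w t))\<^sup>2) (at_right 0)"
    unfolding err_def by (intro tendsto_intros quot_lim[OF t] qn)
  then have "\<forall>\<^sub>F h in at_right 0. err h < e"
    using \<open>e > 0\<close> by (intro order_tendstoD(2)) auto
  moreover have "\<forall>\<^sub>F h in at_right 0. AE x in M. \<bar>u (t + h) x - u t x\<bar> \<le> 1"
    by (rule eventually_at_right_shift[OF u_uniform[OF t] t]) simp
  ultimately show ?thesis
    using eventually_at_right_0_pos
  proof eventually_elim
    case (elim h)
    have th: "t + h \<ge> 0" using t elim by simp
    note qm = quot_mem[OF t elim(3)]
    have "AE x in M. F (u (t + h) x) \<le> F (u t x) - h * (fu t x * quot t h x) + L * h\<^sup>2 * (quot t h x)\<^sup>2"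
      using R(2) elim(2)
    proof eventually_elim
      case (elim x)
      then have "\<bar>u t x\<bar> \<le> R + 1" "\<bar>u (t + h) x\<bar> \<le> R + 1" by linarith+
      from taylor_bound[OF F_deriv f_deriv L(2) this]
      have 1: "F (u (t + h) x) \<le> F (u t x) - f (u t x) * (u (t + h) x - u t x) + L * (u (t + h) x - u t x)\<^sup>2"
        by linarith
      have "u (t + h) x - u t x = h * quot t h x"
        using \<open>0 < h\<close> by (simp add: quot_def scaleR_fun_def)
      with 1 show ?case
        by (simp add: fu_def power_mult_distrib algebra_simps)
    qed
    then have "(LINT x|M. F (u (t + h) x)) \<le> (LINT x|M. F (u t x) - h * (fu t x * quot t h x) + L * h\<^sup>2 * (quot t h x)\<^sup>2)"
      using compose_L2[OF F_cont] th t fm qm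
      by (intro integral_mono_AE Bochner_Integration.integrable_add Bochner_Integration.integrable_diff
          integrable_mult_right L2_mult_integrable L2_square_integrable L2_integrable)
    also have "\<dots> = (LINT x|M. F (u t x)) - h * ip (fu t) (quot t h) + L * h\<^sup>2 * (LINT x|M. (quot t h x)\<^sup>2)"
      using L2_integrable[OF compose_L2[OF F_cont t]] L2_mult_integrable[OF fm qm] L2_square_integrable[OF qm]
      by (simp add: Bochner_Integration.integral_add Bochner_Integration.integral_diff)
    also have "(LINT x|M. (quot t h x)\<^sup>2) = (L2_norm a b (quot t h))\<^sup>2"
      by (rule L2_norm_power2[OF qm, symmetric])
    finally have 2: "(LINT x|M. F (u (t + h) x)) \<le> (LINT x|M. F (u t x)) - h * ip (fu t) (quot t h)
        + L * h\<^sup>2 * (L2_norm a b (quot t h))\<^sup>2" .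
    have "ip (fu t) (quot t h) = ip (fu t) (w t) + ip (fu t) (quot t h - w t)"
      unfolding L2.diff_right[OF qm wm fm] by simp
    then have "ip (fu t) (quot t h) \<ge> ip (w t) (fu t) - L2_norm a b (fu t) * L2_norm a b (quot t h - w t)"
      using L2.cauchy_schwarz[OF fm L2.mem(3)[OF qm wm]] L2.sym[OF fm wm] by linarith
    then have "h * ip (fu t) (quot t h) \<ge> h * (ip (w t) (fu t) - L2_norm a b (fu t) * L2_norm a b (quot t h - w t))"
      using elim(3) by (intro mult_left_mono) auto
    with 2 have "(LINT x|M. F (u (t + h) x)) \<le> (LINT x|M. F (u t x)) - h * ip (w t) (fu t) + h * err h"
      by (simp add: err_def power2_eq_square algebra_simps)
    also have "h * err h \<le> h * e"
      using elim by (intro mult_left_mono) auto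
    finally show ?case by (simp add: mult.commute)
  qed
qed

lemma energy_dini:
  assumes t: "t \<ge> 0" and "e > 0"
  shows "\<forall>\<^sub>F h in at_right 0. E (t + h) \<le> E t - h * (\<sigma> * (L2_norm a b (w t))\<^sup>2) + e * h"
proof -
  have e2: "e / 2 > 0" using \<open>e > 0\<close> by simp
  note wm = uw_mem(3)[OF t] and gm = gw_L2[OF t]
  have "(LINT x|M. \<sigma> * (w t x)\<^sup>2) \<le> ip (w t) (gw t)"
  proof (rule integral_mono)
    show "\<sigma> * (w t x)\<^sup>2 \<le> w t x * gw t x" for x
      using mult_right_mono[OF g_ge[of "u t x"], of "(w t x)\<^sup>2"] by (simp add: gw_def power2_eq_square algebra_simps)
  qed (use wm gm L2_square_integrable[OF wm] in auto)
  then have diss: "\<sigma> * (L2_norm a b (w t))\<^sup>2 \<le> ip (w t) (gw t)"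
    using L2_norm_power2[OF wm] by simp
  from kinetic_dini[OF t e2] potential_dini[OF t e2] eventually_at_right_0_pos show ?thesis
  proof eventually_elim
    case (elim h)
    have "h * (\<sigma> * (L2_norm a b (w t))\<^sup>2) \<le> h * ip (w t) (gw t)"
      using diss elim(3) by (intro mult_left_mono) auto
    with elim(1,2) show ?case
      by (simp add: E_def algebra_simps)
  qed
qed

section \<open>Continuity of distance and energy, and bounds along the solution\<close>

lemma L1_norm_lim:
  assumes v: "v \<in> L2 a b" and t: "t \<ge> 0"
  shows "((\<lambda>s. L1_norm a b (\<lambda>x. u s x - v x)) \<longlongrightarrow> L1_norm a b (\<lambda>x. u t x - v x)) (at t within {0..})"
proof -
  have lim: "((\<lambda>s. sqrt (b - a) * (X_norm a b \<tau> \<epsilon> (y s - y t) / sqrt \<tau>)) \<longlongrightarrow> sqrt (b - a) * (0 / sqrt \<tau>)) (at t within {0..})"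
    using \<tau> by (intro tendsto_intros y_lim[OF t]) auto
  then have lim: "((\<lambda>s. sqrt (b - a) * (X_norm a b \<tau> \<epsilon> (y s - y t) / sqrt \<tau>)) \<longlongrightarrow> 0) (at t within {0..})"
    by simp
  have "((\<lambda>s. L1_norm a b (\<lambda>x. u s x - v x) - L1_norm a b (\<lambda>x. u t x - v x)) \<longlongrightarrow> 0) (at t within {0..})"
  proof (rule Lim_null_comparison[OF _ lim])
    show "\<forall>\<^sub>F s in at t within {0..}. norm (L1_norm a b (\<lambda>x. u s x - v x) - L1_norm a b (\<lambda>x. u t x - v x))
      \<le> sqrt (b - a) * (X_norm a b \<tau> \<epsilon> (y s - y t) / sqrt \<tau>)"
      using eventually_within_nonneg
    proof eventually_elim
      case (elim s)
      note um = uw_mem(2)[OF elim] uw_mem(2)[OF t]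
      have int: "integrable M (\<lambda>x. \<bar>u s x - v x\<bar>)" "integrable M (\<lambda>x. \<bar>u t x - v x\<bar>)" "integrable M (\<lambda>x. \<bar>u s x - u t x\<bar>)"
        using um v by (auto intro!: integrable_abs[OF L2_integrable[OF L2_diff]])
      have "L1_norm a b (\<lambda>x. u s x - v x) - L1_norm a b (\<lambda>x. u t x - v x)
          = (LINT x|M. \<bar>u s x - v x\<bar> - \<bar>u t x - v x\<bar>)"
        unfolding L1_norm_def using int by simp
      then have "norm (L1_norm a b (\<lambda>x. u s x - v x) - L1_norm a b (\<lambda>x. u t x - v x))
          \<le> (LINT x|M. \<bar>\<bar>u s x - v x\<bar> - \<bar>u t x - v x\<bar>\<bar>)"
        by (simp add: integral_abs_bound)
      also have "\<dots> \<le> (LINT x|M. \<bar>u s x - u t x\<bar>)"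
        using int by (intro integral_mono) auto
      also have "\<dots> = L1_norm a b (u s - u t)" by (simp add: L1_norm_def)
      also have "\<dots> \<le> sqrt (b - a) * L2_norm a b (u s - u t)"
        using um by (intro L1_norm_le_L2_norm) auto
      also have "\<dots> \<le> sqrt (b - a) * (X_norm a b \<tau> \<epsilon> (y s - y t) / sqrt \<tau>)"
      proof (rule mult_left_mono)
        show "L2_norm a b (u s - u t) \<le> X_norm a b \<tau> \<epsilon> (y s - y t) / sqrt \<tau>"
          using X_norm_components(2)[OF X.mem(3)[OF yX[OF elim] yX[OF t]]] \<tau> by (simp add: field_simps)
      qed (use ab in simp)
      finally show ?case .
    qed
  qed
  then show ?thesis by (simp add: LIM_zero_iff)
qed

lemma E_lim:
  assumes t: "t \<ge> 0"
  shows "(E \<longlongrightarrow> E t) (at t within {0..})"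
proof -
  have "((\<lambda>s. Q (y s) (y s)) \<longlongrightarrow> Q (y t) (y t)) (at t within {0..})"
    by (intro X.tendsto_Q y_lim t yX eventually_mono[OF eventually_within_nonneg yX])
  moreover have "((\<lambda>s. LINT x|M. F (u s x)) \<longlongrightarrow> (LINT x|M. F (u t x))) (at t within {0..})"
  proof -
    have lim: "((\<lambda>s. sqrt (b - a) * L2_norm a b ((\<lambda>x. F (u s x)) - (\<lambda>x. F (u t x)))) \<longlongrightarrow> 0) (at t within {0..})"
      by (rule tendsto_mult_right_zero[OF compose_L2_lim[OF F_cont t]])
    have "((\<lambda>s. (LINT x|M. F (u s x)) - (LINT x|M. F (u t x))) \<longlongrightarrow> 0) (at t within {0..})"
    proof (rule Lim_null_comparison[OF _ lim])
      show "\<forall>\<^sub>F s in at t within {0..}. norm ((LINT x|M. F (u s x)) - (LINT x|M. F (u t x)))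
        \<le> sqrt (b - a) * L2_norm a b ((\<lambda>x. F (u s x)) - (\<lambda>x. F (u t x)))"
        using eventually_within_nonneg
      proof eventually_elim
        case (elim s)
        note Fm = compose_L2[OF F_cont elim] compose_L2[OF F_cont t]
        have "(LINT x|M. F (u s x)) - (LINT x|M. F (u t x)) = (LINT x|M. F (u s x) - F (u t x))"
          using Fm by (simp add: L2_integrable)
        then have "norm ((LINT x|M. F (u s x)) - (LINT x|M. F (u t x))) \<le> L1_norm a b ((\<lambda>x. F (u s x)) - (\<lambda>x. F (u t x)))"
          by (simp add: L1_norm_def integral_abs_bound)
        also have "\<dots> \<le> sqrt (b - a) * L2_norm a b ((\<lambda>x. F (u s x)) - (\<lambda>x. F (u t x)))"
          by (rule L1_norm_le_L2_norm[OF L2.mem(3)[OF Fm]])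
        finally show ?case .
      qed
    qed
    then show ?thesis by (simp add: LIM_zero_iff)
  qed
  ultimately show ?thesis
    unfolding E_def by (intro tendsto_intros) auto
qed

lemma energy_le:
  assumes "t \<ge> 0"
  shows "E t \<le> E 0"
proof (rule dini_nonincreasing[OF assms])
  show "continuous_on {0..t} E"
    by (rule continuous_on_IccI_nonneg[OF E_lim])
  fix r e :: real
  assume "0 \<le> r" "e > 0"
  from energy_dini[OF this] eventually_at_right_0_pos show "\<forall>\<^sub>F h in at_right 0. E (r + h) \<le> E r + e * h"
  proof eventually_elim
    case (elim h)
    have "0 \<le> h * (\<sigma> * (L2_norm a b (w r))\<^sup>2)" using elim \<sigma> by simp
    with elim show ?case by linarith
  qed
qed

text \<open>The weight \<open>\<mu>\<close> splits \<open>\<parallel>w\<parallel>\<close> in \<open>L\<^sub>1\<close> into \<open>\<mu>/2 \<parallel>w\<parallel>\<^sup>2 + (b - a)/(2 \<mu>)\<close>, so that the dissipated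
  energy bounds the distance travelled without integrating in time.\<close>

lemma distance_travelled:
  assumes t: "t \<ge> 0" and \<mu>: "\<mu> > 0"
  shows "L1_norm a b (\<lambda>x. u t x - u 0 x) \<le> \<mu> / (2 * \<sigma>) * (E 0 - E t) + (b - a) / (2 * \<mu>) * t"
proof -
  define N where "N r = L1_norm a b (\<lambda>x. u r x - u 0 x)" for r
  \<comment> \<open>The decrease of the energy pays for \<open>\<mu> / 2\<close> times the squared
    norm of \<open>w\<close>, the linear term for \<open>(b - a) / (2 * \<mu>)\<close>; so
    \<open>\<phi>\<close> is nonincreasing.\<close>
  define \<phi> where "\<phi> r = N r + \<mu> / (2 * \<sigma>) * E r - (b - a) / (2 * \<mu>) * r" for r
  have u0: "u 0 \<in> L2 a b" by (rule uw_mem) simp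
  have "\<phi> t \<le> \<phi> 0"
  proof (rule dini_nonincreasing[OF t])
    show "continuous_on {0..t} \<phi>"
      unfolding \<phi>_def N_def
      by (intro continuous_intros continuous_on_IccI_nonneg[OF L1_norm_lim[OF u0]] continuous_on_IccI_nonneg[OF E_lim])
    fix r e :: real
    assume r: "0 \<le> r" and "e > 0"
    \<comment> \<open>\<open>e1\<close> and \<open>e2\<close> are scaled to contribute
      \<open>e / 2\<close> each to the slope.\<close>
    define e1 where "e1 = e / (2 * (sqrt (b - a)))"
    define e2 where "e2 = e * \<sigma> / \<mu>"
    have e12: "e1 > 0" "e2 > 0" using \<open>e > 0\<close> ab \<sigma> \<mu> by (auto simp: e1_def e2_def)
    note wm = uw_mem(3)[OF r] and um = uw_mem(2)[OF r]
    have "\<forall>\<^sub>F h in at_right 0. L2_norm a b (quot r h - w r) < e1"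
      using e12 by (intro order_tendstoD(2)[OF quot_lim[OF r]])
    with energy_dini[OF r e12(2)] eventually_at_right_0_pos
    show "\<forall>\<^sub>F h in at_right 0. \<phi> (r + h) \<le> \<phi> r + e * h"
    proof eventually_elim
      case (elim h)
      note uh = uw_mem(2)[of "r + h"] and qm = quot_mem[OF r elim(2)]
      have uhm: "u (r + h) \<in> L2 a b" using uh r elim by simp
      have int: "integrable M (\<lambda>x. \<bar>u (r + h) x - u 0 x\<bar>)" "integrable M (\<lambda>x. \<bar>u r x - u 0 x\<bar>)"
        "integrable M (\<lambda>x. \<bar>u (r + h) x - u r x\<bar>)"
        using um uhm u0 by (auto intro!: integrable_abs[OF L2_integrable[OF L2_diff]])
      have "N (r + h) \<le> (LINT x|M. \<bar>u (r + h) x - u r x\<bar> + \<bar>u r x - u 0 x\<bar>)"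
        unfolding N_def L1_norm_def using int by (intro integral_mono) auto
      also have "\<dots> = L1_norm a b (u (r + h) - u r) + N r"
        using int by (simp add: N_def L1_norm_def)
      also have "L1_norm a b (u (r + h) - u r) \<le> sqrt (b - a) * L2_norm a b (u (r + h) - u r)"
        by (rule L1_norm_le_L2_norm[OF L2.mem(3)[OF uhm um]])
      also have "L2_norm a b (u (r + h) - u r) = h * L2_norm a b (quot r h)"
      proof -
        have "u (r + h) - u r = h *\<^sub>R quot r h" using elim(2) by (simp add: quot_def)
        then show ?thesis using L2.nrm_scale[OF qm, of h] elim(2) by simp
      qed
      finally have 1: "N (r + h) \<le> N r + h * (sqrt (b - a) * L2_norm a b (quot r h))"
        by (simp add: algebra_simps)
      have "L2_norm a b (quot r h) \<le> L2_norm a b (w r) + e1"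
        using L2.nrm_diff_ge[OF qm wm] elim(3) by linarith
      then have "sqrt (b - a) * L2_norm a b (quot r h) \<le> sqrt (b - a) * (L2_norm a b (w r) + e1)"
        using ab by (intro mult_left_mono) auto
      also have "\<dots> = sqrt (b - a) * L2_norm a b (w r) + e / 2"
        using ab by (simp add: e1_def distrib_left)
      also have "sqrt (b - a) * L2_norm a b (w r) \<le> \<mu> / 2 * (L2_norm a b (w r))\<^sup>2 + (b - a) / (2 * \<mu>)"
      proof -
        have "0 \<le> (\<mu> * L2_norm a b (w r) - sqrt (b - a))\<^sup>2 / (2 * \<mu>)"
          using \<mu> by simp
        also have "\<dots> = \<mu> / 2 * (L2_norm a b (w r))\<^sup>2 + (b - a) / (2 * \<mu>) - sqrt (b - a) * L2_norm a b (w r)"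
          using \<mu> ab by (simp add: power2_diff power_mult_distrib field_simps power2_eq_square)
        finally show ?thesis by simp
      qed
      finally have "h * (sqrt (b - a) * L2_norm a b (quot r h))
          \<le> h * (\<mu> / 2 * (L2_norm a b (w r))\<^sup>2 + (b - a) / (2 * \<mu>) + e / 2)"
        using elim(2) by (intro mult_left_mono) auto
      with 1 have 2: "N (r + h) \<le> N r + h * (\<mu> / 2 * (L2_norm a b (w r))\<^sup>2 + (b - a) / (2 * \<mu>) + e / 2)"
        by linarith
      have "\<mu> / (2 * \<sigma>) * E (r + h) \<le> \<mu> / (2 * \<sigma>) * (E r - h * (\<sigma> * (L2_norm a b (w r))\<^sup>2) + e2 * h)"
        using elim(1) \<mu> \<sigma> by (intro mult_left_mono) auto
      also have "\<dots> = \<mu> / (2 * \<sigma>) * E r - h * (\<mu> / 2 * (L2_norm a b (w r))\<^sup>2) + h * (e / 2)"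
        using \<mu> \<sigma> by (simp add: e2_def field_simps)
      finally have 3: "\<mu> / (2 * \<sigma>) * E (r + h) \<le> \<mu> / (2 * \<sigma>) * E r - h * (\<mu> / 2 * (L2_norm a b (w r))\<^sup>2) + h * (e / 2)" .
      have "\<phi> (r + h) \<le> (N r + h * (\<mu> / 2 * (L2_norm a b (w r))\<^sup>2 + (b - a) / (2 * \<mu>) + e / 2))
          + (\<mu> / (2 * \<sigma>) * E r - h * (\<mu> / 2 * (L2_norm a b (w r))\<^sup>2) + h * (e / 2)) - (b - a) / (2 * \<mu>) * (r + h)"
        unfolding \<phi>_def using 2 3 by linarith
      also have "\<dots> = \<phi> r + e * h"
        by (simp add: \<phi>_def algebra_simps add_divide_distrib diff_divide_distrib)
      finally show ?case .
    qed
  qed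
  moreover have "N 0 = 0" by (simp add: N_def L1_norm_def)
  ultimately show ?thesis
    by (simp add: \<phi>_def N_def algebra_simps)
qed

text \<open>A tagged division of \<open>{0..0}\<close> consists of subsets of \<open>{0}\<close>, so
  all Riemann sums vanish and \<open>y 0\<close> agrees with \<open>S 0 y0\<close> up to norm zero.
  This is why the initial data are recovered only almost everywhere.\<close>

lemma initial_distance: "X_norm a b \<tau> \<epsilon> (y 0 - y0) = 0"
proof -
  from mild obtain S where gen: "generates_contraction_semigroup (X_space a b) (X_norm a b \<tau> \<epsilon>)
        (dom_A a b) (op_A a b \<tau> \<epsilon>) S"
    and int: "has_riemann_integral (X_norm a b \<tau> \<epsilon>) (\<lambda>s. S (0 - s) (P s)) (y 0 - S 0 y0) 0 0"
    by (auto simp: mild_solution_def P_eq)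
  have S: "S 0 y0 \<in> X_space a b" "X_norm a b \<tau> \<epsilon> (S 0 y0 - y0) = 0"
    using gen y0 by (auto simp: generates_contraction_semigroup_def contraction_semigroup_def)
  have Y: "y 0 \<in> X_space a b" by (rule yX) simp
  have "X_norm a b \<tau> \<epsilon> (y 0 - S 0 y0) \<le> 0 + e" if "e > 0" for e
  proof -
    from int[unfolded has_riemann_integral_def, rule_format, OF that] obtain d where
      d: "d > 0" "\<And>p. p tagged_division_of {0..0} \<Longrightarrow> (\<lambda>r. ball r d) fine p \<Longrightarrow>
        X_norm a b \<tau> \<epsilon> ((\<Sum>(r, K)\<in>p. measure lborel K *\<^sub>R S (0 - r) (P r)) - (y 0 - S 0 y0)) < e"
      by blast
    obtain p where p: "p tagged_division_of {0..0::real}" "(\<lambda>r. ball r d) fine p"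
      using fine_division_exists_real[OF gauge_ball[OF d(1)]] by blast
    have "(\<Sum>(r, K)\<in>p. measure lborel K *\<^sub>R S (0 - r) (P r)) = 0"
    proof (rule sum.neutral, rule ballI)
      fix z
      assume "z \<in> p"
      then have "snd z \<subseteq> {0..0}"
        using tagged_division_ofD(3)[OF p(1), of "fst z" "snd z"] by simp
      then have "snd z = {} \<or> snd z = {0}" by auto
      then show "(case z of (r, K) \<Rightarrow> measure lborel K *\<^sub>R S (0 - r) (P r)) = 0"
        by (cases z) auto
    qed
    with d(2)[OF p] have "X_norm a b \<tau> \<epsilon> (0 - (y 0 - S 0 y0)) < e"
      by simp
    moreover have "X_norm a b \<tau> \<epsilon> (0 - (y 0 - S 0 y0)) = X_norm a b \<tau> \<epsilon> (y 0 - S 0 y0)"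
      using X.nrm_minus[of 0 "y 0 - S 0 y0"] X.mem(3)[OF Y S(1)] by simp
    ultimately show ?thesis by simp
  qed
  then have "X_norm a b \<tau> \<epsilon> (y 0 - S 0 y0) \<le> 0" by (rule field_le_epsilon)
  with X.nrm_diff_triangle[OF Y S(1) y0] S(2) X.nrm_nonneg[OF X.mem(3)[OF Y y0]]
  show ?thesis by simp
qed

lemma initial_AE: "AE x in M. u 0 x = fst y0 x"
proof -
  note Z = X.mem(3)[OF yX[of 0] y0]
  have "sqrt \<tau> * L2_norm a b (u 0 - fst y0) \<le> 0"
    using X_norm_components(2)[OF Z] initial_distance by simp
  then have "L2_norm a b (u 0 - fst y0) \<le> 0"
    using \<tau> by (simp add: mult_le_0_iff)
  moreover have m: "u 0 - fst y0 \<in> L2 a b" using X_spaceD(2)[OF Z] by simp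
  ultimately have "L2_norm a b (u 0 - fst y0) = 0"
    using L2.nrm_nonneg[OF m] by simp
  from L2_norm_eq_0_AE[OF m this] show ?thesis by eventually_elim simp
qed

lemma initial_energy: "E 0 = Q y0 y0 / 2 + (LINT x|M. F (fst y0 x))"
proof -
  have "X.Q.nrm (y 0) = X.Q.nrm y0"
    using X.Q.nrm_diff_ge[OF yX[of 0] y0] X.Q_nrm_le[OF X.mem(3)[OF yX[of 0] y0]] initial_distance by simp
  then have "Q (y 0) (y 0) = Q y0 y0"
    by (metis X.Q.nrm_sq yX y0 order_refl)
  moreover have "(LINT x|M. F (u 0 x)) = (LINT x|M. F (fst y0 x))"
  proof (rule integral_cong_AE)
    show "(\<lambda>x. F (u 0 x)) \<in> borel_measurable M" by (rule compose_measurable[OF F_cont]) simp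
    show "(\<lambda>x. F (fst y0 x)) \<in> borel_measurable M"
      by (rule measurable_compose[OF L2_measurable[OF X_spaceD(2)[OF y0]] borel_measurable_continuous_onI[OF F_cont]])
    show "AE x in M. F (u 0 x) = F (fst y0 x)"
      using initial_AE by eventually_elim simp
  qed
  ultimately show ?thesis by (simp add: E_def)
qed

end

subsection \<open>Lower bound for the energy near a step function\<close>

lemma antiderivative_on_reals:
  fixes h :: "real \<Rightarrow> real"
  assumes "continuous_on UNIV h"
  obtains H where "\<And>s. (H has_real_derivative h s) (at s)"
proof -
  have "\<exists>H. \<forall>x::real. (-\<infinity>::ereal) < x \<longrightarrow> x < (\<infinity>::ereal) \<longrightarrow> (H has_vector_derivative h x) (at x)"
    by (rule einterval_antiderivative) (use assms in \<open>auto simp: continuous_on_eq_continuous_at\<close>)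
  then show thesis
    using that by (auto simp: has_real_derivative_iff_has_vector_derivative)
qed

lemma mean_value_abs:
  fixes H h :: "real \<Rightarrow> real"
  assumes "\<And>s. (H has_real_derivative h s) (at s)"
  obtains z where "\<bar>z - c\<bar> \<le> \<bar>s - c\<bar>" "\<bar>H s - H c\<bar> = \<bar>s - c\<bar> * \<bar>h z\<bar>"
proof (cases "s = c")
  case True
  then show thesis using that[of c] by simp
next
  case False
  then consider "s < c" | "c < s" by linarith
  then show thesis
  proof cases
    case 1
    from MVT2[OF 1, of H h] assms obtain z where "s < z" "z < c" "H c - H s = (c - s) * h z" by auto
    then show thesis using that[of z] 1 by (simp add: abs_mult abs_minus_commute)
  next
    case 2
    from MVT2[OF 2, of H h] assms obtain z where "c < z" "z < s" "H s - H c = (s - c) * h z" by auto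
    then show thesis using that[of z] 2 by (simp add: abs_mult)
  qed
qed

text \<open>Growth at infinity yields a global minimum. It is a critical point with value at most
  \<open>F c = 0\<close>, so \<open>crit\<close> makes the minimum value zero.\<close>

lemma nonneg_if_critical_points_nonneg:
  fixes F :: "real \<Rightarrow> real"
  assumes F: "\<And>s. (F has_real_derivative F' s) (at s)" and "filterlim F at_top at_infinity"
    and "F c = 0" and crit: "\<And>s. F' s = 0 \<Longrightarrow> F s \<le> 0 \<Longrightarrow> F s = 0"
  shows "F s \<ge> 0"
proof -
  have "\<forall>\<^sub>F s in at_infinity. 1 \<le> F s"
    using assms(2) by (simp add: filterlim_at_top)
  then obtain R where R: "\<And>s. R \<le> \<bar>s\<bar> \<Longrightarrow> 1 \<le> F s"
    by (auto simp: eventually_at_infinity)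
  define R' where "R' = max R \<bar>c\<bar>"
  have "continuous_on {- R'..R'} F"
    using F by (intro continuous_at_imp_continuous_on) (auto intro: DERIV_isCont)
  moreover have "{- R'..R'} \<noteq> {}" by (auto simp: R'_def max_def)
  ultimately obtain z where z: "z \<in> {- R'..R'}" "\<And>s. s \<in> {- R'..R'} \<Longrightarrow> F z \<le> F s"
    using continuous_attains_inf[of "{- R'..R'}" F] by auto
  have zc: "F z \<le> 0"
  proof -
    have "\<bar>c\<bar> \<le> R'" by (simp add: R'_def)
    then have "c \<in> {- R'..R'}" by auto
    from z(2)[OF this] \<open>F c = 0\<close> show ?thesis by simp
  qed
  have min: "F z \<le> F s" for s
  proof (cases "s \<in> {- R'..R'}")
    case False
    then have "R \<le> \<bar>s\<bar>" by (auto simp: R'_def)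
    from R[OF this] zc show ?thesis by simp
  qed (rule z(2))
  have "F' z = 0"
    by (rule DERIV_local_min[OF F, of 1]) (use min in auto)
  with crit zc have "F z = 0" by simp
  with min show ?thesis by simp
qed

context interval
begin

text \<open>\<open>H\<close> is composed with a function that is only absolutely continuous.
  Replacing \<open>w\<close> by test functions \<open>\<psi> n\<close> gives the classical
  fundamental theorem. As \<open>prim (\<psi> n)\<close> converges uniformly, the factors with
  \<open>h\<close> converge in L2 by dominated convergence, and the product passes to the
  limit.\<close>

lemma chain_rule_prim:
  assumes H: "\<And>s. (H has_real_derivative h s) (at s)" and h: "continuous_on UNIV h"
    and w: "w \<in> L2 a b" and pq: "a \<le> p" "p \<le> q" "q \<le> b"
  shows "(LINT x|M. indicator {p<..<q} x * h (k + prim w x) * w x) = H (k + prim w q) - H (k + prim w p)"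
proof -
  define U where "U x = k + prim w x" for x
  have "\<exists>\<psi>\<in>test_functions a b. L2_norm a b (\<psi> - w) < 1 / (real n + 1)" for n
    by (rule test_functions_dense[OF w]) simp
  then obtain \<psi> where \<psi>: "\<And>n. \<psi> n \<in> test_functions a b" "\<And>n. L2_norm a b (\<psi> n - w) < 1 / (real n + 1)"
    by metis
  note \<psi>L = test_functions_L2[OF \<psi>(1)]
  have inv0: "(\<lambda>n. 1 / (real n + 1)) \<longlonglongrightarrow> 0"
    using LIMSEQ_inverse_real_of_nat by (simp add: inverse_eq_divide add.commute)
  have \<psi>0: "(\<lambda>n. L2_norm a b (\<psi> n - w)) \<longlonglongrightarrow> 0"
  proof (rule Lim_null_comparison[OF _ inv0])
    show "\<forall>\<^sub>F n in sequentially. norm (L2_norm a b (\<psi> n - w)) \<le> 1 / (real n + 1)"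
      using \<psi>(2) L2.nrm_nonneg[OF L2.mem(3)[OF \<psi>L w]] by (auto intro!: always_eventually less_imp_le)
  qed
  define V where "V n x = k + prim (\<psi> n) x" for n x
  have VU: "\<bar>V n x - U x\<bar> \<le> sqrt (b - a) * L2_norm a b (\<psi> n - w)" if "x \<in> {a..b}" for n x
    using prim_bound[OF L2.mem(3)[OF \<psi>L w] that] by (simp add: V_def U_def prim_diff[OF \<psi>L w])
  have Vlim: "(\<lambda>n. V n x) \<longlonglongrightarrow> U x" if "x \<in> {a..b}" for x
  proof -
    have "(\<lambda>n. V n x - U x) \<longlonglongrightarrow> 0"
      by (rule Lim_null_comparison[OF _ tendsto_mult_right_zero[OF \<psi>0, of "sqrt (b - a)"]])
         (use VU[OF that] in auto)
    then show ?thesis by (simp add: LIM_zero_iff)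
  qed
  \<comment> \<open>A common bound for \<open>U\<close> and all \<open>V n\<close>, as the norm of
    \<open>\<psi> n - w\<close> is at most 1; on this range \<open>h\<close> is bounded.\<close>
  define R where "R = \<bar>k\<bar> + sqrt (b - a) * L2_norm a b w + sqrt (b - a)"
  have UR: "\<bar>U x\<bar> \<le> R" and VR: "\<bar>V n x\<bar> \<le> R" if "x \<in> {a..b}" for n x
  proof -
    have "1 / (real n + 1) \<le> 1" by simp
    then have "L2_norm a b (\<psi> n - w) \<le> 1" using \<psi>(2)[of n] by linarith
    then have "sqrt (b - a) * L2_norm a b (\<psi> n - w) \<le> sqrt (b - a) * 1"
      using ab by (intro mult_left_mono) auto
    moreover have "sqrt (b - a) \<ge> 0" using ab by simp
    ultimately show "\<bar>U x\<bar> \<le> R" "\<bar>V n x\<bar> \<le> R"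
      using prim_bound[OF w that] VU[OF that, of n] unfolding U_def R_def by linarith+
  qed
  obtain C where C: "C \<ge> 0" "\<And>s. \<bar>s\<bar> \<le> R \<Longrightarrow> \<bar>h s\<bar> \<le> C"
    using continuous_bounded_on_interval[OF h] by blast
  have cU: "continuous_on {a..b} U" and cV: "continuous_on {a..b} (V n)" for n
    unfolding U_def V_def by (intro continuous_intros prim_continuous w \<psi>L)+
  define I where "I = (indicator {p<..<q} :: real \<Rightarrow> real)"
  have Im: "I \<in> borel_measurable M"
    unfolding I_def by (intro L2_measurable indicator_L2) auto
  have I1: "\<bar>I x\<bar> \<le> 1" for x by (simp add: I_def indicator_def)
  have hL2: "(\<lambda>x. I x * h (V' x)) \<in> L2 a b" if "continuous_on {a..b} V'" for V'
  proof (rule L2_mult_bounded[of _ _ 1])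
    show "(\<lambda>x. h (V' x)) \<in> L2 a b"
      by (rule continuous_L2) (rule continuous_on_compose2[OF h that], simp)
  qed (use Im I1 in auto)
  define A where "A = (\<lambda>x. I x * h (U x))"
  define B where "B n = (\<lambda>x. I x * h (V n x))" for n
  have AL: "A \<in> L2 a b" and BL: "B n \<in> L2 a b" for n
    unfolding A_def B_def using hL2 cU cV by auto
  have "(\<lambda>n. L2_norm a b (\<lambda>x. B n x - A x)) \<longlonglongrightarrow> 0"
  proof (rule L2_norm_dominated_convergence[OF L2_const[of "2 * C"]])
    show "AE x in M. \<bar>B n x - A x\<bar> \<le> \<bar>2 * C\<bar>" for n
    proof (rule AE_I2)
      fix x
      assume "x \<in> space M"
      then have x: "x \<in> {a..b}" by auto
      have "\<bar>B n x - A x\<bar> = \<bar>I x\<bar> * \<bar>h (V n x) - h (U x)\<bar>"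
        by (simp add: A_def B_def abs_mult flip: right_diff_distrib)
      also have "\<dots> \<le> 1 * \<bar>h (V n x) - h (U x)\<bar>"
        using I1 by (intro mult_right_mono) auto
      also have "\<dots> \<le> \<bar>2 * C\<bar>"
        using C(2)[OF UR[OF x]] C(2)[OF VR[OF x, of n]] C(1)
          abs_triangle_ineq4[of "h (V n x)" "h (U x)"] by simp
      finally show "\<bar>B n x - A x\<bar> \<le> \<bar>2 * C\<bar>" .
    qed
    show "AE x in M. (\<lambda>n. B n x) \<longlonglongrightarrow> A x"
    proof (rule AE_I2)
      fix x
      assume "x \<in> space M"
      then have x: "x \<in> {a..b}" by auto
      have "isCont h (U x)" using h by (simp add: continuous_on_eq_continuous_at)
      from isCont_tendsto_compose[OF this Vlim[OF x]] show "(\<lambda>n. B n x) \<longlonglongrightarrow> A x"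
        unfolding A_def B_def by (intro tendsto_intros)
    qed
  qed (use AL BL L2_measurable in auto)
  then have BA: "(\<lambda>n. L2_norm a b (B n - A)) \<longlonglongrightarrow> 0"
    by (simp add: fun_diff_def)
  have eq: "ip (B n) (\<psi> n) = H (V n q) - H (V n p)" for n
  proof -
    from \<psi>(1)[of n] obtain \<Psi> where \<Psi>: "\<And>x. (\<Psi> has_real_derivative \<psi> n x) (at x)" "\<And>x. x \<in> {a..b} \<Longrightarrow> \<Psi> x = prim (\<psi> n) x"
      by (rule test_function_primitive) blast
    have c\<psi>: "continuous_on UNIV (\<psi> n)"
      using \<psi>(1) by (rule test_functionsE)
    have c\<Psi>: "continuous_on UNIV \<Psi>"
      using \<Psi>(1) by (intro continuous_at_imp_continuous_on) (auto intro: DERIV_isCont)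
    have der: "((\<lambda>x. H (k + \<Psi> x)) has_real_derivative h (k + \<Psi> x) * \<psi> n x) (at x)" for x
      by (rule DERIV_chain2[OF H]) (auto intro!: derivative_eq_intros \<Psi>)
    have cont: "continuous_on UNIV (\<lambda>x. h (k + \<Psi> x) * \<psi> n x)"
      by (intro continuous_intros continuous_on_compose2[OF h] c\<psi> c\<Psi>) auto
    have "ip (B n) (\<psi> n) = (LINT x|M. indicator {p<..<q} x * (h (k + \<Psi> x) * \<psi> n x))"
      by (rule Bochner_Integration.integral_cong) (auto simp: B_def I_def V_def \<Psi>(2))
    also have "\<dots> = H (k + \<Psi> q) - H (k + \<Psi> p)"
      by (rule integral_FTC[OF der cont pq])
    also have "\<dots> = H (V n q) - H (V n p)"
      using pq by (simp add: V_def \<Psi>(2))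
    finally show ?thesis .
  qed
  have Hc: "isCont H s" for s using H by (rule DERIV_isCont)
  have rhs: "(\<lambda>n. ip (B n) (\<psi> n)) \<longlonglongrightarrow> H (U q) - H (U p)"
    unfolding eq using pq by (intro tendsto_intros isCont_tendsto_compose[OF Hc] Vlim) auto
  have "(\<lambda>n. ip (B n) (\<psi> n) - ip A w) \<longlonglongrightarrow> 0"
  proof (rule Lim_null_comparison)
    have \<psi>n: "(\<lambda>n. L2_norm a b (\<psi> n)) \<longlonglongrightarrow> L2_norm a b w"
      by (rule L2.tendsto_nrm[OF \<psi>0]) (use \<psi>L w in auto)
    have "(\<lambda>n. L2_norm a b (B n - A) * L2_norm a b (\<psi> n) + L2_norm a b A * L2_norm a b (\<psi> n - w))
        \<longlonglongrightarrow> 0 * L2_norm a b w + L2_norm a b A * 0"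
      by (intro tendsto_intros BA \<psi>n \<psi>0)
    then show "(\<lambda>n. L2_norm a b (B n - A) * L2_norm a b (\<psi> n) + L2_norm a b A * L2_norm a b (\<psi> n - w)) \<longlonglongrightarrow> 0"
      by simp
    have "norm (ip (B n) (\<psi> n) - ip A w) \<le> L2_norm a b (B n - A) * L2_norm a b (\<psi> n) + L2_norm a b A * L2_norm a b (\<psi> n - w)" for n
      using L2.cauchy_schwarz[OF L2.mem(3)[OF BL[of n] AL] \<psi>L[of n]] L2.cauchy_schwarz[OF AL L2.mem(3)[OF \<psi>L[of n] w]]
        L2.diff_left[OF BL[of n] AL \<psi>L[of n]] L2.diff_right[OF \<psi>L[of n] w AL] unfolding real_norm_def by linarith
    then show "\<forall>\<^sub>F n in sequentially. norm (ip (B n) (\<psi> n) - ip A w)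
        \<le> L2_norm a b (B n - A) * L2_norm a b (\<psi> n) + L2_norm a b A * L2_norm a b (\<psi> n - w)"
      by simp
  qed
  then have "(\<lambda>n. ip (B n) (\<psi> n)) \<longlonglongrightarrow> ip A w"
    by (simp add: LIM_zero_iff)
  from LIMSEQ_unique[OF this rhs] show ?thesis
    by (simp add: A_def I_def U_def)
qed

end

section \<open>The double-well potential and the cost of a transition\<close>

locale double_well = interval +
  fixes F F1 F2 :: "real \<Rightarrow> real"
  assumes F1: "\<And>s. (F has_real_derivative F1 s) (at s)" and F2: "\<And>s. (F1 has_real_derivative F2 s) (at s)"
    and F2_cont: "continuous_on UNIV F2" and F_nonneg: "\<And>s. F s \<ge> 0"
    and wells: "F (-1) = 0" "F 1 = 0" "F1 (-1) = 0" "F1 1 = 0" "F2 (-1) > 0" "F2 1 > 0"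
begin

lemma F_cont: "continuous_on UNIV F"
  using F1 by (auto intro!: continuous_at_imp_continuous_on DERIV_isCont)

text \<open>The Modica-Mortola weight: for every positive \<epsilon>,
  \<open>\<epsilon> / 2 * p\<^sup>2 + F s / \<epsilon>\<close> is at least
  \<open>h s * \<bar>p\<bar>\<close> by the arithmetic-geometric mean inequality.\<close>

definition h :: "real \<Rightarrow> real" where "h s = sqrt (2 * F s)"

lemma h_cont: "continuous_on UNIV h"
  unfolding h_def by (intro continuous_intros F_cont)

lemma h_nonneg: "h s \<ge> 0"
  by (simp add: h_def F_nonneg)

definition H :: "real \<Rightarrow> real" where "H = (SOME H. \<forall>s. (H has_real_derivative h s) (at s))"

lemma H_deriv: "(H has_real_derivative h s) (at s)"
proof -
  have "\<exists>H. \<forall>s. (H has_real_derivative h s) (at s)"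
    using antiderivative_on_reals[OF h_cont] by metis
  from someI_ex[OF this] show ?thesis by (simp add: H_def)
qed

text \<open>The absolute value makes this the cost of a transition in either direction; the choice
  of the antiderivative \<open>H\<close> drops out.\<close>

definition c0 :: real where "c0 = \<bar>H 1 - H (-1)\<bar>"

lemma c0_eq: "sqrt 2 * (LINT s|lebesgue_on {-1..1}. sqrt (F s)) = c0"
proof -
  have "continuous_on {-1..1} (\<lambda>s. sqrt (F s))"
    by (intro continuous_intros continuous_on_subset[OF F_cont]) auto
  then have "integrable (lebesgue_on {-1..1}) (\<lambda>s. sqrt (F s))"
    by (rule continuous_imp_integrable_real)
  then have "(LINT s|lebesgue_on {-1..1}. sqrt (F s)) = integral {-1..1} (\<lambda>s. sqrt (F s))"
    by (rule lebesgue_integral_eq_integral) auto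
  then have "sqrt 2 * (LINT s|lebesgue_on {-1..1}. sqrt (F s)) = integral {-1..1} h"
    by (simp add: h_def[abs_def] real_sqrt_mult)
  also have "\<dots> = H 1 - H (-1)"
    using H_deriv by (intro integral_unique fundamental_theorem_of_calculus)
      (auto simp: has_real_derivative_iff_has_vector_derivative intro: has_vector_derivative_at_within)
  also have "\<dots> = c0"
  proof -
    have "H (-1) \<le> H 1"
      by (rule DERIV_nonneg_imp_nondecreasing) (use H_deriv h_nonneg in auto)
    then show ?thesis by (simp add: c0_def)
  qed
  finally show ?thesis .
qed

text \<open>Near a nondegenerate zero, \<open>F\<close> lies between multiples of
  \<open>(s - c)\<^sup>2\<close>, so \<open>h\<close> grows at most linearly and \<open>H\<close>
  departs from \<open>H c\<close> at most quadratically, that is, by a multiple of \<open>F\<close>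
  itself. This bound, linear in \<open>F\<close>, gives a full power of \<epsilon> per induction
  step in \<open>windows_lower_bound\<close>.\<close>

lemma well_deficiency:
  assumes c: "F c = 0" "F1 c = 0" "F2 c > 0"
  obtains \<eta> K where "\<eta> > 0" "K > 0" "\<And>s. \<bar>s - c\<bar> < \<eta> \<Longrightarrow> \<bar>H s - H c\<bar> \<le> K * F s"
proof -
  define \<mu> where "\<mu> = F2 c"
  have "isCont F2 c" using F2_cont by (simp add: continuous_on_eq_continuous_at)
  then obtain \<eta> where \<eta>: "\<eta> > 0" "\<And>s. \<bar>s - c\<bar> < \<eta> \<Longrightarrow> \<bar>F2 s - F2 c\<bar> < \<mu> / 2"
    using c(3) unfolding continuous_at_eps_delta by (metis half_gt_zero \<mu>_def dist_real_def)
  have bounds: "\<mu> / 4 * (s - c)\<^sup>2 \<le> F s \<and> F s \<le> \<mu> * (s - c)\<^sup>2" if s: "\<bar>s - c\<bar> < \<eta>" for s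
  proof (cases "s = c")
    case False
    define diff where "diff m = (if m = 0 then F else if m = 1 then F1 else F2)" for m :: nat
    have "\<exists>t. (if s < c then s < t \<and> t < c else c < t \<and> t < s) \<and>
        F s = (\<Sum>m<2. (diff m c / fact m) * (s - c) ^ m) + (diff 2 t / fact 2) * (s - c) ^ 2"
      by (rule Taylor[where a = "min s c" and b = "max s c"])
         (use False F1 F2 in \<open>auto simp: diff_def less_2_cases_iff\<close>)
    then obtain t where t0: "if s < c then s < t \<and> t < c else c < t \<and> t < s"
      and t1: "F s = (\<Sum>m<2. (diff m c / fact m) * (s - c) ^ m) + (diff 2 t / fact 2) * (s - c) ^ 2"
      by blast
    have t: "\<bar>t - c\<bar> < \<eta>" using t0 s by (auto split: if_splits)
    from t1 have Fs: "F s = F2 t / 2 * (s - c)\<^sup>2"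
      using c by (simp add: diff_def numeral_2_eq_2)
    have "\<mu> / 4 \<le> F2 t / 2" "F2 t / 2 \<le> \<mu>"
      using \<eta>(2)[OF t] c unfolding \<mu>_def by linarith+
    then show ?thesis
      unfolding Fs by (intro conjI mult_right_mono) simp_all
  qed (use c in auto)
  \<comment> \<open>\<open>sqrt (2 * \<mu>)\<close> is the growth rate of \<open>h\<close>, from the
    upper bound on \<open>F\<close>; \<open>4 / \<mu>\<close> comes from the lower bound.\<close>
  define K where "K = sqrt (2 * \<mu>) * (4 / \<mu>)"
  have \<mu>: "\<mu> > 0" using c by (simp add: \<mu>_def)
  have "\<bar>H s - H c\<bar> \<le> K * F s" if s: "\<bar>s - c\<bar> < \<eta>" for s
  proof -
    obtain z where z: "\<bar>z - c\<bar> \<le> \<bar>s - c\<bar>" "\<bar>H s - H c\<bar> = \<bar>s - c\<bar> * \<bar>h z\<bar>"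
      using mean_value_abs[of H h c s] H_deriv by blast
    have "h z \<le> sqrt (2 * (\<mu> * (z - c)\<^sup>2))"
      unfolding h_def using bounds[of z] z s by simp
    also have "\<dots> = sqrt (2 * \<mu>) * \<bar>z - c\<bar>"
      by (simp add: real_sqrt_mult)
    also have "\<dots> \<le> sqrt (2 * \<mu>) * \<bar>s - c\<bar>"
      using z \<mu> by (intro mult_left_mono) auto
    finally have "\<bar>h z\<bar> \<le> sqrt (2 * \<mu>) * \<bar>s - c\<bar>" using h_nonneg by simp
    then have "\<bar>H s - H c\<bar> \<le> \<bar>s - c\<bar> * (sqrt (2 * \<mu>) * \<bar>s - c\<bar>)"
      unfolding z(2) by (intro mult_left_mono) auto
    also have "\<dots> = K * (\<mu> / 4 * (s - c)\<^sup>2)"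
      using \<mu> by (simp add: K_def power2_eq_square abs_mult_self_eq flip: abs_mult)
    also have "\<dots> \<le> K * F s"
      using bounds[OF s] \<mu> by (intro mult_left_mono) (auto simp: K_def)
    finally show ?thesis .
  qed
  moreover have "K > 0" using \<mu> by (simp add: K_def)
  ultimately show thesis using that \<eta>(1) by blast
qed

text \<open>The energy density of the theorem without its nonnegative kinetic term, so that a lower
  bound for it is one for the full energy.\<close>

definition density :: "real \<Rightarrow> (real \<Rightarrow> real) \<Rightarrow> real \<Rightarrow> real"
  where "density \<epsilon> u x = \<epsilon> / 2 * (wderiv a b u x)\<^sup>2 + F (u x) / \<epsilon>"

definition Eint :: "real \<Rightarrow> (real \<Rightarrow> real) \<Rightarrow> real set \<Rightarrow> real"
  where "Eint \<epsilon> u A = (LINT x|M. indicator A x * density \<epsilon> u x)"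

lemma H1_bounded: "u \<in> H1 a b \<Longrightarrow> \<exists>R. AE x in M. \<bar>u x\<bar> \<le> R"
  using H1_sup_bound by blast

lemma F_comp_L2:
  assumes "u \<in> H1 a b"
  shows "(\<lambda>x. F (u x)) \<in> L2 a b"
proof -
  obtain R where R: "AE x in M. \<bar>u x\<bar> \<le> R" using H1_bounded[OF assms] by blast
  obtain C where C: "\<And>s. \<bar>s\<bar> \<le> R \<Longrightarrow> \<bar>F s\<bar> \<le> C"
    using continuous_bounded_on_interval[OF F_cont] by blast
  have "AE x in M. \<bar>F (u x)\<bar> \<le> C" using R by eventually_elim (rule C)
  moreover have "(\<lambda>x. F (u x)) \<in> borel_measurable M"
    by (rule measurable_compose[OF L2_measurable[OF H1D(1)[OF assms]] borel_measurable_continuous_onI[OF F_cont]])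
  ultimately show ?thesis by (rule L2_I_bounded[rotated])
qed

lemma density_integrable: "u \<in> H1 a b \<Longrightarrow> integrable M (density \<epsilon> u)"
  unfolding density_def
  by (intro Bochner_Integration.integrable_add integrable_mult_right integrable_divide L2_square_integrable H1D
      L2_integrable F_comp_L2)

lemma density_nonneg: "\<epsilon> > 0 \<Longrightarrow> density \<epsilon> u x \<ge> 0"
  by (simp add: density_def F_nonneg)

lemma restricted_density_integrable:
  assumes "u \<in> H1 a b" "A \<in> sets borel"
  shows "integrable M (\<lambda>x. indicator A x * density \<epsilon> u x)"
proof (rule Bochner_Integration.integrable_bound[OF density_integrable[OF assms(1), of \<epsilon>]])
  show "(\<lambda>x. indicator A x * density \<epsilon> u x) \<in> borel_measurable M"
    by (rule borel_measurable_times[OF L2_measurable[OF indicator_L2[OF assms(2)]]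
          borel_measurable_integrable[OF density_integrable[OF assms(1)]]])
qed (auto simp: indicator_def)

lemma Eint_mono:
  assumes "u \<in> H1 a b" "A \<in> sets borel" "B \<in> sets borel" "A \<subseteq> B" "\<epsilon> > 0"
  shows "Eint \<epsilon> u A \<le> Eint \<epsilon> u B"
  unfolding Eint_def
  by (rule integral_mono)
     (use assms density_nonneg restricted_density_integrable in \<open>auto simp: indicator_def\<close>)

text \<open>The pointwise inequality between \<open>h (u x) * \<bar>w x\<bar>\<close> and the
  density is integrated, and the chain rule evaluates the integral of \<open>h\<close> along the
  continuous representative.\<close>

lemma modica_mortola:
  assumes u: "u \<in> H1 a b" and \<epsilon>: "\<epsilon> > 0" and rep: "AE x in M. u x = k + prim (wderiv a b u) x"
    and pq: "a \<le> p" "p \<le> q" "q \<le> b"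
  shows "\<bar>H (k + prim (wderiv a b u) q) - H (k + prim (wderiv a b u) p)\<bar> \<le> Eint \<epsilon> u {p<..<q}"
proof -
  define w where "w = wderiv a b u"
  have w: "w \<in> L2 a b" using H1D[OF u] by (simp add: w_def)
  have hL: "(\<lambda>x. indicator {p<..<q} x * h (k + prim w x)) \<in> L2 a b"
  proof (rule L2_mult_bounded[of _ _ 1])
    show "(\<lambda>x. h (k + prim w x)) \<in> L2 a b"
      by (intro continuous_L2 continuous_on_compose2[OF h_cont] continuous_intros prim_continuous w) auto
    show "(indicator {p<..<q} :: real \<Rightarrow> real) \<in> borel_measurable M"
      by (intro L2_measurable indicator_L2) auto
  qed (auto simp: indicator_def)
  have "\<bar>H (k + prim w q) - H (k + prim w p)\<bar> = \<bar>LINT x|M. indicator {p<..<q} x * h (k + prim w x) * w x\<bar>"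
    by (simp add: chain_rule_prim[OF H_deriv h_cont w pq])
  also have "\<dots> \<le> (LINT x|M. \<bar>indicator {p<..<q} x * h (k + prim w x) * w x\<bar>)"
    by (rule integral_abs_bound)
  also have "\<dots> \<le> Eint \<epsilon> u {p<..<q}"
    unfolding Eint_def
  proof (rule integral_mono_AE)
    show "integrable M (\<lambda>x. \<bar>indicator {p<..<q} x * h (k + prim w x) * w x\<bar>)"
      using hL w by (intro integrable_abs L2_mult_integrable)
    show "integrable M (\<lambda>x. indicator {p<..<q} x * density \<epsilon> u x)"
      using u by (rule restricted_density_integrable) auto
    show "AE x in M. \<bar>indicator {p<..<q} x * h (k + prim w x) * w x\<bar> \<le> indicator {p<..<q} x * density \<epsilon> u x"
      using rep
    proof eventually_elim
      case (elim x)
      have "\<bar>h (u x) * w x\<bar> \<le> density \<epsilon> u x"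
      proof -
        have "0 \<le> (\<epsilon> * \<bar>w x\<bar> - h (u x))\<^sup>2 / (2 * \<epsilon>)" using \<epsilon> by simp
        also have "\<dots> = \<epsilon> / 2 * (w x)\<^sup>2 + (h (u x))\<^sup>2 / (2 * \<epsilon>) - \<bar>h (u x) * w x\<bar>"
          using \<epsilon> h_nonneg[of "u x"] by (simp add: power2_diff power_mult_distrib abs_mult field_simps power2_eq_square)
        also have "(h (u x))\<^sup>2 / (2 * \<epsilon>) = F (u x) / \<epsilon>"
          using F_nonneg[of "u x"] by (simp add: h_def)
        finally show ?thesis by (simp add: density_def w_def)
      qed
      with elim show ?case
        by (auto simp: indicator_def w_def)
    qed
  qed
  finally show ?thesis by (simp add: w_def)
qed

text \<open>A Chebyshev argument. Points with \<open>\<bar>u - v\<bar> \<ge> \<eta>\<close> fill at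
  most a quarter of the interval by \<open>close\<close>, points with large \<open>F (u)\<close> at
  most a quarter by \<open>energy\<close>; so some point is neither. Both counts are combined in one
  integral inequality for the indicator \<open>I\<close>.\<close>

lemma good_point:
  assumes u: "u \<in> H1 a b" and \<epsilon>: "\<epsilon> > 0" and rep: "AE x in M. u x = k + prim (wderiv a b u) x"
    and v: "v \<in> L2 a b" and ab': "a \<le> \<alpha>" "\<alpha> < \<beta>" "\<beta> \<le> b" and vc: "\<And>x. x \<in> {\<alpha><..<\<beta>} \<Longrightarrow> v x = c"
    and close: "4 * L1_norm a b (\<lambda>x. u x - v x) \<le> \<eta> * (\<beta> - \<alpha>)" and \<eta>: "\<eta> > 0"
    and energy: "Eint \<epsilon> u {\<alpha><..<\<beta>} \<le> D" and D: "D > 0"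
  obtains p where "p \<in> {\<alpha><..<\<beta>}" "\<bar>k + prim (wderiv a b u) p - c\<bar> < \<eta>"
    "F (k + prim (wderiv a b u) p) \<le> 4 * \<epsilon> * D / (\<beta> - \<alpha>)"
proof (rule ccontr)
  assume "\<not> thesis"
  with that have bad: "\<And>p. p \<in> {\<alpha><..<\<beta>} \<Longrightarrow> \<eta> \<le> \<bar>k + prim (wderiv a b u) p - c\<bar>
      \<or> 4 * \<epsilon> * D / (\<beta> - \<alpha>) < F (k + prim (wderiv a b u) p)"
    by (meson not_le)
  define I where "I = (indicator {\<alpha><..<\<beta>} :: real \<Rightarrow> real)"
  \<comment> \<open>The reciprocal of \<open>4 * D / (\<beta> - \<alpha>)\<close>, the level above
    which the density counts as large.\<close>
  define \<theta> where "\<theta> = (\<beta> - \<alpha>) / (4 * D)"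
  have \<theta>: "\<theta> > 0" using ab' D by (simp add: \<theta>_def)
  have IL: "I \<in> L2 a b" unfolding I_def by (rule indicator_L2) auto
  have len: "(LINT x|M. I x) = \<beta> - \<alpha>"
  proof -
    have "(LINT x|M. I x * 1) = \<beta> - \<alpha>"
      unfolding I_def by (rule integral_FTC[of "\<lambda>x. x" "\<lambda>_. 1"]) (use ab' in \<open>auto intro!: derivative_eq_intros\<close>)
    then show ?thesis by simp
  qed
  have uv: "integrable M (\<lambda>x. \<bar>u x - v x\<bar>)"
    using H1D(1)[OF u] v by (intro integrable_abs L2_integrable L2_diff)
  have dI: "integrable M (\<lambda>x. I x * density \<epsilon> u x)"
    unfolding I_def using u by (rule restricted_density_integrable) auto
  have "(LINT x|M. I x) \<le> (LINT x|M. \<bar>u x - v x\<bar> / \<eta> + \<theta> * (I x * density \<epsilon> u x))"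
  proof (rule integral_mono_AE)
    show "AE x in M. I x \<le> \<bar>u x - v x\<bar> / \<eta> + \<theta> * (I x * density \<epsilon> u x)"
      using rep
    proof eventually_elim
      case (elim x)
      show ?case
      proof (cases "x \<in> {\<alpha><..<\<beta>}")
        case True
        have dn: "density \<epsilon> u x \<ge> 0" using \<epsilon> by (rule density_nonneg)
        from bad[OF True] show ?thesis
        proof
          assume "\<eta> \<le> \<bar>k + prim (wderiv a b u) x - c\<bar>"
          then have "1 \<le> \<bar>u x - v x\<bar> / \<eta>"
            using \<eta> vc[OF True] elim by simp
          moreover have "0 \<le> \<theta> * density \<epsilon> u x" using \<theta> dn by simp
          ultimately show ?thesis using True by (simp add: I_def)
        next
          assume "4 * \<epsilon> * D / (\<beta> - \<alpha>) < F (k + prim (wderiv a b u) x)"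
          then have "4 * D / (\<beta> - \<alpha>) < F (u x) / \<epsilon>"
            using \<epsilon> elim by (simp add: field_simps)
          also have "\<dots> \<le> density \<epsilon> u x" using \<epsilon> by (simp add: density_def)
          finally have "\<theta> * (4 * D / (\<beta> - \<alpha>)) \<le> \<theta> * density \<epsilon> u x"
            using \<theta> by (intro mult_left_mono) auto
          moreover have "\<theta> * (4 * D / (\<beta> - \<alpha>)) = 1" using D ab' by (simp add: \<theta>_def)
          moreover have "0 \<le> \<bar>u x - v x\<bar> / \<eta>" using \<eta> by simp
          ultimately have "1 \<le> \<bar>u x - v x\<bar> / \<eta> + \<theta> * density \<epsilon> u x" by linarith
          then show ?thesis using True by (simp add: I_def)
        qed
      qed (use \<eta> in \<open>simp add: I_def\<close>)
    qed
  qed (use IL uv dI in \<open>auto intro: L2_integrable\<close>)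
  also have "\<dots> = L1_norm a b (\<lambda>x. u x - v x) / \<eta> + \<theta> * Eint \<epsilon> u {\<alpha><..<\<beta>}"
    using uv dI by (simp add: L1_norm_def Eint_def I_def)
  also have "\<dots> \<le> (\<beta> - \<alpha>) / 4 + \<theta> * D"
    using close \<eta> energy \<theta> by (intro add_mono mult_left_mono) (auto simp: field_simps)
  also have "\<dots> = (\<beta> - \<alpha>) / 2" using D by (simp add: \<theta>_def)
  finally show False using len ab' by simp
qed

end

context double_well
begin

text \<open>Windows of radius \<open>j * d\<close> around the jumps carry an induction on
  \<open>j\<close>. The ring between consecutive windows avoids all windows of stage
  \<open>j\<close>, so the upper energy bound minus their lower bound leaves at most
  \<open>(C + D) * \<epsilon> ^ j\<close> there. The constants are uniform in \<epsilon> and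
  \<open>u\<close>.\<close>

lemma windows_lower_bound:
  fixes J :: "real set" and l :: "real \<Rightarrow> real"
  assumes J: "finite J" and r: "r > 0"
    and inside: "\<And>x. x \<in> J \<Longrightarrow> a \<le> x - r \<and> x + r \<le> b"
    and apart: "\<And>x x'. x \<in> J \<Longrightarrow> x' \<in> J \<Longrightarrow> x \<noteq> x' \<Longrightarrow> 2 * r \<le> \<bar>x - x'\<bar>"
    and v: "v \<in> L2 a b" and l: "\<And>x. x \<in> J \<Longrightarrow> l x \<in> {-1, 1}"
    and left: "\<And>x y. x \<in> J \<Longrightarrow> y \<in> {x - r<..<x} \<Longrightarrow> v y = l x"
    and right: "\<And>x y. x \<in> J \<Longrightarrow> y \<in> {x<..<x + r} \<Longrightarrow> v y = - l x"
    and C: "C > 0"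
  obtains \<delta> C' where "\<delta> > 0" "C' \<ge> 0"
    "\<And>\<epsilon> u. 0 < \<epsilon> \<Longrightarrow> \<epsilon> \<le> 1 \<Longrightarrow> u \<in> H1 a b \<Longrightarrow> L1_norm a b (\<lambda>x. u x - v x) \<le> \<delta> \<Longrightarrow>
      Eint \<epsilon> u UNIV \<le> real (card J) * c0 + C * \<epsilon> ^ k \<Longrightarrow>
      Eint \<epsilon> u UNIV \<ge> real (card J) * c0 - C' * \<epsilon> ^ k"
proof -
  obtain \<eta>1 K1 where 1: "\<eta>1 > 0" "K1 > 0" "\<And>s. \<bar>s - 1\<bar> < \<eta>1 \<Longrightarrow> \<bar>H s - H 1\<bar> \<le> K1 * F s"
    using well_deficiency[of 1] wells by blast
  obtain \<eta>2 K2 where 2: "\<eta>2 > 0" "K2 > 0" "\<And>s. \<bar>s - (-1)\<bar> < \<eta>2 \<Longrightarrow> \<bar>H s - H (-1)\<bar> \<le> K2 * F s"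
    using well_deficiency[of "-1"] wells by blast
  define \<eta> where "\<eta> = min \<eta>1 \<eta>2"
  define K where "K = max K1 K2"
  have \<eta>: "\<eta> > 0" and K: "K > 0" using 1 2 by (auto simp: \<eta>_def K_def)
  have deficiency: "\<bar>H s - H c\<bar> \<le> K * F s" if "c \<in> {-1, 1}" "\<bar>s - c\<bar> < \<eta>" for c s
  proof -
    have "K1 * F s \<le> K * F s" "K2 * F s \<le> K * F s"
      using F_nonneg by (auto simp: K_def intro!: mult_right_mono)
    with that 1(3)[of s] 2(3)[of s] show ?thesis by (auto simp: \<eta>_def)
  qed
  \<comment> \<open>Each of the \<open>k\<close> steps widens the windows by \<open>d\<close>, and
    all of them stay within distance \<open>r\<close> of the jumps.\<close>
  define d where "d = r / real (k + 1)"
  have d: "d > 0" using r by (simp add: d_def)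
  have dr: "real j * d \<le> r" if "j \<le> k + 1" for j
  proof -
    have "real j * d \<le> real (k + 1) * d" using that d by (intro mult_right_mono) auto
    then show ?thesis by (simp add: d_def)
  qed
  \<comment> \<open>The closeness that \<open>good_point\<close> asks for on an interval of length
    \<open>d\<close>.\<close>
  define \<delta> where "\<delta> = \<eta> * d / 4"
  have \<delta>: "\<delta> > 0" using \<eta> d by (simp add: \<delta>_def)
  define W where "W j x = {x - real j * d<..<x + real j * d}" for j :: nat and x :: real
  define hyp where "hyp \<epsilon> u \<longleftrightarrow> 0 < \<epsilon> \<and> \<epsilon> \<le> 1 \<and> u \<in> H1 a b \<and> L1_norm a b (\<lambda>x. u x - v x) \<le> \<delta> \<and>
      Eint \<epsilon> u UNIV \<le> real (card J) * c0 + C * \<epsilon> ^ k" for \<epsilon> u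
  have W_sub: "W j x \<subseteq> {x - r<..<x + r}" if "j \<le> k + 1" for j x
    using dr[OF that] by (auto simp: W_def)
  have disj: "{x - r<..<x + r} \<inter> {x' - r<..<x' + r} = {}" if "x \<in> J" "x' \<in> J" "x \<noteq> x'" for x x'
    using apart[OF that] by (auto simp: abs_if split: if_splits)
  have sum_le: "Eint \<epsilon> u A + (\<Sum>x\<in>J. Eint \<epsilon> u (W j x)) \<le> Eint \<epsilon> u UNIV"
    if "hyp \<epsilon> u" "A \<in> sets borel" "j \<le> k + 1" "\<And>x. x \<in> J \<Longrightarrow> A \<inter> W j x = {}" for \<epsilon> u A j
  proof -
    have u: "u \<in> H1 a b" and \<epsilon>: "\<epsilon> > 0" using that by (auto simp: hyp_def)
    have Wb: "W j x \<in> sets borel" for x by (simp add: W_def)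
    have int: "integrable M (\<lambda>y. indicator B y * density \<epsilon> u y)" if "B \<in> sets borel" for B
      using u that by (rule restricted_density_integrable)
    have "Eint \<epsilon> u A + (\<Sum>x\<in>J. Eint \<epsilon> u (W j x))
        = (LINT y|M. indicator A y * density \<epsilon> u y + (\<Sum>x\<in>J. indicator (W j x) y * density \<epsilon> u y))"
      unfolding Eint_def using int that(2) Wb
      by (subst Bochner_Integration.integral_add)
         (auto intro!: Bochner_Integration.integrable_sum simp: Bochner_Integration.integral_sum)
    also have "\<dots> \<le> Eint \<epsilon> u UNIV"
      unfolding Eint_def
    proof (rule integral_mono)
      show "integrable M (\<lambda>y. indicator A y * density \<epsilon> u y + (\<Sum>x\<in>J. indicator (W j x) y * density \<epsilon> u y))"
        using int that(2) Wb by (intro Bochner_Integration.integrable_add Bochner_Integration.integrable_sum) auto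
      show "integrable M (\<lambda>y. indicator UNIV y * density \<epsilon> u y)" by (rule int) simp
      fix y
      have "disjoint_family_on (W j) J"
        unfolding disjoint_family_on_def using disj W_sub[OF that(3)] by blast
      then have "(\<Sum>x\<in>J. indicator (W j x) y :: real) = indicator (\<Union>(W j ` J)) y"
        by (rule indicator_UN_disjoint[OF J, symmetric])
      then have "indicator A y + (\<Sum>x\<in>J. indicator (W j x) y :: real) \<le> 1"
        using that(4) by (auto simp: indicator_def)
      then have "(indicator A y + (\<Sum>x\<in>J. indicator (W j x) y)) * density \<epsilon> u y \<le> 1 * density \<epsilon> u y"
        using density_nonneg[OF \<epsilon>] by (intro mult_right_mono) auto
      then show "indicator A y * density \<epsilon> u y + (\<Sum>x\<in>J. indicator (W j x) y * density \<epsilon> u y)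
          \<le> indicator UNIV y * density \<epsilon> u y"
        by (simp add: distrib_right sum_distrib_right)
    qed
    finally show ?thesis .
  qed
  have windows: "\<exists>D\<ge>0. \<forall>\<epsilon> u. hyp \<epsilon> u \<longrightarrow> (\<Sum>x\<in>J. Eint \<epsilon> u (W j x)) \<ge> real (card J) * c0 - D * \<epsilon> ^ j"
    if "j \<le> k" for j
    using that
  proof (induction j)
    case 0
    \<comment> \<open>At stage 0 the windows are empty, and \<open>D = card J * c0\<close> makes the
      bound trivial.\<close>
    have "(\<Sum>x\<in>J. Eint \<epsilon> u (W 0 x)) = 0" for \<epsilon> u by (simp add: W_def Eint_def)
    then show ?case
      by (intro exI[of _ "real (card J) * c0"]) (simp add: c0_def)
  next
    case (Suc j)
    then obtain D where D: "D \<ge> 0" "\<And>\<epsilon> u. hyp \<epsilon> u \<Longrightarrow> (\<Sum>x\<in>J. Eint \<epsilon> u (W j x)) \<ge> real (card J) * c0 - D * \<epsilon> ^ j"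
      by auto
    \<comment> \<open>Each jump involves two good points, each with deficit \<open>K * F\<close> and
      \<open>F\<close> at most \<open>4 * (C + D) / d * \<epsilon> ^ Suc j\<close>.\<close>
    define D' where "D' = real (card J) * (2 * K * (4 * (C + D) / d))"
    have "D' \<ge> 0" using D(1) C K d by (simp add: D'_def)
    moreover have "(\<Sum>x\<in>J. Eint \<epsilon> u (W (Suc j) x)) \<ge> real (card J) * c0 - D' * \<epsilon> ^ Suc j" if hyp: "hyp \<epsilon> u" for \<epsilon> u
    proof -
      have u: "u \<in> H1 a b" and \<epsilon>: "\<epsilon> > 0" "\<epsilon> \<le> 1" and close: "L1_norm a b (\<lambda>x. u x - v x) \<le> \<delta>"
        and energy: "Eint \<epsilon> u UNIV \<le> real (card J) * c0 + C * \<epsilon> ^ k"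
        using hyp by (auto simp: hyp_def)
      \<comment> \<open>Here \<open>\<epsilon> \<le> 1\<close> enters: the assumed error of order
        \<open>k\<close> is weakened to order \<open>j\<close>.\<close>
      have "\<epsilon> ^ k \<le> \<epsilon> ^ j" using \<epsilon> Suc.prems by (intro power_decreasing) auto
      then have "C * \<epsilon> ^ k \<le> C * \<epsilon> ^ j" using C by (intro mult_left_mono) auto
      then have rest: "Eint \<epsilon> u A \<le> (C + D) * \<epsilon> ^ j" if "A \<in> sets borel" "\<And>x. x \<in> J \<Longrightarrow> A \<inter> W j x = {}" for A
        using sum_le[OF hyp that(1) _ that(2)] energy D(2)[OF hyp] Suc.prems by (auto simp: distrib_right)
      have pos: "(C + D) * \<epsilon> ^ j > 0" using C D(1) \<epsilon> by (intro mult_pos_pos) auto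
      obtain \<kappa> where rep: "AE x in M. u x = \<kappa> + prim (wderiv a b u) x"
        using u by (rule H1_representative)
      define U where "U x = \<kappa> + prim (wderiv a b u) x" for x
      have each: "Eint \<epsilon> u (W (Suc j) x) \<ge> c0 - 2 * K * (4 * (C + D) / d) * \<epsilon> ^ Suc j" if x: "x \<in> J" for x
      proof -
        define s0 where "s0 = real j * d"
        define s1 where "s1 = real (Suc j) * d"
        have j1: "s1 \<le> r" "s0 \<le> r" "s1 = s0 + d" "0 \<le> s0" "s0 < s1"
          using Suc.prems dr[of "Suc j"] dr[of j] d by (auto simp: s0_def s1_def distrib_right)
        have Weq: "W j x = {x - s0<..<x + s0}" "W (Suc j) x = {x - s1<..<x + s1}"
          by (simp_all add: W_def s0_def s1_def)
        have away: "B \<inter> W j x' = {}" if "B \<subseteq> {x - r<..<x + r}" "B \<inter> W j x = {}" "x' \<in> J" for B x'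
        proof (cases "x' = x")
          case False
          have "j \<le> k + 1" using Suc.prems by simp
          from W_sub[OF this, of x'] disj[OF x that(3)] False that(1) show ?thesis by blast
        qed (use that in simp)
        have bound: "4 * \<epsilon> * ((C + D) * \<epsilon> ^ j) / d = (4 * (C + D) / d) * \<epsilon> ^ Suc j"
          by simp
        have small: "4 * L1_norm a b (\<lambda>x. u x - v x) \<le> \<eta> * d"
          using close by (simp add: \<delta>_def)
        obtain p where p: "p \<in> {x - s1<..<x - s0}" "\<bar>U p - l x\<bar> < \<eta>"
          "F (U p) \<le> (4 * (C + D) / d) * \<epsilon> ^ Suc j"
        proof -
          let ?A = "{x - s1<..<x - s0}"
          have len: "x - s0 - (x - s1) = d" using j1 by simp
          have sub: "?A \<subseteq> {x - r<..<x + r}" using j1 r by auto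
          have e: "Eint \<epsilon> u ?A \<le> (C + D) * \<epsilon> ^ j"
            by (rule rest) (use away[OF sub] in \<open>auto simp: Weq\<close>)
          have vl: "\<And>y. y \<in> ?A \<Longrightarrow> v y = l x"
            by (rule left[OF x]) (use j1 in auto)
          show ?thesis
            by (rule good_point[OF u \<epsilon>(1) rep v _ _ _ vl _ \<eta> e pos])
               (use inside[OF x] j1 d small r bound len that in \<open>auto simp: U_def\<close>)
        qed
        obtain q where q: "q \<in> {x + s0<..<x + s1}" "\<bar>U q - (- l x)\<bar> < \<eta>"
          "F (U q) \<le> (4 * (C + D) / d) * \<epsilon> ^ Suc j"
        proof -
          let ?A = "{x + s0<..<x + s1}"
          have len: "x + s1 - (x + s0) = d" using j1 by simp
          have sub: "?A \<subseteq> {x - r<..<x + r}" using j1 r by auto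
          have e: "Eint \<epsilon> u ?A \<le> (C + D) * \<epsilon> ^ j"
            by (rule rest) (use away[OF sub] in \<open>auto simp: Weq\<close>)
          have vl: "\<And>y. y \<in> ?A \<Longrightarrow> v y = - l x"
            by (rule right[OF x]) (use j1 in auto)
          show ?thesis
            by (rule good_point[OF u \<epsilon>(1) rep v _ _ _ vl _ \<eta> e pos])
               (use inside[OF x] j1 d small r bound len that in \<open>auto simp: U_def\<close>)
        qed
        have pq: "a \<le> p" "p \<le> q" "q \<le> b"
          using p(1) q(1) inside[OF x] j1 by auto
        have lx: "l x \<in> {-1, 1}" "- l x \<in> {-1, 1}" using l[OF x] by auto
        \<comment> \<open>The transition leads from near \<open>l x\<close> to near
          \<open>- l x\<close>, hence costs \<open>c0\<close> up to the deficits at \<open>p\<close>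
          and \<open>q\<close>.\<close>
        have "c0 = \<bar>H (- l x) - H (l x)\<bar>"
          using lx(1) by (auto simp: c0_def abs_minus_commute)
        then have "c0 \<le> \<bar>H (U q) - H (U p)\<bar> + K * F (U p) + K * F (U q)"
          using deficiency[OF lx(1) p(2)] deficiency[OF lx(2) q(2)] by linarith
        also have "\<bar>H (U q) - H (U p)\<bar> \<le> Eint \<epsilon> u {p<..<q}"
          unfolding U_def by (rule modica_mortola[OF u \<epsilon>(1) rep pq])
        also have "Eint \<epsilon> u {p<..<q} \<le> Eint \<epsilon> u (W (Suc j) x)"
          by (rule Eint_mono[OF u _ _ _ \<epsilon>(1)]) (use p(1) q(1) in \<open>auto simp: Weq\<close>)
        also have "K * F (U p) \<le> K * ((4 * (C + D) / d) * \<epsilon> ^ Suc j)"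
          using p(3) K by (intro mult_left_mono) auto
        also have "K * F (U q) \<le> K * ((4 * (C + D) / d) * \<epsilon> ^ Suc j)"
          using q(3) K by (intro mult_left_mono) auto
        finally show ?thesis by (simp add: algebra_simps)
      qed
      have "(\<Sum>x\<in>J. Eint \<epsilon> u (W (Suc j) x)) \<ge> (\<Sum>x\<in>J. c0 - 2 * K * (4 * (C + D) / d) * \<epsilon> ^ Suc j)"
        by (rule sum_mono) (rule each)
      then show ?thesis
        by (simp add: D'_def right_diff_distrib mult.assoc)
    qed
    ultimately show ?case by blast
  qed
  from windows[of k] obtain D where D: "D \<ge> 0" "\<And>\<epsilon> u. hyp \<epsilon> u \<Longrightarrow> (\<Sum>x\<in>J. Eint \<epsilon> u (W k x)) \<ge> real (card J) * c0 - D * \<epsilon> ^ k"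
    by auto
  have "Eint \<epsilon> u UNIV \<ge> real (card J) * c0 - D * \<epsilon> ^ k" if "hyp \<epsilon> u" for \<epsilon> u
    using D(2)[OF that] sum_le[OF that, of "{}" k] by (simp add: Eint_def)
  then show thesis
    using \<delta> D(1) unfolding hyp_def by (intro that[of \<delta> D]) blast+
qed

end

section \<open>One-sided values and jumps of piecewise constant functions\<close>

lemma one_sided_constant:
  fixes v :: "real \<Rightarrow> real"
  assumes pc: "piecewise_constant a b v" and x: "x \<in> {a<..<b}" and s: "s \<in> {-1, 1::real}"
  obtains d c where "d > 0" "\<And>h. 0 < h \<Longrightarrow> h < d \<Longrightarrow> x + s * h \<in> {a<..<b} \<and> v (x + s * h) = c"
proof -
  from pc obtain P where P: "finite P" "partition_on {a<..<b} P"
    "\<And>I. I \<in> P \<Longrightarrow> is_interval I \<and> v constant_on I"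
    unfolding piecewise_constant_def by blast
  define d0 where "d0 = min (x - a) (b - x)"
  have d0: "d0 > 0" using x by (auto simp: d0_def)
  have inside: "x + s * h \<in> {a<..<b}" if "0 < h" "h < d0" for h
    using that s by (auto simp: d0_def)
  \<comment> \<open>Points approaching \<open>x\<close> from the side given by \<open>s\<close>;
    \<open>+ 2\<close> keeps the offsets strictly below \<open>d0\<close>.\<close>
  define z where "z n = x + s * (d0 / (real n + 2))" for n :: nat
  have fraction: "0 < d0 / (real n + 2)" "d0 / (real n + 2) < d0" for n :: nat
    using d0 divide_strict_left_mono[of 1 "real n + 2" d0] by auto
  have zin: "z n \<in> {a<..<b}" for n
    unfolding z_def by (rule inside[OF fraction])
  have cover: "\<Union>P = {a<..<b}" using P(2) by (auto simp: partition_on_def)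
  have "\<exists>I\<in>P. z n \<in> I" for n using zin[of n] cover by blast
  then obtain I where I: "\<And>n. I n \<in> P" "\<And>n. z n \<in> I n" by metis
  have "finite (I ` UNIV)" using P(1) I(1) by (meson finite_subset image_subsetI)
  \<comment> \<open>Infinitely many points lie in finitely many pieces, so one piece contains points
    arbitrarily close to \<open>x\<close> and, being an interval, everything between them and
    \<open>z n0\<close>.\<close>
  then obtain n0 where n0: "infinite {n \<in> UNIV. I n = I n0}"
    using pigeonhole_infinite[of UNIV I] by auto
  define d where "d = d0 / (real n0 + 2)"
  have d: "d > 0" "d < d0" using fraction[of n0] by (auto simp: d_def)
  have interval: "is_interval (I n0)" and "v constant_on I n0"
    using P(3)[OF I(1)] by auto
  then obtain c where c: "\<And>y. y \<in> I n0 \<Longrightarrow> v y = c" unfolding constant_on_def by blast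
  have "x + s * h \<in> I n0" if h: "0 < h" "h < d" for h
  proof -
    obtain m where m: "d0 / h < real m" using reals_Archimedean2 by blast
    obtain n where n: "n > m" "I n = I n0"
      using n0 by (auto simp: infinite_nat_iff_unbounded)
    have "d0 / h < real n + 2" using m n by linarith
    then have "d0 / (real n + 2) < h" using h d0 by (simp add: field_simps)
    moreover have "z n \<in> I n0" "z n0 \<in> I n0" using I(2)[of n] I(2)[of n0] n(2) by auto
    ultimately show ?thesis
      using s h mem_is_interval_1_I[OF interval, of "z n" "z n0" "x + s * h"]
        mem_is_interval_1_I[OF interval, of "z n0" "z n" "x + s * h"]
      by (auto simp: z_def d_def)
  qed
  with c inside d show thesis by (intro that[of d c]) auto
qed

text \<open>The piece containing \<open>x\<close> is nondegenerate, so it has another point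
  \<open>y\<close> and contains the segment from \<open>x\<close> to \<open>y\<close>. Hence
  \<open>v x\<close> cannot be an isolated value.\<close>

lemma value_attained_on_one_side:
  fixes v :: "real \<Rightarrow> real"
  assumes pc: "piecewise_constant a b v" and x: "x \<in> {a<..<b}"
  obtains s d where "s \<in> {-1, 1::real}" "d > 0" "\<And>h. 0 < h \<Longrightarrow> h < d \<Longrightarrow> v (x + s * h) = v x"
proof -
  from pc obtain P where P: "partition_on {a<..<b} P"
    "\<And>I. I \<in> P \<Longrightarrow> is_interval I \<and> interior I \<noteq> {} \<and> v constant_on I"
    unfolding piecewise_constant_def by blast
  have "x \<in> \<Union>P" using P(1) x by (auto simp: partition_on_def)
  then obtain I where I: "I \<in> P" "x \<in> I" by blast
  then have iv: "is_interval I" "interior I \<noteq> {}" "v constant_on I" using P(2) by auto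
  have "\<exists>y\<in>I. y \<noteq> x"
  proof (rule ccontr)
    assume "\<not> (\<exists>y\<in>I. y \<noteq> x)"
    then have "I \<subseteq> {x}" by auto
    then have "interior I \<subseteq> interior {x}" by (rule interior_mono)
    with iv(2) show False by simp
  qed
  then obtain y where y: "y \<in> I" "y \<noteq> x" by blast
  obtain c where c: "\<And>y. y \<in> I \<Longrightarrow> v y = c" using iv(3) unfolding constant_on_def by blast
  show thesis
  proof (rule that)
    show "sgn (y - x) \<in> {-1, 1}" "\<bar>y - x\<bar> > 0" using y by (auto simp: sgn_if)
    fix h
    assume h: "0 < h" "h < \<bar>y - x\<bar>"
    have "x + sgn (y - x) * h \<in> I"
      using h y mem_is_interval_1_I[OF iv(1) I(2) y(1)] mem_is_interval_1_I[OF iv(1) y(1) I(2)]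
      by (auto simp: sgn_if split: if_splits)
    with c I(2) show "v (x + sgn (y - x) * h) = v x" by simp
  qed
qed

text \<open>If the values on the two sides agreed, \<open>v x\<close> would equal them, since it is
  attained on one side, and \<open>v\<close> would be continuous at \<open>x\<close>. So they
  differ, and values in \<open>{-1, 1}\<close> that differ are opposite.\<close>

lemma jump_at_discontinuity:
  fixes v :: "real \<Rightarrow> real"
  assumes pc: "piecewise_constant a b v" and val: "\<And>x. x \<in> {a<..<b} \<Longrightarrow> v x \<in> {-1, 1}"
    and x: "x \<in> {a<..<b}" and disc: "\<not> isCont v x"
  obtains d l where "d > 0" "l \<in> {-1, 1}" "a \<le> x - d" "x + d \<le> b"
    "\<And>y. y \<in> {x - d<..<x} \<Longrightarrow> v y = l" "\<And>y. y \<in> {x<..<x + d} \<Longrightarrow> v y = - l"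
proof -
  obtain d1 c1 where 1: "d1 > 0" "\<And>h. 0 < h \<Longrightarrow> h < d1 \<Longrightarrow> x + 1 * h \<in> {a<..<b} \<and> v (x + 1 * h) = c1"
    using one_sided_constant[OF pc x, of 1] by blast
  obtain d2 c2 where 2: "d2 > 0" "\<And>h. 0 < h \<Longrightarrow> h < d2 \<Longrightarrow> x + (-1) * h \<in> {a<..<b} \<and> v (x + (-1) * h) = c2"
    using one_sided_constant[OF pc x, of "-1"] by blast
  obtain s d3 where 3: "s \<in> {-1, 1::real}" "d3 > 0" "\<And>h. 0 < h \<Longrightarrow> h < d3 \<Longrightarrow> v (x + s * h) = v x"
    using value_attained_on_one_side[OF pc x] by blast
  define d where "d = min (min d1 d2) (min d3 (min (x - a) (b - x)))"
  have d: "d > 0" "d \<le> d1" "d \<le> d2" "d \<le> d3" "d \<le> x - a" "d \<le> b - x"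
    using 1(1) 2(1) 3(2) x by (auto simp: d_def)
  have R: "v y = c1" if "y \<in> {x<..<x + d}" for y
    using 1(2)[of "y - x"] that d by auto
  have L: "v y = c2" if "y \<in> {x - d<..<x}" for y
    using 2(2)[of "x - y"] that d by auto
  have c: "c1 \<in> {-1, 1}" "c2 \<in> {-1, 1}"
    using R[of "x + d / 2"] val[of "x + d / 2"] L[of "x - d / 2"] val[of "x - d / 2"] d by auto
  have "c1 \<noteq> c2"
  proof
    assume eq: "c1 = c2"
    have "v x = c1"
      using 3(1) 3(3)[of "d / 2"] R[of "x + d / 2"] L[of "x - d / 2"] d eq by auto
    then have "v y = v x" if "\<bar>y - x\<bar> < d" for y
      using R[of y] L[of y] eq that by (cases y x rule: linorder_cases) auto
    with d(1) have "\<forall>\<^sub>F y in at x. v y = v x"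
      unfolding eventually_at dist_real_def by blast
    then have "(v \<longlongrightarrow> v x) (at x)" by (rule tendsto_eventually)
    with disc show False by (simp add: isCont_def)
  qed
  with c have "c1 = - c2" by auto
  with R L c d show thesis by (intro that[of d c2]) auto
qed

lemma piecewise_constant_measurable:
  assumes "piecewise_constant a b v"
  shows "v \<in> borel_measurable (lebesgue_on {a<..<b})"
proof -
  from assms obtain P where P: "finite P" "partition_on {a<..<b} P"
    "\<And>I. I \<in> P \<Longrightarrow> is_interval I \<and> v constant_on I"
    unfolding piecewise_constant_def by blast
  have "\<exists>c. \<forall>y\<in>I. v y = c" if "I \<in> P" for I
    using P(3)[OF that] by (auto simp: constant_on_def)
  then obtain c where c: "\<And>I y. I \<in> P \<Longrightarrow> y \<in> I \<Longrightarrow> v y = c I" by metis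
  have "(\<lambda>y. \<Sum>I\<in>P. c I * indicator I y) \<in> borel_measurable (lebesgue_on {a<..<b})"
  proof (intro borel_measurable_sum borel_measurable_times borel_measurable_const)
    fix I
    assume "I \<in> P"
    then have "I \<in> sets borel" using P(3) by (intro real_interval_borel_measurable) auto
    then have "(indicator I :: real \<Rightarrow> real) \<in> borel_measurable borel" by simp
    then show "(indicator I :: real \<Rightarrow> real) \<in> borel_measurable (lebesgue_on {a<..<b})"
      by (simp add: measurable_restrict_space1 measurable_completion)
  qed
  moreover have "(\<Sum>I\<in>P. c I * indicator I y) = v y" if y: "y \<in> {a<..<b}" for y
  proof -
    have "y \<in> \<Union>P" using P(2) y by (auto simp: partition_on_def)
    then obtain I where I: "I \<in> P" "y \<in> I" by blast
    have "(\<Sum>I'\<in>P. c I' * indicator I' y) = (\<Sum>I'\<in>{I}. c I' * indicator I' y)"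
    proof (rule sum.mono_neutral_right)
      show "\<forall>I'\<in>P - {I}. c I' * indicator I' y = 0"
      proof
        fix I'
        assume "I' \<in> P - {I}"
        then have "I' \<inter> I = {}" using partition_onD2[OF P(2)] I by (auto simp: disjoint_def)
        then show "c I' * indicator I' y = 0" using I by (auto simp: indicator_def)
      qed
    qed (use P I in auto)
    with c[OF I] I show ?thesis by simp
  qed
  ultimately show ?thesis
    by (subst measurable_cong[of _ _ "\<lambda>y. \<Sum>I\<in>P. c I * indicator I y"]) auto
qed

subsection \<open>Slow motion\<close>

context damped_wave
begin

lemma energy_ge_gradient_part:
  assumes t: "t \<ge> 0"
  shows "(LINT x|M. \<epsilon> / 2 * (wderiv a b (u t) x)\<^sup>2 + F (u t x) / \<epsilon>) \<le> E t / \<epsilon>"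
proof -
  note um = uw_mem[OF t]
  have "(LINT x|M. \<epsilon> / 2 * (wderiv a b (u t) x)\<^sup>2 + F (u t x) / \<epsilon>)
      = \<epsilon> / 2 * ip (wderiv a b (u t)) (wderiv a b (u t)) + (LINT x|M. F (u t x)) / \<epsilon>"
    using L2_square_integrable[OF um(4)] L2_integrable[OF compose_L2[OF F_cont t]]
    by (simp add: power2_eq_square)
  also have "\<dots> \<le> \<epsilon> / 2 * ip (wderiv a b (u t)) (wderiv a b (u t)) + (LINT x|M. F (u t x)) / \<epsilon>
      + \<tau> / (2 * \<epsilon>) * ip (w t) (w t)"
    using L2.nonneg[OF um(3)] \<tau> \<epsilon> by simp
  also have "\<dots> = E t / \<epsilon>"
    using \<epsilon> by (simp add: E_def Q_def field_simps power2_eq_square)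
  finally show ?thesis .
qed

lemma initial_energy_density:
  "(LINT x|M. \<tau> / (2 * \<epsilon>) * (snd y0 x)\<^sup>2 + \<epsilon> / 2 * (wderiv a b (fst y0) x)\<^sup>2 + F (fst y0 x) / \<epsilon>) = E 0 / \<epsilon>"
proof -
  note ym = X_spaceD[OF y0]
  have "AE x in M. \<bar>fst y0 x\<bar> \<le> L2_norm a b (fst y0) / sqrt (b - a) + 2 * sqrt (b - a) * L2_norm a b (wderiv a b (fst y0))"
    using ym(1) by (rule H1_sup_bound)
  then obtain R where R: "AE x in M. \<bar>fst y0 x\<bar> \<le> R" by blast
  obtain C where C: "\<And>s. \<bar>s\<bar> \<le> R \<Longrightarrow> \<bar>F s\<bar> \<le> C"
    using continuous_bounded_on_interval[OF F_cont] by blast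
  have "integrable M (\<lambda>x. F (fst y0 x))"
  proof (rule integrable_bounded)
    show "(\<lambda>x. F (fst y0 x)) \<in> borel_measurable M"
      by (rule measurable_compose[OF L2_measurable[OF ym(2)] borel_measurable_continuous_onI[OF F_cont]])
    show "AE x in M. \<bar>F (fst y0 x)\<bar> \<le> C" using R by eventually_elim (rule C)
  qed
  then have "(LINT x|M. \<tau> / (2 * \<epsilon>) * (snd y0 x)\<^sup>2 + \<epsilon> / 2 * (wderiv a b (fst y0) x)\<^sup>2 + F (fst y0 x) / \<epsilon>)
      = \<tau> / (2 * \<epsilon>) * ip (snd y0) (snd y0) + \<epsilon> / 2 * ip (wderiv a b (fst y0)) (wderiv a b (fst y0))
        + (LINT x|M. F (fst y0 x)) / \<epsilon>"
    using L2_square_integrable[OF ym(3)] L2_square_integrable[OF ym(4)]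
    by (simp add: power2_eq_square)
  also have "\<dots> = E 0 / \<epsilon>"
    using \<epsilon> by (simp add: initial_energy Q_def field_simps power2_eq_square)
  finally show ?thesis .
qed

text \<open>A continuity argument: at any time where the distance is at most
  \<open>\<delta>\<close>, the bound improves to a value below \<open>\<delta>\<close>, so the
  distance never reaches \<open>\<delta>\<close>. Since \<open>distance_travelled\<close> compares
  energies only at the two ends of the time interval, \<open>drop\<close> is invoked at a single
  time.\<close>

lemma slow_motion:
  assumes v: "v \<in> L2 a b" and "A \<ge> 0"
    and drop: "\<And>t. 0 \<le> t \<Longrightarrow> L1_norm a b (\<lambda>x. u t x - v x) \<le> \<delta> \<Longrightarrow> E 0 - E t \<le> A * \<epsilon> ^ (k + 1)"
    and small: "L1_norm a b (\<lambda>x. fst y0 x - v x) + (A / (2 * \<sigma>) + (b - a) * m / 2) * sqrt \<epsilon> < \<delta>"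
    and t: "t \<in> {0..m / \<epsilon> ^ k}"
  shows "L1_norm a b (\<lambda>x. u t x - v x)
    \<le> L1_norm a b (\<lambda>x. fst y0 x - v x) + (A / (2 * \<sigma>) + (b - a) * m / 2) * sqrt \<epsilon>"
proof -
  define n where "n s = L1_norm a b (\<lambda>x. u s x - v x)" for s
  define \<omega> where "\<omega> = L1_norm a b (\<lambda>x. fst y0 x - v x) + (A / (2 * \<sigma>) + (b - a) * m / 2) * sqrt \<epsilon>"
  have u0: "u 0 \<in> L2 a b" by (rule uw_mem) simp
  have n0: "n 0 = L1_norm a b (\<lambda>x. fst y0 x - v x)"
    unfolding n_def L1_norm_def
  proof (rule integral_cong_AE)
    show "AE x in M. \<bar>u 0 x - v x\<bar> = \<bar>fst y0 x - v x\<bar>"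
      using initial_AE by eventually_elim simp
    show "(\<lambda>x. \<bar>u 0 x - v x\<bar>) \<in> borel_measurable M"
      by (intro borel_measurable_abs L2_measurable L2_diff u0 v)
    show "(\<lambda>x. \<bar>fst y0 x - v x\<bar>) \<in> borel_measurable M"
      by (intro borel_measurable_abs L2_measurable L2_diff X_spaceD(2)[OF y0] v)
  qed
  have step: "n s \<le> \<omega>" if s: "0 \<le> s" "s \<le> m / \<epsilon> ^ k" and ns: "n s \<le> \<delta>" for s
  proof -
    \<comment> \<open>With this weight, \<open>\<mu>\<close> times the energy drop of order
      \<open>\<epsilon> ^ (k + 1)\<close> and the time \<open>m / \<epsilon> ^ k\<close> divided by
      \<open>\<mu>\<close> are both of order \<open>sqrt \<epsilon>\<close>.\<close>
    define \<mu> where "\<mu> = 1 / (\<epsilon> ^ k * sqrt \<epsilon>)"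
    have \<mu>: "\<mu> > 0" using \<epsilon> by (simp add: \<mu>_def)
    note us = uw_mem(2)[OF s(1)]
    have int: "integrable M (\<lambda>x. \<bar>u s x - u 0 x\<bar>)" "integrable M (\<lambda>x. \<bar>u 0 x - v x\<bar>)" "integrable M (\<lambda>x. \<bar>u s x - v x\<bar>)"
      using us u0 v by (auto intro!: integrable_abs[OF L2_integrable[OF L2_diff]])
    have "n s \<le> (LINT x|M. \<bar>u s x - u 0 x\<bar> + \<bar>u 0 x - v x\<bar>)"
      unfolding n_def L1_norm_def using int by (intro integral_mono) auto
    also have "\<dots> = L1_norm a b (\<lambda>x. u s x - u 0 x) + n 0"
      using int by (simp add: n_def L1_norm_def)
    finally have 1: "n s \<le> L1_norm a b (\<lambda>x. u s x - u 0 x) + n 0" .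
    have "L1_norm a b (\<lambda>x. u s x - u 0 x) \<le> \<mu> / (2 * \<sigma>) * (E 0 - E s) + (b - a) / (2 * \<mu>) * s"
      by (rule distance_travelled[OF s(1) \<mu>])
    also have "\<mu> / (2 * \<sigma>) * (E 0 - E s) \<le> \<mu> / (2 * \<sigma>) * (A * \<epsilon> ^ (k + 1))"
      using drop[OF s(1)] ns \<mu> \<sigma> by (intro mult_left_mono) (auto simp: n_def)
    also have "\<mu> / (2 * \<sigma>) * (A * \<epsilon> ^ (k + 1)) = A / (2 * \<sigma>) * (\<epsilon> / sqrt \<epsilon>)"
      using \<epsilon> by (simp add: \<mu>_def field_simps)
    also have "\<epsilon> / sqrt \<epsilon> = sqrt \<epsilon>"
      using \<epsilon> by (simp add: real_div_sqrt)
    also have "(b - a) / (2 * \<mu>) * s \<le> (b - a) / (2 * \<mu>) * (m / \<epsilon> ^ k)"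
      using s \<mu> ab by (intro mult_left_mono) auto
    also have "(b - a) / (2 * \<mu>) * (m / \<epsilon> ^ k) = (b - a) * m / 2 * sqrt \<epsilon>"
      using \<epsilon> by (simp add: \<mu>_def field_simps)
    finally have "L1_norm a b (\<lambda>x. u s x - u 0 x) \<le> (A / (2 * \<sigma>) + (b - a) * m / 2) * sqrt \<epsilon>"
      by (simp add: distrib_right)
    with 1 n0 show ?thesis by (simp add: \<omega>_def)
  qed
  have "0 \<le> m / \<epsilon> ^ k" using t by auto
  moreover have "\<epsilon> ^ k > 0" using \<epsilon> by simp
  ultimately have "m \<ge> 0" by (auto simp: zero_le_divide_iff)
  then have "n 0 \<le> \<omega>"
    unfolding n0 \<omega>_def using \<open>A \<ge> 0\<close> \<sigma> ab \<epsilon> by simp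
  \<comment> \<open>By the intermediate value theorem, exceeding \<open>\<delta>\<close> would
    require taking the value \<open>\<delta>\<close>, where \<open>step\<close> gives a smaller
    one.\<close>
  have "n t \<le> \<delta>"
  proof (rule ccontr)
    assume "\<not> n t \<le> \<delta>"
    moreover have "continuous_on {0..t} n"
      unfolding n_def by (rule continuous_on_IccI_nonneg[OF L1_norm_lim[OF v]])
    ultimately obtain s where "0 \<le> s" "s \<le> t" "n s = \<delta>"
      using IVT'[of n 0 \<delta> t] \<open>n 0 \<le> \<omega>\<close> small t by (auto simp: \<omega>_def)
    with step[of s] t small show False by (simp add: \<omega>_def)
  qed
  with step[of t] t show ?thesis by (simp add: n_def \<omega>_def)
qed

end

section \<open>Preparation of the hypotheses and conclusion\<close>

lemma lipschitz_near_continuous: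
  fixes g :: "real \<Rightarrow> real"
  assumes "\<And>s. \<exists>r>0. \<exists>L. L-lipschitz_on (cball s r) g"
  shows "continuous_on UNIV g"
proof (rule continuous_at_imp_continuous_on, rule ballI)
  fix s
  obtain r L where r: "r > 0" "L-lipschitz_on (cball s r) g" using assms by blast
  have "continuous_on (cball s r) g" by (rule lipschitz_on_continuous_on[OF r(2)])
  then have "continuous_on (ball s r) g" by (rule continuous_on_subset) auto
  with r(1) show "isCont g s" by (simp add: continuous_on_eq_continuous_at)
qed

lemma C_3_derivatives:
  assumes "C_k 3 F"
  shows "(F has_real_derivative deriv F s) (at s)" "(deriv F has_real_derivative deriv (deriv F) s) (at s)"
    "continuous_on UNIV (deriv (deriv F))"
proof -
  have d: "(deriv ^^ j) F differentiable (at x)" if "j < 3" for j x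
    using assms that by (simp add: C_k_def)
  show "(F has_real_derivative deriv F s) (at s)"
    using d[of 0 s] by (simp add: DERIV_deriv_iff_real_differentiable)
  show "(deriv F has_real_derivative deriv (deriv F) s) (at s)"
    using d[of 1 s] by (simp add: DERIV_deriv_iff_real_differentiable)
  have "deriv (deriv F) differentiable (at x)" for x
    using d[of 2 x] by (simp add: numeral_2_eq_2)
  then show "continuous_on UNIV (deriv (deriv F))"
    by (intro continuous_at_imp_continuous_on) (auto intro: differentiable_imp_continuous_within)
qed

lemma finite_separation:
  fixes J :: "real set" and d :: "real \<Rightarrow> real"
  assumes "finite J" "\<And>x. x \<in> J \<Longrightarrow> d x > 0"
  obtains r where "r > 0" "\<And>x. x \<in> J \<Longrightarrow> r \<le> d x"
    "\<And>x x'. x \<in> J \<Longrightarrow> x' \<in> J \<Longrightarrow> x \<noteq> x' \<Longrightarrow> 2 * r \<le> \<bar>x - x'\<bar>"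
proof -
  \<comment> \<open>The element 1 keeps the minimum defined when there are no points; halving the
    distances makes open intervals of radius \<open>r\<close> around the points disjoint.\<close>
  define G where "G = insert 1 (d ` J \<union> (\<lambda>(x, x'). \<bar>x - x'\<bar> / 2) ` {z \<in> J \<times> J. fst z \<noteq> snd z})"
  have fin: "finite G" using assms(1) by (auto simp: G_def)
  have "Min G > 0"
    using fin assms(2) by (subst Min_gr_iff) (auto simp: G_def)
  moreover have "Min G \<le> d x" if "x \<in> J" for x
    using fin that by (intro Min_le) (auto simp: G_def)
  moreover have "2 * Min G \<le> \<bar>x - x'\<bar>" if "x \<in> J" "x' \<in> J" "x \<noteq> x'" for x x'
  proof -
    have "\<bar>x - x'\<bar> / 2 \<in> G"
      using that by (auto simp: G_def image_iff intro!: bexI[of _ "(x, x')"])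
    with fin have "Min G \<le> \<bar>x - x'\<bar> / 2" by (rule Min_le)
    then show ?thesis by simp
  qed
  ultimately show thesis by (rule that)
qed

theorem theorem2:
  fixes a b \<tau> \<sigma> c\<^sub>0 m :: real
    and f g F v :: "real \<Rightarrow> real"
    and u\<^sub>0 u\<^sub>1 :: "real \<Rightarrow> real \<Rightarrow> real"
    and u u\<^sub>t :: "real \<Rightarrow> real \<Rightarrow> real \<Rightarrow> real"
    and N k :: nat
  assumes "a < b" and "\<tau> > 0"
    and "\<And>s. \<exists>r>0. \<exists>L. L-lipschitz_on (cball s r) g"
    and "\<sigma> > 0" and "\<And>s. g s \<ge> \<sigma>"
    and "f = (\<lambda>s. - deriv F s)"
    and "C_k 3 F" and "filterlim F at_top at_infinity"
    and "F (-1) = 0" and "F 1 = 0" and "deriv F (-1) = 0" and "deriv F 1 = 0"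
    and "deriv (deriv F) (-1) > 0" and "deriv (deriv F) 1 > 0"
    and "{s. deriv F s = 0 \<and> F s \<le> 0} = {-1, 1}"
    and "N \<ge> 1"
    and "\<And>x. x \<in> {a<..<b} \<Longrightarrow> v x \<in> {-1, 1}"
    and "piecewise_constant a b v"
    and "card {x \<in> {a<..<b}. \<not> isCont v x} = N"
    and "c\<^sub>0 = sqrt 2 * (LINT s|lebesgue_on {-1..1}. sqrt (F s))"
    and "k \<ge> 1"
    and "\<forall>\<^sub>F \<epsilon> in at_right 0. u\<^sub>0 \<epsilon> \<in> H1 a b \<and> u\<^sub>1 \<epsilon> \<in> L2 a b"
    and "((\<lambda>\<epsilon>. L1_norm a b (\<lambda>x. u\<^sub>0 \<epsilon> x - v x)) \<longlongrightarrow> 0) (at_right 0)"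
    and "\<exists>C>0. \<forall>\<^sub>F \<epsilon> in at_right 0.
      (LINT x|lebesgue_on {a<..<b}. \<tau> / (2 * \<epsilon>) * (u\<^sub>1 \<epsilon> x)\<^sup>2
        + \<epsilon> / 2 * (wderiv a b (u\<^sub>0 \<epsilon>) x)\<^sup>2 + F (u\<^sub>0 \<epsilon> x) / \<epsilon>)
      \<le> real N * c\<^sub>0 + C * \<epsilon> ^ k"
    and "\<forall>\<^sub>F \<epsilon> in at_right 0.
      mild_solution a b \<tau> \<epsilon> f g (u\<^sub>0 \<epsilon>, u\<^sub>1 \<epsilon>) (\<lambda>t. (u \<epsilon> t, u\<^sub>t \<epsilon> t))"
    and "m > 0"
  shows "((\<lambda>\<epsilon>. SUP t\<in>{0..m / \<epsilon> ^ k}. ereal (L1_norm a b (\<lambda>x. u \<epsilon> t x - v x))) \<longlongrightarrow> 0)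
    (at_right 0)"
proof -
  interpret interval a b
    using assms(1) by unfold_locales
  note F' = C_3_derivatives[OF \<open>C_k 3 F\<close>]
  \<comment> \<open>Obtained from the hypothesis on critical points: the only ones with
    \<open>F \<le> 0\<close> are the wells, where \<open>F\<close> vanishes.\<close>
  have F_nonneg: "F s \<ge> 0" for s
  proof (rule nonneg_if_critical_points_nonneg[OF F'(1) \<open>filterlim F at_top at_infinity\<close> \<open>F 1 = 0\<close>])
    fix s
    assume "deriv F s = 0" "F s \<le> 0"
    then have "s \<in> {-1, 1}" using \<open>{s. deriv F s = 0 \<and> F s \<le> 0} = {-1, 1}\<close> by blast
    then show "F s = 0" using \<open>F (-1) = 0\<close> \<open>F 1 = 0\<close> by auto
  qed
  interpret DW: double_well a b F "deriv F" "deriv (deriv F)"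
    by unfold_locales (use F' F_nonneg assms in auto)
  have c\<^sub>0: "c\<^sub>0 = DW.c0"
    using assms(20) DW.c0_eq by simp
  define J where "J = {x \<in> {a<..<b}. \<not> isCont v x}"
  have cardJ: "card J = N" using assms(19) by (simp add: J_def)
  \<comment> \<open>An infinite set has cardinality 0, which \<open>N \<ge> 1\<close> rules
    out.\<close>
  then have "finite J" using \<open>N \<ge> 1\<close> card.infinite by fastforce
  have "\<exists>d l. d > 0 \<and> l \<in> {-1, 1} \<and> a \<le> x - d \<and> x + d \<le> b
      \<and> (\<forall>y\<in>{x - d<..<x}. v y = l) \<and> (\<forall>y\<in>{x<..<x + d}. v y = - l)" if "x \<in> J" for x
  proof -
    have x: "x \<in> {a<..<b}" "\<not> isCont v x" using that by (auto simp: J_def)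
    show ?thesis
      by (rule jump_at_discontinuity[OF \<open>piecewise_constant a b v\<close> assms(17) x]) blast+
  qed
  then obtain d l where dl: "\<And>x. x \<in> J \<Longrightarrow> d x > 0 \<and> l x \<in> {-1, 1 :: real} \<and> a \<le> x - d x \<and> x + d x \<le> b
      \<and> (\<forall>y\<in>{x - d x<..<x}. v y = l x) \<and> (\<forall>y\<in>{x<..<x + d x}. v y = - l x)"
    by metis
  \<comment> \<open>A common radius for the windows: within the one-sided neighbourhoods where
    \<open>v\<close> is constant, and small enough for the windows to be disjoint.\<close>
  obtain r where r: "r > 0" "\<And>x. x \<in> J \<Longrightarrow> r \<le> d x"
    "\<And>x x'. x \<in> J \<Longrightarrow> x' \<in> J \<Longrightarrow> x \<noteq> x' \<Longrightarrow> 2 * r \<le> \<bar>x - x'\<bar>"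
    using finite_separation[OF \<open>finite J\<close>, of d] dl by blast
  have v: "v \<in> L2 a b"
  proof (rule L2_I_bounded[of _ 1])
    show "v \<in> borel_measurable M"
      by (rule piecewise_constant_measurable[OF \<open>piecewise_constant a b v\<close>])
    show "AE x in M. \<bar>v x\<bar> \<le> 1"
    proof (rule AE_I2)
      fix x
      assume "x \<in> space M"
      then have "v x \<in> {-1, 1}" by (intro assms(17)) simp
      then show "\<bar>v x\<bar> \<le> 1" by auto
    qed
  qed
  obtain C where C: "C > 0" and ev_energy: "\<forall>\<^sub>F \<epsilon> in at_right 0.
      (LINT x|M. \<tau> / (2 * \<epsilon>) * (u\<^sub>1 \<epsilon> x)\<^sup>2 + \<epsilon> / 2 * (wderiv a b (u\<^sub>0 \<epsilon>) x)\<^sup>2 + F (u\<^sub>0 \<epsilon> x) / \<epsilon>)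
      \<le> real N * c\<^sub>0 + C * \<epsilon> ^ k"
    using assms(24) by blast
  obtain \<delta> C' where \<delta>: "\<delta> > 0" and C': "C' \<ge> 0"
    and lower: "\<And>\<epsilon> u. 0 < \<epsilon> \<Longrightarrow> \<epsilon> \<le> 1 \<Longrightarrow> u \<in> H1 a b \<Longrightarrow> L1_norm a b (\<lambda>x. u x - v x) \<le> \<delta> \<Longrightarrow>
      DW.Eint \<epsilon> u UNIV \<le> real N * c\<^sub>0 + C * \<epsilon> ^ k \<Longrightarrow>
      DW.Eint \<epsilon> u UNIV \<ge> real N * c\<^sub>0 - C' * \<epsilon> ^ k"
  proof (rule DW.windows_lower_bound[OF \<open>finite J\<close> r(1) _ r(3) v _ _ _ C, where l = l and k = k])
    show "a \<le> x - r \<and> x + r \<le> b" if "x \<in> J" for x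
      using dl[OF that] r(2)[OF that] by auto
    show "l x \<in> {-1, 1}" if "x \<in> J" for x
      using dl[OF that] by blast
    show "v y = l x" if "x \<in> J" "y \<in> {x - r<..<x}" for x y
      using dl[OF that(1)] r(2)[OF that(1)] that(2) by auto
    show "v y = - l x" if "x \<in> J" "y \<in> {x<..<x + r}" for x y
      using dl[OF that(1)] r(2)[OF that(1)] that(2) by auto
  qed (use that in \<open>auto simp: cardJ c\<^sub>0\<close>)
  \<comment> \<open>The constant of \<open>slow_motion\<close> with \<open>A = C + C'\<close>, the
    gap between the upper energy bound at time 0 and the lower bound at time
    \<open>t\<close>.\<close>
  define \<Lambda> where "\<Lambda> = (C + C') / (2 * \<sigma>) + (b - a) * m / 2"
  define \<omega> where "\<omega> \<epsilon> = L1_norm a b (\<lambda>x. u\<^sub>0 \<epsilon> x - v x) + \<Lambda> * sqrt \<epsilon>" for \<epsilon>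
  have "((\<lambda>\<epsilon>. sqrt \<epsilon>) \<longlongrightarrow> sqrt 0) (at_right (0::real))"
    by (intro tendsto_intros)
  then have "(\<omega> \<longlongrightarrow> 0 + \<Lambda> * sqrt 0) (at_right 0)"
    unfolding \<omega>_def by (intro tendsto_intros assms(23))
  then have \<omega>0: "(\<omega> \<longlongrightarrow> 0) (at_right 0)" by simp
  then have ev_\<omega>: "\<forall>\<^sub>F \<epsilon> in at_right 0. \<omega> \<epsilon> < \<delta>"
    using \<delta> by (rule order_tendstoD(2))
  have ev_\<epsilon>: "\<forall>\<^sub>F \<epsilon> in at_right (0::real). 0 < \<epsilon> \<and> \<epsilon> \<le> 1"
    by (auto simp: eventually_at_right_field intro: exI[of _ 1])
  have close: "\<forall>\<^sub>F \<epsilon> in at_right 0. \<forall>t\<in>{0..m / \<epsilon> ^ k}. L1_norm a b (\<lambda>x. u \<epsilon> t x - v x) \<le> \<omega> \<epsilon>"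
    using ev_\<epsilon> ev_\<omega> ev_energy assms(22,25)
  proof eventually_elim
    case (elim \<epsilon>)
    then have small: "\<epsilon> > 0" "\<epsilon> \<le> 1" by auto
    interpret energy_space a b \<tau> \<epsilon>
      using \<open>\<tau> > 0\<close> small by unfold_locales
    interpret damped_wave a b \<tau> \<epsilon> \<sigma> f "\<lambda>s. - deriv (deriv F) s" g F "(u\<^sub>0 \<epsilon>, u\<^sub>1 \<epsilon>)" "u \<epsilon>" "u\<^sub>t \<epsilon>"
    proof
      show "(F has_real_derivative - f s) (at s)" for s
        using F'(1) by (simp add: \<open>f = _\<close>)
      show "(f has_real_derivative - deriv (deriv F) s) (at s)" for s
        unfolding \<open>f = _\<close> by (intro DERIV_minus F'(2))
      show "continuous_on UNIV (\<lambda>s. - deriv (deriv F) s)"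
        by (intro continuous_intros F'(3))
      show "continuous_on UNIV g" by (rule lipschitz_near_continuous[OF assms(3)])
      show "(u\<^sub>0 \<epsilon>, u\<^sub>1 \<epsilon>) \<in> X_space a b" using elim by (simp add: X_space_def)
    qed (use assms(4,5) elim in auto)
    have E0: "E 0 / \<epsilon> \<le> real N * c\<^sub>0 + C * \<epsilon> ^ k"
      using elim(3) initial_energy_density by simp
    show ?case
      unfolding \<omega>_def \<Lambda>_def
    proof (rule ballI, rule slow_motion[OF v, where \<delta> = \<delta> and k = k and m = m and A = "C + C'", simplified fst_conv])
      show "0 \<le> C + C'" using C C' by simp
      show "L1_norm a b (\<lambda>x. u\<^sub>0 \<epsilon> x - v x) + ((C + C') / (2 * \<sigma>) + (b - a) * m / 2) * sqrt \<epsilon> < \<delta>"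
        using elim(2) by (simp add: \<omega>_def \<Lambda>_def)
      fix t
      assume t: "0 \<le> t" "L1_norm a b (\<lambda>x. u \<epsilon> t x - v x) \<le> \<delta>"
      have Eint: "DW.Eint \<epsilon> (u \<epsilon> t) UNIV \<le> E t / \<epsilon>"
        using energy_ge_gradient_part[OF t(1)] by (simp add: DW.Eint_def DW.density_def)
      have "E t / \<epsilon> \<le> E 0 / \<epsilon>"
        using energy_le[OF t(1)] \<epsilon> by (simp add: divide_right_mono)
      with Eint E0 have "DW.Eint \<epsilon> (u \<epsilon> t) UNIV \<le> real N * c\<^sub>0 + C * \<epsilon> ^ k" by linarith
      from lower[OF small uw_mem(1)[OF t(1)] t(2) this] Eint E0
      have "E 0 / \<epsilon> - E t / \<epsilon> \<le> (C + C') * \<epsilon> ^ k" by (simp add: distrib_right)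
      \<comment> \<open>\<open>E\<close> is \<epsilon> times the energy, which turns the gap of
        order \<open>k\<close> into a drop of order \<open>k + 1\<close>.\<close>
      then have "\<epsilon> * (E 0 / \<epsilon> - E t / \<epsilon>) \<le> \<epsilon> * ((C + C') * \<epsilon> ^ k)"
        using \<epsilon> by (intro mult_left_mono) auto
      then show "E 0 - E t \<le> (C + C') * \<epsilon> ^ (k + 1)"
        using \<epsilon> by (simp add: right_diff_distrib mult.left_commute)
    qed
  qed
  \<comment> \<open>The supremum is taken in the extended reals, so a bound valid at all times
    bounds it directly; the lower bound 0 comes from the time \<open>0\<close>.\<close>
  show ?thesis
  proof (rule tendsto_sandwich)
    show "((\<lambda>_. 0) \<longlongrightarrow> (0::ereal)) (at_right (0::real))" by (rule tendsto_const)
    show "((\<lambda>\<epsilon>. ereal (\<omega> \<epsilon>)) \<longlongrightarrow> 0) (at_right 0)"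
      using \<omega>0 by (simp add: zero_ereal_def)
    show "\<forall>\<^sub>F \<epsilon> in at_right 0. 0 \<le> (SUP t\<in>{0..m / \<epsilon> ^ k}. ereal (L1_norm a b (\<lambda>x. u \<epsilon> t x - v x)))"
      using ev_\<epsilon>
    proof eventually_elim
      case (elim \<epsilon>)
      have "0 \<in> {0..m / \<epsilon> ^ k}" using elim \<open>m > 0\<close> by simp
      then show ?case
        by (rule SUP_upper2) (simp add: L1_norm_def)
    qed
    show "\<forall>\<^sub>F \<epsilon> in at_right 0. (SUP t\<in>{0..m / \<epsilon> ^ k}. ereal (L1_norm a b (\<lambda>x. u \<epsilon> t x - v x))) \<le> ereal (\<omega> \<epsilon>)"
      using close by eventually_elim (auto intro!: SUP_least)
  qed
qed

end
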